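(* Let $g(u;a)=u(1-u)(u-a)$ be the standard cubic nonlinearity and let $0<\delta_a<\frac14$. For $a \in (0,1)$ and $k>1$ write $d(a,k)=(a-\tfrac12)^2\frac{k+1}{(k-1)^2}$. Then there exists $k_*>1$ so that the following properties hold for all $a\in[\frac12+\delta_a,1-\delta_a]$ and all real $k\in(1,k_* )$. (i) $|c(a,d(a,k),k)|\le d(a,k)^{-1/4}$. (ii) $c(a,d,k)<0$ whenever $d>d(a,k)\big[1+d(a,k)^{-1/4}\big]$. (iii) $c(a,d,k)>0$ whenever $\frac12 d(a,k)<d<d(a,k)\big[1-d(a,k)^{-1/4}\big]$.
   Context: For $a\in(0,1)$, $d>0$, $k>0$, set $h=h(d,k)=\frac{\sqrt2}{\sqrt d\sqrt{k+1}}$. The number $c(a,d,k)$ is the unique wavespeed $c\in\mathbb{R}$ for which there exists a non-decreasing profile $\Phi:\mathbb{R}\to\mathbb{R}$ with $$-c\,\Phi'(\xi)=\frac{\Phi(\xi+h)-2\Phi(\xi)+\Phi(\xi-h)}{h^2}+\frac{2(k-1)}{h(k+1)}\,\frac{\Phi(\xi+h)-\Phi(\xi-h)}{2h}+g(\Phi(\xi);a),$$ $\Phi(-\infty)=0$, $\Phi(+\infty)=1$ (for $c=0$ this is a pure difference equation). Existence of such a pair $(c,\Phi)$ and uniqueness of $c$ is a known result of Mallet-Paret (1999). The pair corresponds to a travelling front $u_i(t)=\Phi(ih(d,k)-ct)$ of the lattice equation $\dot u_i=d\big(ku_{i+1}-(k+1)u_i+u_{i-1}\big)+g(u_i;a)$,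 $i\in\mathbb{Z}$. *)

theory Defs
  imports Complex_Main "HOL-Analysis.Analysis"
begin

definition cubic :: "real \<Rightarrow> real \<Rightarrow> real"
  where "cubic u a = u * (1 - u) * (u - a)"

definition mesh :: "real \<Rightarrow> real \<Rightarrow> real"
  where "mesh d k = sqrt 2 / (sqrt d * sqrt (k + 1))"

text \<open>
  The lattice equation is
  \<open>u_i' = d * (k * u_{i+1} - (k + 1) * u_i + u_{i-1}) + cubic u_i a\<close>,
  and \<open>u_i(t) = \<Phi> (i * mesh d k - c * t)\<close> is the corresponding front.
  For \<open>c = 0\<close> the profile equation is a pure difference equation and the profile need not even
  be continuous, so differentiability is required only when \<open>c \<noteq> 0\<close>; the value of
  \<open>deriv \<Phi> \<xi>\<close> is then multiplied by zero and plays no role.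
\<close>

definition front :: "real \<Rightarrow> real \<Rightarrow> real \<Rightarrow> real \<Rightarrow> (real \<Rightarrow> real) \<Rightarrow> bool"
  where "front a d k c \<Phi> \<longleftrightarrow>
    (let h = mesh d k in
      mono \<Phi> \<and>
      (c \<noteq> 0 \<longrightarrow> (\<forall>\<xi>. \<Phi> field_differentiable (at \<xi>))) \<and>
      (\<forall>\<xi>. - c * deriv \<Phi> \<xi> =
          (\<Phi> (\<xi> + h) - 2 * \<Phi> \<xi> + \<Phi> (\<xi> - h)) / h\<^sup>2
          + 2 * (k - 1) / (h * (k + 1)) * ((\<Phi> (\<xi> + h) - \<Phi> (\<xi> - h)) / (2 * h))
          + cubic (\<Phi> \<xi>) a) \<and>
      (\<Phi> \<longlongrightarrow> 0) at_bot \<and> (\<Phi> \<longlongrightarrow> 1) at_top)"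

text \<open>
  For \<open>0 < a < 1\<close>, \<open>d > 0\<close> and \<open>k > 0\<close> there is exactly one such speed (Mallet-Paret, 1999).
\<close>

definition wavespeed :: "real \<Rightarrow> real \<Rightarrow> real \<Rightarrow> real"
  where "wavespeed a d k = (THE c. \<exists>\<Phi>. front a d k c \<Phi>)"

definition dcrit :: "real \<Rightarrow> real \<Rightarrow> real"
  where "dcrit a k = (a - 1/2)\<^sup>2 * ((k + 1) / (k - 1)\<^sup>2)"

end

theory Submission
  imports Defs "HOL-Probability.Distributions" "HOL-Probability.Helly_Selection"
begin

text \<open>
  As \<open>h\<close> tends to 0 the profile equation becomes \<open>-c \<Phi>' = \<Phi>'' + 2 (k - 1) / (h (k + 1)) \<Phi>' + g(\<Phi>)\<close>, which
  the logistic function \<open>1 / (1 + exp (- x / sqrt 2))\<close> solves exactly, with speed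
  \<open>c = sqrt 2 (a - 1/2) - 2 (k - 1) / (h (k + 1))\<close>.  This speed vanishes precisely at \<open>d = dcrit a k\<close>, and
  \<open>dcrit a k\<close> tends to infinity as \<open>k\<close> tends to 1.  On the lattice the logistic profile is no longer exact,
  but its residual is its derivative times a quantity known up to \<open>O(h)\<close>.  Comparing the front with it
  therefore determines the speed up to \<open>O(h)\<close>, whereas at relative distance \<open>dcrit a k powr (-1/4)\<close> from the critical
  diffusion the limiting speed is already of order \<open>sqrt h\<close>.  What remains is to have the comparison
  principle, and to know that the front exists and that its speed is unique.
  
  For all three the equation is written as a fixed point problem.  With \<open>M = d (k + 1) + 2\<close> and \<open>v = c / M\<close> it reads
  \<open>v \<Phi>' - \<Phi> + G \<Phi> = 0\<close>, where \<open>G \<Phi> x = p \<Phi>(x + h) + q \<Phi>(x - h) + r(\<Phi> x)\<close> preserves the order.  The bounded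
  solutions are the fixed points of \<open>T v \<Phi> x = E[G \<Phi> (x + v S)]\<close> with an exponentially distributed time
  \<open>S\<close> of mean 1.  The operator treats \<open>v < 0\<close>, \<open>v = 0\<close> and \<open>v > 0\<close> alike, asks for no regularity of \<open>\<Phi>\<close>, preserves
  the order, commutes with translations, and increases with \<open>v\<close> on monotone profiles (\<open>front_iff\<close> gives the
  equivalence with the original equation).
  
  Comparison (\<open>sliding\<close>): a subsolution \<open>\<Phi> \<le> T v \<Phi>\<close> starting at 0 and a continuous strict supersolution
  \<open>T v \<psi> < \<psi>\<close> with the same \<open>v\<close> cannot coexist.  Shifted far enough, \<open>\<Phi>\<close> lies below \<open>\<psi>\<close>, because near the stable
  states 0 and 1 the operator contracts differences (\<open>tail_comparison\<close>); moving \<open>\<Phi>\<close> back to the first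
  contact leaves a uniform gap on compact sets, by strictness, and the tails are again controlled
  by the contraction, so that \<open>\<Phi>\<close> can be moved still further.
  
  Uniqueness (\<open>front_speed_unique\<close>): of two fronts with different speeds one has nonzero speed and is therefore
  continuous, and it is a strict super- or subsolution for the speed of the other.
  
  Existence (\<open>front_exists\<close>): let \<open>v\<close> be the infimum of the speeds that admit a nonzero subsolution starting at
  0.  By Helly's theorem \<open>v\<close> admits one itself.  For a speed below \<open>v\<close>, an obstacle problem
  has a solution that is forced to be small on the left of 0 and to equal 1 on the right of \<open>N\<close>; as \<open>N\<close> grows
  its transition must run away from the left obstacle, for otherwise a subsolution would remain
  in the limit.  Recentring at the transition and letting the speed tend to \<open>v\<close> produces a supersolution.
  The translated subsolution lies below this supersolution, and between the two there is a fixed point.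
  Its limit at infinity is \<open>a\<close> or 1; the value \<open>a\<close> is excluded by comparison with a logistic profile that climbs to
  a level between \<open>a\<close> and 1 (\<open>no_sub_below_a\<close>, \<open>residual_low\<close>).
\<close>

section \<open>Profiles and the wave operator\<close>

definition profile :: "(real \<Rightarrow> real) \<Rightarrow> bool"
  where "profile \<Phi> \<longleftrightarrow> mono \<Phi> \<and> (\<forall>x. 0 \<le> \<Phi> x \<and> \<Phi> x \<le> 1)"

lemma profileI: "mono \<Phi> \<Longrightarrow> (\<And>x. 0 \<le> \<Phi> x) \<Longrightarrow> (\<And>x. \<Phi> x \<le> 1) \<Longrightarrow> profile \<Phi>"
  by (auto simp: profile_def)

lemma profileD:
  assumes "profile \<Phi>"
  shows "mono \<Phi>" "0 \<le> \<Phi> x" "\<Phi> x \<le> 1" "\<bar>\<Phi> x\<bar> \<le> 1"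
  using assms by (auto simp: profile_def mono_def)

lemma profile_le: "profile \<Phi> \<Longrightarrow> x \<le> y \<Longrightarrow> \<Phi> x \<le> \<Phi> y"
  by (auto simp: profile_def mono_def)

lemma profile_shift: "profile \<Phi> \<Longrightarrow> profile (\<lambda>x. \<Phi> (x + s))"
  by (auto simp: profile_def mono_def)

lemma profile_countable_discont:
  assumes "profile \<Phi>" shows "countable {x. \<not> isCont \<Phi> x}"
  using mono_ctble_discont profileD(1)[OF assms] by blast

lemma profile_of_limits:
  assumes "mono \<Phi>" "(\<Phi> \<longlongrightarrow> 0) at_bot" "(\<Phi> \<longlongrightarrow> 1) at_top" shows "profile \<Phi>"
proof (rule profileI[OF assms(1)])
  fix x :: real
  have "\<forall>\<^sub>F y in at_bot. \<Phi> y \<le> \<Phi> x"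
    unfolding eventually_at_bot_linorder using monoD[OF assms(1)] by blast
  then show "0 \<le> \<Phi> x" by (rule tendsto_upperbound[OF assms(2)]) simp
  have "\<forall>\<^sub>F y in at_top. \<Phi> x \<le> \<Phi> y"
    unfolding eventually_at_top_linorder using monoD[OF assms(1)] by blast
  then show "\<Phi> x \<le> 1" by (rule tendsto_lowerbound[OF assms(3)]) simp
qed

definition waiting_time :: "real measure"
  where "waiting_time = density lborel (exponential_density 1)"

lemma prob_space_waiting_time: "prob_space waiting_time"
  unfolding waiting_time_def by (rule prob_space_exponential_density) simp

lemma sets_waiting_time [simp, measurable_cong]: "sets waiting_time = sets borel"
  by (simp add: waiting_time_def)

lemma space_waiting_time [simp]: "space waiting_time = UNIV"
  by (simp add: waiting_time_def)

lemma measure_waiting_time_UNIV [simp]: "measure waiting_time UNIV = 1"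
  using prob_space.prob_space[OF prob_space_waiting_time] by simp

lemma AE_waiting_time_iff: "(AE s in waiting_time. P s) \<longleftrightarrow> (AE s in lborel. 0 \<le> s \<longrightarrow> P s)"
  unfolding waiting_time_def
  by (subst AE_density) (auto simp: exponential_density_def)

lemma integral_waiting_time:
  fixes f :: "real \<Rightarrow> real"
  assumes [measurable]: "f \<in> borel_measurable borel"
  shows "integral\<^sup>L waiting_time f = (LINT s:{0..}|lborel. exp (- s) * f s)"
  unfolding waiting_time_def set_lebesgue_integral_def
  by (subst integral_real_density)
     (auto simp: exponential_density_def intro!: Bochner_Integration.integral_cong)

lemma integrable_waiting_time:
  fixes f :: "real \<Rightarrow> real"
  assumes "f \<in> borel_measurable borel" "\<And>x. \<bar>f x\<bar> \<le> B"
  shows "integrable waiting_time f"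
proof -
  interpret prob_space waiting_time by (rule prob_space_waiting_time)
  show ?thesis using assms by (intro integrable_const_bound[where B=B]) auto
qed

text \<open>
  The part of the profile equation that preserves the order, after the multiple \<open>M \<Phi>\<close> that makes the
  reaction term increasing has been split off and everything has been divided by \<open>M\<close>.
\<close>
definition hop :: "real \<Rightarrow> real \<Rightarrow> real \<Rightarrow> (real \<Rightarrow> real) \<Rightarrow> (real \<Rightarrow> real) \<Rightarrow> real \<Rightarrow> real"
  where "hop p q h r \<Phi> x = p * \<Phi> (x + h) + q * \<Phi> (x - h) + r (\<Phi> x)"

text \<open>
  The resolvent of the transport term \<open>v \<Phi>'\<close>, applied to \<open>G \<Phi>\<close>: fixed points are the mild solutions
  of \<open>v \<Phi>' - \<Phi> + G \<Phi> = 0\<close>, for \<open>v = 0\<close> the solutions of the difference equation \<open>\<Phi> = G \<Phi>\<close>.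
\<close>
definition wave_op ::
    "real \<Rightarrow> real \<Rightarrow> real \<Rightarrow> (real \<Rightarrow> real) \<Rightarrow> real \<Rightarrow> (real \<Rightarrow> real) \<Rightarrow> real \<Rightarrow> real"
  where "wave_op p q h r v \<Phi> x = integral\<^sup>L waiting_time (\<lambda>s. hop p q h r \<Phi> (x + v * s))"

lemma wave_op_zero: "wave_op p q h r 0 \<Phi> x = hop p q h r \<Phi> x"
proof -
  interpret prob_space waiting_time by (rule prob_space_waiting_time)
  show ?thesis by (simp add: wave_op_def)
qed

lemma wave_op_shift: "wave_op p q h r v (\<lambda>x. \<Phi> (x + t)) x = wave_op p q h r v \<Phi> (x + t)"
proof -
  have "hop p q h r (\<lambda>x. \<Phi> (x + t)) y = hop p q h r \<Phi> (y + t)" for y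
    by (simp add: hop_def algebra_simps)
  then show ?thesis by (simp add: wave_op_def add.assoc add.commute)
qed

text \<open>
  Monotonicity of \<open>r\<close> makes the operator preserve the order, and its values at 0 and 1 make it map
  profiles to profiles.  The constant \<open>u\<close> is a
  subsolution iff \<open>(1 - p - q) u \<le> r u\<close>: the sign of \<open>r u - (1 - p - q) u\<close> is the sign of the reaction term.
\<close>
locale hopping =
  fixes p q h :: real and r :: "real \<Rightarrow> real"
  assumes p_pos: "0 < p" and q_pos: "0 < q" and h_pos: "0 < h" and pq: "p + q < 1"
    and r_mono: "mono_on {0..1} r" and r_cont: "continuous_on {0..1} r"
    and r_0: "r 0 = 0" and r_1: "r 1 \<le> 1 - p - q"
begin

abbreviation "G \<equiv> hop p q h r"
abbreviation "T \<equiv> wave_op p q h r"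

lemma r_le: "0 \<le> u \<Longrightarrow> u \<le> w \<Longrightarrow> w \<le> 1 \<Longrightarrow> r u \<le> r w"
  using r_mono by (auto simp: mono_on_def)

lemma r_nonneg: "0 \<le> u \<Longrightarrow> u \<le> 1 \<Longrightarrow> 0 \<le> r u"
  using r_le[of 0 u] r_0 by simp

lemma G_mono:
  assumes "profile \<Phi>" "profile \<Psi>" and "\<And>z. z \<in> {-h, 0, h} \<Longrightarrow> \<Phi> (x + z) \<le> \<Psi> (y + z)"
  shows "G \<Phi> x \<le> G \<Psi> y"
proof -
  have "\<Phi> (x + h) \<le> \<Psi> (y + h)" "\<Phi> (x - h) \<le> \<Psi> (y - h)" "\<Phi> x \<le> \<Psi> y"
    using assms(3)[of h] assms(3)[of "-h"] assms(3)[of 0] by auto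
  then show ?thesis unfolding hop_def
    using p_pos q_pos assms(1,2)[THEN profileD(2)] assms(1,2)[THEN profileD(3)]
    by (intro add_mono mult_left_mono r_le) auto
qed

lemma profile_G:
  assumes "profile \<Phi>" shows "profile (G \<Phi>)"
proof (rule profileI)
  show "mono (G \<Phi>)"
    by (intro monoI G_mono assms profile_le[OF assms]) auto
  show "0 \<le> G \<Phi> x" for x unfolding hop_def
    using p_pos q_pos profileD[OF assms]
    by (intro add_nonneg_nonneg mult_nonneg_nonneg r_nonneg) auto
  show "G \<Phi> x \<le> 1" for x
  proof -
    have "p * \<Phi> (x + h) \<le> p" "q * \<Phi> (x - h) \<le> q"
      using p_pos q_pos profileD[OF assms] by (auto intro!: mult_left_le)
    moreover have "r (\<Phi> x) \<le> r 1" using profileD[OF assms] by (intro r_le) auto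
    ultimately show ?thesis unfolding hop_def using r_1 by linarith
  qed
qed

lemma G_measurable [measurable]:
  assumes "profile \<Phi>" shows "G \<Phi> \<in> borel_measurable borel"
  by (rule borel_measurable_mono[OF profileD(1)[OF profile_G[OF assms]]])

lemma G_integrable:
  assumes "profile \<Phi>" shows "integrable waiting_time (\<lambda>s. G \<Phi> (x + v * s))"
proof (rule integrable_waiting_time)
  have [measurable]: "G \<Phi> \<in> borel_measurable borel" by (rule G_measurable[OF assms])
  show "(\<lambda>s. G \<Phi> (x + v * s)) \<in> borel_measurable borel" by measurable
  show "\<bar>G \<Phi> (x + v * s)\<bar> \<le> 1" for s by (rule profileD(4)[OF profile_G[OF assms]])
qed

lemma AE_waiting_time_nonneg: "AE s in waiting_time. 0 \<le> s"
  by (simp add: AE_waiting_time_iff)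

lemma T_mono:
  assumes "profile \<Phi>" "profile \<Psi>" and "\<And>s. 0 \<le> s \<Longrightarrow> G \<Phi> (x + v * s) \<le> G \<Psi> (y + w * s)"
  shows "T v \<Phi> x \<le> T w \<Psi> y"
  unfolding wave_op_def
  by (rule integral_mono_AE[OF G_integrable[OF assms(1)] G_integrable[OF assms(2)]])
     (use AE_waiting_time_nonneg in eventually_elim, rule assms(3))

lemma T_mono_profile:
  assumes "profile \<Phi>" "profile \<Psi>" and "\<And>x. \<Phi> x \<le> \<Psi> x"
  shows "T v \<Phi> x \<le> T v \<Psi> x"
  using assms by (intro T_mono G_mono) auto

lemma T_mono_speed:
  assumes "profile \<Phi>" "v \<le> w" shows "T v \<Phi> x \<le> T w \<Phi> x"
  using assms by (intro T_mono monoD[OF profileD(1)[OF profile_G]]) (auto intro: mult_right_mono)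

lemma profile_T:
  assumes "profile \<Phi>" shows "profile (T v \<Phi>)"
proof (rule profileI)
  interpret prob_space waiting_time by (rule prob_space_waiting_time)
  show "mono (T v \<Phi>)"
    using assms by (intro monoI T_mono monoD[OF profileD(1)[OF profile_G]]) auto
  show "0 \<le> T v \<Phi> x" for x unfolding wave_op_def
    by (intro integral_nonneg_AE AE_I2 profileD(2)[OF profile_G[OF assms]])
  have "integral\<^sup>L waiting_time (\<lambda>s. G \<Phi> (x + v * s)) \<le> integral\<^sup>L waiting_time (\<lambda>s. 1)" for x
    by (intro integral_mono_AE G_integrable assms AE_I2 profileD(3)[OF profile_G[OF assms]]) simp
  then show "T v \<Phi> x \<le> 1" for x
    by (simp add: wave_op_def)
qed

lemma G_tendsto:
  assumes "\<And>n. profile (\<Phi>' n)" "profile \<Phi>"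
    and "\<And>z. z \<in> {-h, 0, h} \<Longrightarrow> (\<lambda>n. \<Phi>' n (y' n + z)) \<longlonglongrightarrow> \<Phi> (y + z)"
  shows "(\<lambda>n. G (\<Phi>' n) (y' n)) \<longlonglongrightarrow> G \<Phi> y"
proof -
  have l: "(\<lambda>n. \<Phi>' n (y' n + h)) \<longlonglongrightarrow> \<Phi> (y + h)" "(\<lambda>n. \<Phi>' n (y' n - h)) \<longlonglongrightarrow> \<Phi> (y - h)"
     "(\<lambda>n. \<Phi>' n (y' n)) \<longlonglongrightarrow> \<Phi> y"
    using assms(3)[of h] assms(3)[of "-h"] assms(3)[of 0] by auto
  have "(\<lambda>n. r (\<Phi>' n (y' n))) \<longlonglongrightarrow> r (\<Phi> y)"
    by (rule continuous_on_tendsto_compose[OF r_cont l(3)])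
       (use profileD(2,3)[OF assms(2)] profileD(2,3)[OF assms(1)] in auto)
  then show ?thesis unfolding hop_def by (intro tendsto_intros l)
qed

text \<open>
  Dominated convergence, in the generality in which profile, speed and base point vary together.
  Only almost every waiting time matters, which is what makes pointwise convergence at the continuity
  points of the limit sufficient below.
\<close>
lemma T_tendsto:
  assumes \<Phi>': "\<And>n. profile (\<Phi>' n)" and \<Phi>: "profile \<Phi>"
    and lim: "AE s in waiting_time. \<forall>z\<in>{-h, 0, h}.
      (\<lambda>n. \<Phi>' n (x' n + v' n * s + z)) \<longlonglongrightarrow> \<Phi> (x + v * s + z)"
  shows "(\<lambda>n. T (v' n) (\<Phi>' n) (x' n)) \<longlonglongrightarrow> T v \<Phi> x"
  unfolding wave_op_def
proof (rule integral_dominated_convergence[where w="\<lambda>_. 1"])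
  interpret prob_space waiting_time by (rule prob_space_waiting_time)
  show "integrable waiting_time (\<lambda>_. 1::real)" by simp
  show "(\<lambda>s. G \<Phi> (x + v * s)) \<in> borel_measurable waiting_time"
    using G_integrable[OF \<Phi>] by (rule borel_measurable_integrable)
  show "(\<lambda>s. G (\<Phi>' n) (x' n + v' n * s)) \<in> borel_measurable waiting_time" for n
    using G_integrable[OF \<Phi>'] by (rule borel_measurable_integrable)
  show "AE s in waiting_time. (\<lambda>n. G (\<Phi>' n) (x' n + v' n * s)) \<longlonglongrightarrow> G \<Phi> (x + v * s)"
    using lim by eventually_elim (intro G_tendsto \<Phi>' \<Phi>, auto)
  show "AE s in waiting_time. norm (G (\<Phi>' n) (x' n + v' n * s)) \<le> 1" for n
    using profileD[OF profile_G[OF \<Phi>']] by (intro AE_I2) auto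
qed

lemma T_continuous:
  assumes \<Phi>: "profile \<Phi>" and c: "\<And>x. isCont \<Phi> x"
  shows "isCont (T v \<Phi>) x"
  unfolding continuous_at_sequentially comp_def
proof (intro allI impI)
  fix x' assume x': "x' \<longlonglongrightarrow> x"
  show "(\<lambda>n. T v \<Phi> (x' n)) \<longlonglongrightarrow> T v \<Phi> x"
    by (rule T_tendsto[where v'="\<lambda>_. v" and \<Phi>'="\<lambda>_. \<Phi>"])
       (auto intro!: \<Phi> AE_I2 isCont_tendsto_compose[OF c] tendsto_intros x')
qed

text \<open>
  For \<open>v = 0\<close> the random point \<open>x + v S\<close> is deterministic, so that \<open>x\<close> itself has to keep away from the
  exceptional set; for any other \<open>v\<close> its law has no atoms.
\<close>
lemma AE_avoids_countable:
  assumes "countable D" "v = 0 \<Longrightarrow> \<forall>z\<in>{-h, 0, h}. x + z \<notin> D"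
  shows "AE s in waiting_time. \<forall>z\<in>{-h, 0, h}. x + v * s + z \<notin> D"
proof (cases "v = 0")
  case True then show ?thesis using assms by auto
next
  case False
  have "countable (\<Union>z\<in>{-h, 0, h}. (\<lambda>y. (y - z - x) / v) ` D)"
    using assms(1) by auto
  then have "AE s in lborel. s \<notin> (\<Union>z\<in>{-h, 0, h}. (\<lambda>y. (y - z - x) / v) ` D)"
    by (intro AE_not_in countable_imp_null_set_lborel)
  then have "AE s in lborel. \<forall>z\<in>{-h, 0, h}. x + v * s + z \<notin> D"
  proof eventually_elim
    case (elim s)
    have "s = ((x + v * s + z) - z - x) / v" for z using False by simp
    with elim show ?case by blast
  qed
  then show ?thesis unfolding AE_waiting_time_iff by eventually_elim auto
qed

text \<open>
  A moving front is automatically continuous, because averaging over \<open>S\<close> removes the countably many jumps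
  of a monotone function.
\<close>
lemma T_continuous_nonzero:
  assumes \<Phi>: "profile \<Phi>" and "v \<noteq> 0"
  shows "isCont (T v \<Phi>) x"
  unfolding continuous_at_sequentially comp_def
proof (intro allI impI)
  fix x' assume x': "x' \<longlonglongrightarrow> x"
  have "AE s in waiting_time. \<forall>z\<in>{-h, 0, h}. x + v * s + z \<notin> {x. \<not> isCont \<Phi> x}"
    by (rule AE_avoids_countable) (use profile_countable_discont[OF \<Phi>] \<open>v \<noteq> 0\<close> in auto)
  then have "AE s in waiting_time. \<forall>z\<in>{-h, 0, h}.
      (\<lambda>n. \<Phi> (x' n + v * s + z)) \<longlonglongrightarrow> \<Phi> (x + v * s + z)"
  proof eventually_elim
    case (elim s)
    then show ?case by (intro ballI isCont_tendsto_compose[where g=\<Phi>] tendsto_intros x') auto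
  qed
  from T_tendsto[where v'="\<lambda>_. v" and \<Phi>'="\<lambda>_. \<Phi>", OF \<Phi> \<Phi> this]
  show "(\<lambda>n. T v \<Phi> (x' n)) \<longlonglongrightarrow> T v \<Phi> x" .
qed

lemma T_tendsto_right:
  assumes \<Phi>: "profile \<Phi>" and \<Psi>: "profile \<Psi>"
    and R: "\<And>y. (\<Phi> \<longlongrightarrow> \<Psi> y) (at_right y)"
    and x': "x' \<longlonglongrightarrow> x" "\<And>n. x < x' n"
  shows "(\<lambda>n. T v \<Phi> (x' n)) \<longlonglongrightarrow> T v \<Psi> x"
proof (rule T_tendsto[where v'="\<lambda>_. v" and \<Phi>'="\<lambda>_. \<Phi>"])
  show "AE s in waiting_time. \<forall>z\<in>{-h, 0, h}. (\<lambda>n. \<Phi> (x' n + v * s + z)) \<longlonglongrightarrow> \<Psi> (x + v * s + z)"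
  proof (intro AE_I2 ballI)
    fix s z
    have "filterlim (\<lambda>n. x' n + v * s + z) (at_right (x + v * s + z)) sequentially"
      unfolding filterlim_at using x'
      by (auto intro!: tendsto_intros always_eventually)
    from filterlim_compose[OF R this]
    show "(\<lambda>n. \<Phi> (x' n + v * s + z)) \<longlonglongrightarrow> \<Psi> (x + v * s + z)" .
  qed
qed (use assms in auto)

lemma T_tendsto_end:
  assumes \<Phi>: "profile \<Phi>" and l: "0 \<le> l" "l \<le> 1" and lim: "\<And>y. (\<lambda>n. \<Phi> (x' n + y)) \<longlonglongrightarrow> l"
  shows "(\<lambda>n. T v \<Phi> (x' n)) \<longlonglongrightarrow> (p + q) * l + r l"
proof -
  interpret prob_space waiting_time by (rule prob_space_waiting_time)
  have "(\<lambda>n. T v \<Phi> (x' n)) \<longlonglongrightarrow> T v (\<lambda>_. l) 0"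
  proof (rule T_tendsto[where v'="\<lambda>_. v" and \<Phi>'="\<lambda>_. \<Phi>"])
    show "profile (\<lambda>_. l)" using l by (auto intro!: profileI monoI)
  qed (auto simp: add.assoc intro!: AE_I2 \<Phi> lim)
  also have "T v (\<lambda>_. l) 0 = (p + q) * l + r l"
    by (simp add: wave_op_def hop_def algebra_simps)
  finally show ?thesis .
qed

end

section \<open>Comparison by sliding\<close>

context hopping
begin

text \<open>
  Let \<open>m\<close> be the largest excess of \<open>\<Phi>\<close> over \<open>\<psi>\<close>.  At points where \<open>\<Phi>\<close> exceeds \<open>\<psi>\<close> stability reduces the local
  contribution to \<open>(1 - p - q - \<gamma>) m\<close>; at all other points the local contribution is not positive.  So one
  application of the operator reduces the excess to \<open>(1 - \<gamma>) m\<close>, and \<open>m = 0\<close>.  No maximum has to be attained,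
  and no derivative at a maximum is taken.
\<close>
lemma tail_comparison:
  assumes \<Phi>: "profile \<Phi>" and \<psi>: "profile \<psi>"
    and sub: "\<And>x. \<Phi> x \<le> T v \<Phi> x" and super: "\<And>x. T v \<psi> x \<le> \<psi> x"
    and \<gamma>: "0 < \<gamma>" "\<gamma> \<le> 1 - p - q"
    and stable: "\<And>y. \<psi> y < \<Phi> y \<Longrightarrow> r (\<Phi> y) - r (\<psi> y) \<le> (1 - p - q - \<gamma>) * (\<Phi> y - \<psi> y)"
  shows "\<Phi> x \<le> \<psi> x"
proof -
  define w where "w y = max 0 (\<Phi> y - \<psi> y)" for y
  define m where "m = (SUP y. w y)"
  have "w y \<le> 1" for y
    using profileD(3)[OF \<Phi>, of y] profileD(2)[OF \<psi>, of y] by (auto simp: w_def)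
  then have bdd: "bdd_above (range w)" by (intro bdd_aboveI2)
  have w_le: "w y \<le> m" for y
    unfolding m_def by (rule cSUP_upper[OF _ bdd]) simp
  have m0: "0 \<le> m" using w_le[of 0] by (auto simp: w_def)
  have diff: "\<Phi> y - \<psi> y \<le> m" for y using w_le[of y] by (auto simp: w_def)
  have G_diff: "G \<Phi> y \<le> G \<psi> y + (1 - \<gamma>) * m" for y
  proof -
    have a: "p * (\<Phi> (y + h) - \<psi> (y + h)) \<le> p * m" "q * (\<Phi> (y - h) - \<psi> (y - h)) \<le> q * m"
      using p_pos q_pos diff by (auto intro: mult_left_mono)
    have "r (\<Phi> y) - r (\<psi> y) \<le> (1 - p - q - \<gamma>) * m"
    proof (cases "\<psi> y < \<Phi> y")
      case True
      from stable[OF this] show ?thesis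
        using mult_left_mono[OF diff[of y], of "1 - p - q - \<gamma>"] \<gamma> by linarith
    next
      case False
      then have "r (\<Phi> y) \<le> r (\<psi> y)" using profileD[OF \<Phi>] profileD[OF \<psi>] by (intro r_le) auto
      moreover have "0 \<le> (1 - p - q - \<gamma>) * m" using \<gamma> m0 by simp
      ultimately show ?thesis by linarith
    qed
    with a show ?thesis unfolding hop_def by (simp add: algebra_simps)
  qed
  interpret prob_space waiting_time by (rule prob_space_waiting_time)
  have "\<Phi> y - \<psi> y \<le> (1 - \<gamma>) * m" for y
  proof -
    have "T v \<Phi> y \<le> integral\<^sup>L waiting_time (\<lambda>s. G \<psi> (y + v * s) + (1 - \<gamma>) * m)"
      unfolding wave_op_def by (intro integral_mono G_integrable \<Phi> \<psi> Bochner_Integration.integrable_add G_diff) simp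
    also have "\<dots> = T v \<psi> y + (1 - \<gamma>) * m"
      unfolding wave_op_def
      by (subst Bochner_Integration.integral_add) (auto intro: G_integrable \<psi>)
    finally show ?thesis using sub[of y] super[of y] by linarith
  qed
  moreover have "0 \<le> (1 - \<gamma>) * m" using \<gamma> p_pos q_pos m0 by simp
  ultimately have "w y \<le> (1 - \<gamma>) * m" for y by (auto simp: w_def)
  then have "m \<le> (1 - \<gamma>) * m" unfolding m_def by (intro cSUP_least) (auto simp: m_def)
  then have "\<gamma> * m \<le> 0" by (simp add: algebra_simps)
  with \<gamma> m0 have "m = 0" by (simp add: mult_le_0_iff)
  with diff[of x] show ?thesis by simp
qed

text \<open>
  The order of the shifted profile has to be verified on a compact interval only, provided that to its left
  both functions are near 0 whenever they are in the wrong order, and to its right stability is assumed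
  directly.  The second condition is phrased with an upper bound \<open>R\<close> of \<open>\<Phi>\<close>, so that it covers
  the case of \<open>\<psi>\<close> entering a neighbourhood of 1 and, vacuously, the case of \<open>\<psi>\<close> exceeding \<open>R\<close>.
\<close>
lemma shift_below:
  assumes \<Phi>: "profile \<Phi>" and \<psi>: "profile \<psi>"
    and sub: "\<And>x. \<Phi> x \<le> T v \<Phi> x" and super: "\<And>x. T v \<psi> x \<le> \<psi> x"
    and \<gamma>: "0 < \<gamma>" "\<gamma> \<le> 1 - p - q"
    and left: "\<And>u w. 0 \<le> w \<Longrightarrow> w \<le> u \<Longrightarrow> u \<le> \<eta> \<Longrightarrow> r u - r w \<le> (1 - p - q - \<gamma>) * (u - w)"
    and right: "\<And>x u. X \<le> x \<Longrightarrow> \<psi> x \<le> u \<Longrightarrow> u \<le> R \<Longrightarrow> r u - r (\<psi> x) \<le> (1 - p - q - \<gamma>) * (u - \<psi> x)"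
    and R: "\<And>x. \<Phi> x \<le> R"
    and small: "\<Phi> (Y - t) \<le> \<eta>"
    and mid: "\<And>x. Y \<le> x \<Longrightarrow> x \<le> X \<Longrightarrow> \<Phi> (x - t) \<le> \<psi> x"
  shows "\<Phi> (x - t) \<le> \<psi> x"
proof -
  have "(\<lambda>x. \<Phi> (x + (- t))) x \<le> \<psi> x"
  proof (rule tail_comparison[OF profile_shift[OF \<Phi>] \<psi> _ super \<gamma>])
    show "\<Phi> (x + - t) \<le> T v (\<lambda>x. \<Phi> (x + - t)) x" for x
      unfolding wave_op_shift by (rule sub)
    show "r (\<Phi> (y + - t)) - r (\<psi> y) \<le> (1 - p - q - \<gamma>) * (\<Phi> (y + - t) - \<psi> y)"
      if "\<psi> y < \<Phi> (y + - t)" for y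
    proof -
      consider "y < Y" | "X < y" | "Y \<le> y" "y \<le> X" by linarith
      then show ?thesis
      proof cases
        case 1
        then have "\<Phi> (y + - t) \<le> \<eta>" using profile_le[OF \<Phi>, of "y + - t" "Y - t"] small by auto
        then show ?thesis using that profileD[OF \<psi>] by (intro left) auto
      next
        case 2
        then show ?thesis using that R by (intro right) auto
      next
        case 3
        then show ?thesis using mid[of y] that by auto
      qed
    qed
  qed
  then show ?thesis by simp
qed

lemma tendsto_at_bot_profileE:
  fixes \<Phi> :: "real \<Rightarrow> real"
  assumes "(\<Phi> \<longlongrightarrow> 0) at_bot" "0 < \<eta>"
  obtains y where "\<And>x. x \<le> y \<Longrightarrow> \<Phi> x < \<eta>"
  using order_tendstoD(2)[OF assms] that unfolding eventually_at_bot_linorder by blast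

text \<open>
  The set \<open>S\<close> of admissible shifts is nonempty, closed and bounded below.  At its infimum the inequality
  between the two profiles is strict with a uniform gap \<open>\<kappa>\<close> on compact sets, since
  \<open>\<Phi> \<le> T v \<Phi> \<le> T v \<psi> < \<psi>\<close>.  Then a slightly smaller shift is admissible as well, a contradiction.
\<close>
lemma sliding:
  assumes \<Phi>: "profile \<Phi>" and \<psi>: "profile \<psi>"
    and sub: "\<And>x. \<Phi> x \<le> T v \<Phi> x" and super: "\<And>x. T v \<psi> x < \<psi> x"
    and cont: "\<And>x. isCont \<psi> x"
    and \<gamma>: "0 < \<gamma>" "\<gamma> \<le> 1 - p - q" and \<eta>: "0 < \<eta>"
    and left: "\<And>u w. 0 \<le> w \<Longrightarrow> w \<le> u \<Longrightarrow> u \<le> \<eta> \<Longrightarrow> r u - r w \<le> (1 - p - q - \<gamma>) * (u - w)"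
    and right: "\<And>x u. X \<le> x \<Longrightarrow> \<psi> x \<le> u \<Longrightarrow> u \<le> R \<Longrightarrow> r u - r (\<psi> x) \<le> (1 - p - q - \<gamma>) * (u - \<psi> x)"
    and R: "\<And>x. \<Phi> x \<le> R"
    and \<Phi>0: "(\<Phi> \<longlongrightarrow> 0) at_bot" and \<psi>0: "(\<psi> \<longlongrightarrow> 0) at_bot"
    and nontriv: "0 < \<Phi> x0"
  shows False
proof -
  have super': "T v \<psi> x \<le> \<psi> x" for x using super[of x] by simp
  obtain y\<Phi> where y\<Phi>: "\<And>x. x \<le> y\<Phi> \<Longrightarrow> \<Phi> x < \<eta>"
    using tendsto_at_bot_profileE[OF \<Phi>0 \<eta>] by blast
  define S where "S = {t. \<forall>x. \<Phi> (x - t) \<le> \<psi> x}"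
  have "X + 1 - y\<Phi> \<in> S" unfolding S_def mem_Collect_eq
  proof
    show "\<Phi> (x - (X + 1 - y\<Phi>)) \<le> \<psi> x" for x
      by (rule shift_below[OF \<Phi> \<psi> sub super' \<gamma> left right R, where Y = "X + 1" and X = X])
         (use y\<Phi>[of y\<Phi>] in auto)
  qed
  then have S_ne: "S \<noteq> {}" by blast
  obtain y\<psi> where y\<psi>: "\<And>x. x \<le> y\<psi> \<Longrightarrow> \<psi> x < \<Phi> x0"
    using tendsto_at_bot_profileE[OF \<psi>0 nontriv] by blast
  have bdd: "bdd_below S"
  proof (rule bdd_belowI[where m = "y\<psi> - x0"])
    fix t assume "t \<in> S"
    then have "\<Phi> ((x0 + t) - t) \<le> \<psi> (x0 + t)" unfolding S_def by blast
    then have "\<not> x0 + t \<le> y\<psi>" using y\<psi>[of "x0 + t"] by auto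
    then show "y\<psi> - x0 \<le> t" by simp
  qed
  define t where "t = Inf S"
  \<comment> \<open>Shifting the argument of the continuous function instead of that of \<open>\<Phi>\<close> shows that \<open>S\<close> is closed.\<close>
  have "\<Phi> y \<le> \<psi> (y + t)" for y
  proof -
    have "t \<in> closure S" unfolding t_def by (rule closure_contains_Inf[OF S_ne bdd])
    then obtain t' where t': "\<And>n. t' n \<in> S" "t' \<longlonglongrightarrow> t" unfolding closure_sequential by blast
    have "(\<lambda>n. \<psi> (y + t' n)) \<longlonglongrightarrow> \<psi> (y + t)"
      by (intro isCont_tendsto_compose[OF cont] tendsto_intros t')
    moreover have "\<Phi> y \<le> \<psi> (y + t' n)" for n
      using t'(1)[of n] unfolding S_def by (auto dest: spec[where x = "y + t' n"])
    ultimately show ?thesis by (intro LIMSEQ_le_const) auto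
  qed
  from this[of "x - t" for x] have touch: "\<Phi> (x - t) \<le> \<psi> x" for x by simp
  define Y where "Y = min X (y\<Phi> + t - 1)"
  define gap where "gap x = \<psi> x - T v \<psi> x" for x
  have "continuous_on {Y..X+1} gap" unfolding gap_def
    by (intro continuous_intros continuous_at_imp_continuous_on ballI T_continuous \<psi> cont)
  moreover have "compact {Y..X+1}" "{Y..X+1} \<noteq> {}" by (auto simp: Y_def)
  ultimately obtain x1 where x1: "x1 \<in> {Y..X+1}" "\<And>x. x \<in> {Y..X+1} \<Longrightarrow> gap x1 \<le> gap x"
    using continuous_attains_inf by metis
  define \<kappa> where "\<kappa> = gap x1"
  have \<kappa>: "0 < \<kappa>" using super[of x1] by (simp add: \<kappa>_def gap_def)
  have room: "\<Phi> (x - t) \<le> \<psi> x - \<kappa>" if "x \<in> {Y..X+1}" for x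
  proof -
    have "\<Phi> (x - t) \<le> T v \<Phi> (x - t)" by (rule sub)
    also have "\<dots> = T v (\<lambda>x. \<Phi> (x + (- t))) x" unfolding wave_op_shift by simp
    also have "\<dots> \<le> T v \<psi> x"
      by (rule T_mono_profile[OF profile_shift[OF \<Phi>] \<psi>]) (use touch in simp)
    also have "\<dots> \<le> \<psi> x - \<kappa>" using x1(2)[OF that] by (simp add: \<kappa>_def gap_def)
    finally show ?thesis .
  qed
  have "uniformly_continuous_on {Y..X+1} \<psi>"
    by (intro compact_uniformly_continuous continuous_at_imp_continuous_on ballI cont) auto
  then obtain e where e: "0 < e" "\<And>x y. x \<in> {Y..X+1} \<Longrightarrow> y \<in> {Y..X+1} \<Longrightarrow> dist y x < e \<Longrightarrow> dist (\<psi> y) (\<psi> x) < \<kappa>"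
    unfolding uniformly_continuous_on_def using \<kappa> by metis
  define \<epsilon> where "\<epsilon> = min 1 (e / 2)"
  have \<epsilon>: "0 < \<epsilon>" "\<epsilon> \<le> 1" "\<epsilon> < e" using e(1) by (auto simp: \<epsilon>_def)
  have "t - \<epsilon> \<in> S" unfolding S_def mem_Collect_eq
  proof
    show "\<Phi> (x - (t - \<epsilon>)) \<le> \<psi> x" for x
    proof (rule shift_below[OF \<Phi> \<psi> sub super' \<gamma> left right R, where Y = Y and X = X])
      show "\<Phi> (Y - (t - \<epsilon>)) \<le> \<eta>" using \<epsilon> by (intro less_imp_le[OF y\<Phi>]) (auto simp: Y_def)
      show "\<Phi> (x - (t - \<epsilon>)) \<le> \<psi> x" if "Y \<le> x" "x \<le> X" for x
      proof -
        have "\<Phi> ((x + \<epsilon>) - t) \<le> \<psi> (x + \<epsilon>) - \<kappa>" using that \<epsilon> by (intro room) auto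
        moreover have "dist (\<psi> (x + \<epsilon>)) (\<psi> x) < \<kappa>"
          using that \<epsilon> by (intro e) (auto simp: dist_real_def)
        ultimately show ?thesis by (simp add: dist_real_def algebra_simps)
      qed
    qed
  qed
  then have "t \<le> t - \<epsilon>" unfolding t_def by (rule cInf_lower[OF _ bdd])
  with \<epsilon> show False by simp
qed

end

text \<open>
  The symmetry of the problem: reversing space and exchanging the states 0 and 1 exchanges \<open>p\<close> and \<open>q\<close>,
  changes the sign of the speed, and turns subsolutions into supersolutions.
\<close>
definition flip :: "(real \<Rightarrow> real) \<Rightarrow> real \<Rightarrow> real"
  where "flip \<Phi> x = 1 - \<Phi> (- x)"

lemma profile_flip: "profile \<Phi> \<Longrightarrow> profile (flip \<Phi>)"
  by (auto simp: profile_def flip_def mono_def)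

lemma flip_tendsto_at_bot: "(\<Phi> \<longlongrightarrow> 1) at_top \<Longrightarrow> (flip \<Phi> \<longlongrightarrow> 0) at_bot"
  unfolding flip_def filterlim_at_bot_mirror by (auto intro!: tendsto_eq_intros)

lemma flip_tendsto_at_top: "(\<Phi> \<longlongrightarrow> 0) at_bot \<Longrightarrow> (flip \<Phi> \<longlongrightarrow> 1) at_top"
  unfolding flip_def filterlim_at_bot_mirror by (auto intro!: tendsto_eq_intros)

lemma isCont_flip: "(\<And>x. isCont \<Phi> x) \<Longrightarrow> isCont (flip \<Phi>) x"
  unfolding flip_def
  by (rule continuous_diff[OF continuous_const isCont_o2[where g=\<Phi>, OF continuous_minus[OF continuous_ident]]])

text \<open>
  Both 0 and 1 are stable: there the reaction term decreases at least at rate \<open>\<gamma>\<close>.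
\<close>
locale stable_hopping = hopping +
  fixes \<gamma> \<eta> :: real
  assumes r_1_eq: "r 1 = 1 - p - q"
    and \<gamma>_pos: "0 < \<gamma>" and \<gamma>_le: "\<gamma> \<le> 1 - p - q" and \<eta>_pos: "0 < \<eta>"
    and near_0: "\<And>u w. 0 \<le> w \<Longrightarrow> w \<le> u \<Longrightarrow> u \<le> \<eta> \<Longrightarrow> r u - r w \<le> (1 - p - q - \<gamma>) * (u - w)"
    and near_1: "\<And>u w. 1 - \<eta> \<le> w \<Longrightarrow> w \<le> u \<Longrightarrow> u \<le> 1 \<Longrightarrow> r u - r w \<le> (1 - p - q - \<gamma>) * (u - w)"
begin

lemma stable_hopping_flip: "stable_hopping q p h (\<lambda>u. 1 - p - q - r (1 - u)) \<gamma> \<eta>"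
proof
  show "mono_on {0..1} (\<lambda>u. 1 - p - q - r (1 - u))"
    by (auto intro!: mono_onI r_le)
  show "continuous_on {0..1} (\<lambda>u. 1 - p - q - r (1 - u))"
    by (intro continuous_intros continuous_on_compose2[OF r_cont]) auto
  show "(1 - p - q - r (1 - u)) - (1 - p - q - r (1 - w)) \<le> (1 - q - p - \<gamma>) * (u - w)"
    if "0 \<le> w" "w \<le> u" "u \<le> \<eta>" for u w
    using near_1[of "1 - u" "1 - w"] that by (simp add: algebra_simps)
  show "(1 - p - q - r (1 - u)) - (1 - p - q - r (1 - w)) \<le> (1 - q - p - \<gamma>) * (u - w)"
    if "1 - \<eta> \<le> w" "w \<le> u" "u \<le> 1" for u w
    using near_0[of "1 - u" "1 - w"] that by (simp add: algebra_simps)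
qed (use p_pos q_pos h_pos pq r_0 r_1_eq \<gamma>_pos \<gamma>_le \<eta>_pos in auto)

lemma hop_flip: "hop q p h (\<lambda>u. 1 - p - q - r (1 - u)) (flip \<Phi>) x = 1 - G \<Phi> (- x)"
proof -
  have "\<Phi> (- (x + h)) = \<Phi> (- x - h)" "\<Phi> (- (x - h)) = \<Phi> (- x + h)" by simp_all
  then show ?thesis unfolding hop_def flip_def by (simp only:) (simp add: algebra_simps)
qed

lemma wave_op_flip:
  assumes "profile \<Phi>"
  shows "wave_op q p h (\<lambda>u. 1 - p - q - r (1 - u)) (- v) (flip \<Phi>) x = 1 - T v \<Phi> (- x)"
proof -
  interpret prob_space waiting_time by (rule prob_space_waiting_time)
  have "wave_op q p h (\<lambda>u. 1 - p - q - r (1 - u)) (- v) (flip \<Phi>) x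
      = integral\<^sup>L waiting_time (\<lambda>s. 1 - G \<Phi> (- x + v * s))"
    unfolding wave_op_def hop_flip by simp
  also have "\<dots> = 1 - T v \<Phi> (- x)"
    unfolding wave_op_def by (subst Bochner_Integration.integral_diff) (use G_integrable[OF assms, of "- x" v] in simp_all)
  finally show ?thesis .
qed

lemma no_sub_at_strict_super:
  assumes \<Phi>: "profile \<Phi>" and \<psi>: "profile \<psi>"
    and sub: "\<And>x. \<Phi> x \<le> T v \<Phi> x" and super: "\<And>x. T v \<psi> x < \<psi> x"
    and cont: "\<And>x. isCont \<psi> x"
    and lim: "(\<Phi> \<longlongrightarrow> 0) at_bot" "(\<psi> \<longlongrightarrow> 0) at_bot" "(\<psi> \<longlongrightarrow> 1) at_top"
  shows "\<Phi> x = 0"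
proof (rule ccontr)
  assume "\<Phi> x \<noteq> 0"
  then have "0 < \<Phi> x" using profileD(2)[OF \<Phi>, of x] by simp
  have "\<forall>\<^sub>F x in at_top. 1 - \<eta> < \<psi> x" by (rule order_tendstoD(1)[OF lim(3)]) (use \<eta>_pos in simp)
  then obtain X where "\<And>x. X \<le> x \<Longrightarrow> 1 - \<eta> < \<psi> x" unfolding eventually_at_top_linorder by blast
  then show False
    by (intro sliding[where \<Phi>=\<Phi> and \<psi>=\<psi> and v=v and X=X and R=1, OF \<Phi> \<psi> sub super cont \<gamma>_pos \<gamma>_le \<eta>_pos
          near_0 near_1 profileD(3)[OF \<Phi>] lim(1,2) \<open>0 < \<Phi> x\<close>])
       (auto intro: less_imp_le)
qed

lemma no_super_at_strict_sub:
  assumes \<Phi>: "profile \<Phi>" and \<psi>: "profile \<psi>"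
    and super: "\<And>x. T v \<Phi> x \<le> \<Phi> x" and sub: "\<And>x. \<psi> x < T v \<psi> x"
    and cont: "\<And>x. isCont \<psi> x"
    and lim: "(\<Phi> \<longlongrightarrow> 1) at_top" "(\<psi> \<longlongrightarrow> 0) at_bot" "(\<psi> \<longlongrightarrow> 1) at_top"
  shows "\<Phi> x = 1"
proof -
  interpret f: stable_hopping q p h "\<lambda>u. 1 - p - q - r (1 - u)" \<gamma> \<eta>
    by (rule stable_hopping_flip)
  have "flip \<Phi> (- x) = 0"
  proof (rule f.no_sub_at_strict_super[OF profile_flip[OF \<Phi>] profile_flip[OF \<psi>], where v = "- v"])
    show "flip \<Phi> x \<le> f.T (- v) (flip \<Phi>) x" for x
      unfolding wave_op_flip[OF \<Phi>] by (simp add: flip_def super)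
    show "f.T (- v) (flip \<psi>) x < flip \<psi> x" for x
      unfolding wave_op_flip[OF \<psi>] by (simp add: flip_def sub)
  qed (intro isCont_flip cont flip_tendsto_at_bot flip_tendsto_at_top lim)+
  then show ?thesis by (simp add: flip_def)
qed

end

section \<open>Limits of profiles and obstacle problems\<close>

text \<open>
  The sets of subsolutions and of supersolutions are to be closed under limits, and convergence is
  available only at continuity points.  Right continuous representatives are determined by these.
\<close>
definition rcont :: "(real \<Rightarrow> real) \<Rightarrow> bool"
  where "rcont \<Phi> \<longleftrightarrow> (\<forall>x. (\<Phi> \<longlongrightarrow> \<Phi> x) (at_right x))"

lemma rcont_shift:
  assumes "rcont \<Phi>" shows "rcont (\<lambda>x. \<Phi> (x + s))"
  unfolding rcont_def
proof
  fix x
  have "filterlim (\<lambda>x. x + s) (at_right (x + s)) (at_right x)"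
    unfolding filterlim_at by (auto intro!: tendsto_intros simp: eventually_at_filter)
  moreover have "(\<Phi> \<longlongrightarrow> \<Phi> (x + s)) (at_right (x + s))" using assms by (simp add: rcont_def)
  ultimately show "((\<lambda>x. \<Phi> (x + s)) \<longlongrightarrow> \<Phi> (x + s)) (at_right x)"
    by (rule filterlim_compose[rotated])
qed

lemma rcont_seq:
  assumes "rcont \<Phi>" "x' \<longlonglongrightarrow> x" "\<And>n. x < x' n" shows "(\<lambda>n. \<Phi> (x' n)) \<longlonglongrightarrow> \<Phi> x"
proof -
  have "filterlim x' (at_right x) sequentially"
    unfolding filterlim_at using assms by (auto intro!: always_eventually)
  moreover have "(\<Phi> \<longlongrightarrow> \<Phi> x) (at_right x)" using assms by (simp add: rcont_def)
  ultimately show ?thesis by (rule filterlim_compose[rotated])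
qed

lemma rcont_step: "rcont (\<lambda>x. if x < N then b else c)"
  unfolding rcont_def
proof
  fix x show "((\<lambda>x. if x < N then b else c) \<longlongrightarrow> (if x < N then b else c)) (at_right x)"
  proof (cases "x < N")
    case True
    then have "\<forall>\<^sub>F y in at_right x. (if y < N then b else c) = b"
      unfolding eventually_at_right_field by (intro exI[of _ N]) auto
    with True show ?thesis by (auto intro: tendsto_eventually)
  next
    case False
    then have "\<forall>\<^sub>F y in at_right x. (if y < N then b else c) = c"
      unfolding eventually_at_right_field by (intro exI[of _ "x + 1"]) auto
    with False show ?thesis by (auto intro: tendsto_eventually)
  qed
qed

lemma isCont_imp_rcont: "(\<And>x. isCont \<Phi> x) \<Longrightarrow> rcont \<Phi>"
  unfolding rcont_def isCont_def by (blast intro: tendsto_within_subset)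

lemma right_limit_profile:
  assumes \<Phi>: "profile \<Phi>"
  obtains \<Psi> where "profile \<Psi>" "\<And>x. \<Phi> x \<le> \<Psi> x" "\<And>x. (\<Phi> \<longlongrightarrow> \<Psi> x) (at_right x)"
proof
  define \<Psi> where "\<Psi> x = (INF y\<in>{x<..}. \<Phi> y)" for x
  have bdd: "bdd_below (\<Phi> ` A)" for A
    by (rule bdd_belowI2[where m = 0]) (rule profileD(2)[OF \<Phi>])
  show ge: "\<Phi> x \<le> \<Psi> x" for x
    unfolding \<Psi>_def by (rule cINF_greatest) (auto intro: profile_le[OF \<Phi>])
  show "profile \<Psi>"
  proof (rule profileI)
    show "mono \<Psi>" unfolding \<Psi>_def
      by (intro monoI cINF_superset_mono bdd) auto
    show "0 \<le> \<Psi> x" for x using ge[of x] profileD(2)[OF \<Phi>, of x] by linarith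
    show "\<Psi> x \<le> 1" for x
      using cINF_lower[OF bdd, of "x + 1" "{x<..}"] profileD(3)[OF \<Phi>, of "x + 1"] by (auto simp: \<Psi>_def)
  qed
  show "(\<Phi> \<longlongrightarrow> \<Psi> x) (at_right x)" for x
    using Lim_right_bound[where I = UNIV and f = \<Phi> and x = x and K = 0]
      profile_le[OF \<Phi>] profileD(2)[OF \<Phi>] by (auto simp: \<Psi>_def)
qed

lemma profile_limit_bot:
  assumes \<Phi>: "profile \<Phi>"
  obtains l where "(\<Phi> \<longlongrightarrow> l) at_bot" "\<And>x. l \<le> \<Phi> x" "0 \<le> l" "l \<le> 1"
proof
  define l where "l = (INF x. \<Phi> x)"
  have bdd: "bdd_below (range \<Phi>)"
    by (rule bdd_belowI2[where m = 0]) (rule profileD(2)[OF \<Phi>])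
  show l: "l \<le> \<Phi> x" for x unfolding l_def by (rule cINF_lower[OF bdd]) simp
  show "0 \<le> l" unfolding l_def by (rule cINF_greatest) (auto intro: profileD(2)[OF \<Phi>])
  show "l \<le> 1" using l[of 0] profileD(3)[OF \<Phi>, of 0] by linarith
  show "(\<Phi> \<longlongrightarrow> l) at_bot"
  proof (rule order_tendstoI)
    fix u assume "u < l" then show "\<forall>\<^sub>F x in at_bot. u < \<Phi> x"
      by (intro always_eventually allI less_le_trans[OF _ l])
  next
    fix u assume "l < u"
    then obtain y where "\<Phi> y < u" unfolding l_def by (subst (asm) cINF_less_iff[OF _ bdd]) auto
    then show "\<forall>\<^sub>F x in at_bot. \<Phi> x < u"
      unfolding eventually_at_bot_linorder by (meson profile_le[OF \<Phi>] le_less_trans)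
  qed
qed

lemma profile_limit_top:
  assumes \<Phi>: "profile \<Phi>"
  obtains l where "(\<Phi> \<longlongrightarrow> l) at_top" "\<And>x. \<Phi> x \<le> l" "0 \<le> l" "l \<le> 1"
proof -
  obtain l where l: "(flip \<Phi> \<longlongrightarrow> l) at_bot" "\<And>x. l \<le> flip \<Phi> x" "0 \<le> l" "l \<le> 1"
    using profile_limit_bot[OF profile_flip[OF \<Phi>]] by blast
  have "((\<lambda>x. 1 - flip \<Phi> (- x)) \<longlongrightarrow> 1 - l) at_top"
    using l(1) unfolding filterlim_at_bot_mirror by (intro tendsto_intros)
  then have "(\<Phi> \<longlongrightarrow> 1 - l) at_top" by (simp add: flip_def)
  moreover have "\<Phi> x \<le> 1 - l" for x using l(2)[of "- x"] by (simp add: flip_def)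
  ultimately show thesis using l(3,4) that by simp
qed

lemma continuity_point_between:
  assumes "profile \<Phi>" "a < b"
  obtains x where "a < x" "x < b" "isCont \<Phi> x"
  using open_minus_countable[OF profile_countable_discont[OF assms(1)], of "{a<..<b}"] assms(2) that
  by auto

text \<open>
  Helly's selection theorem bounds the absolute value of the limit; applied to \<open>\<Phi> - 1/2\<close> it
  yields limits with values between 0 and 1.
\<close>
lemma profile_helly:
  assumes "\<And>n. profile (\<Phi>' n)" "\<And>n. rcont (\<Phi>' n)"
  obtains s :: "nat \<Rightarrow> nat" and \<Phi> where "strict_mono s" "profile \<Phi>" "rcont \<Phi>"
    "\<And>x. isCont \<Phi> x \<Longrightarrow> (\<lambda>n. \<Phi>' (s n) x) \<longlonglongrightarrow> \<Phi> x"
proof -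
  have "\<exists>s. strict_mono (s::nat \<Rightarrow> nat) \<and> (\<exists>F. (\<forall>x. continuous (at_right x) F) \<and> mono F \<and>
      (\<forall>x. \<bar>F x\<bar> \<le> 1 / 2) \<and> (\<forall>x. continuous (at x) F \<longrightarrow> (\<lambda>n. \<Phi>' (s n) x - 1 / 2) \<longlonglongrightarrow> F x))"
  proof (rule Helly_selection)
    show "continuous (at_right x) (\<lambda>x. \<Phi>' n x - 1 / 2)" for n x
      using assms(2)[of n] by (auto simp: continuous_within rcont_def intro!: tendsto_intros)
    show "mono (\<lambda>x. \<Phi>' n x - 1 / 2)" for n
      using profileD(1)[OF assms(1)[of n]] by (auto simp: mono_def)
    show "\<bar>\<Phi>' n x - 1 / 2\<bar> \<le> 1 / 2" for n x
      using profileD(2,3)[OF assms(1)[of n], of x] unfolding abs_le_iff by (auto simp: field_simps)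
  qed
  then obtain s F where s: "strict_mono (s :: nat \<Rightarrow> nat)"
    and F: "\<And>x. continuous (at_right x) F" "mono F" "\<And>x. \<bar>F x\<bar> \<le> 1 / 2"
      "\<And>x. isCont F x \<Longrightarrow> (\<lambda>n. \<Phi>' (s n) x - 1 / 2) \<longlonglongrightarrow> F x" by blast
  define \<Phi> where "\<Phi> x = F x + 1 / 2" for x
  have "profile \<Phi>"
    using F(2) F(3)[unfolded abs_le_iff] by (auto simp: \<Phi>_def profile_def mono_def field_simps)
       (smt (verit) field_sum_of_halves)+
  moreover have "rcont \<Phi>"
    using F(1) by (auto simp: \<Phi>_def[abs_def] rcont_def continuous_within intro!: tendsto_intros)
  moreover have "(\<lambda>n. \<Phi>' (s n) x) \<longlonglongrightarrow> \<Phi> x" if "isCont \<Phi> x" for x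
  proof -
    have "isCont (\<lambda>x. \<Phi> x - 1 / 2) x" using that by (intro continuous_intros)
    then have "isCont F x" by (simp add: \<Phi>_def[abs_def])
    from tendsto_add[OF F(4)[OF this] tendsto_const[of "1 / 2"]] show ?thesis by (simp add: \<Phi>_def)
  qed
  ultimately show thesis using s that by blast
qed

lemma moving_limit:
  assumes \<Phi>': "\<And>n. profile (\<Phi>' n)" and \<Phi>: "profile \<Phi>"
    and lim: "\<And>x. isCont \<Phi> x \<Longrightarrow> (\<lambda>n. \<Phi>' n x) \<longlonglongrightarrow> \<Phi> x"
    and y: "isCont \<Phi> y" "y' \<longlonglongrightarrow> y"
  shows "(\<lambda>n. \<Phi>' n (y' n)) \<longlonglongrightarrow> \<Phi> y"
proof (rule order_tendstoI)
  fix u assume "u < \<Phi> y"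
  then have "\<forall>\<^sub>F x in at y. u < \<Phi> x" using y(1) unfolding isCont_def by (rule order_tendstoD(1)[rotated])
  then obtain d where d: "0 < d" "\<And>x. x \<noteq> y \<Longrightarrow> dist x y < d \<Longrightarrow> u < \<Phi> x"
    unfolding eventually_at by blast
  obtain x where x: "y - d < x" "x < y" "isCont \<Phi> x"
    by (rule continuity_point_between[OF \<Phi>, of "y - d" y]) (use d in auto)
  then have "u < \<Phi> x" by (intro d) (auto simp: dist_real_def)
  from order_tendstoD(1)[OF lim[OF x(3)] this] order_tendstoD(1)[OF y(2) x(2)]
  show "\<forall>\<^sub>F n in sequentially. u < \<Phi>' n (y' n)"
  proof eventually_elim
    case (elim n) then show ?case using profile_le[OF \<Phi>'[of n], of x "y' n"] by linarith
  qed
next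
  fix u assume "\<Phi> y < u"
  then have "\<forall>\<^sub>F x in at y. \<Phi> x < u" using y(1) unfolding isCont_def by (rule order_tendstoD(2)[rotated])
  then obtain d where d: "0 < d" "\<And>x. x \<noteq> y \<Longrightarrow> dist x y < d \<Longrightarrow> \<Phi> x < u"
    unfolding eventually_at by blast
  obtain x where x: "y < x" "x < y + d" "isCont \<Phi> x"
    by (rule continuity_point_between[OF \<Phi>, of y "y + d"]) (use d in auto)
  then have "\<Phi> x < u" by (intro d) (auto simp: dist_real_def)
  from order_tendstoD(2)[OF lim[OF x(3)] this] order_tendstoD(2)[OF y(2) x(1)]
  show "\<forall>\<^sub>F n in sequentially. \<Phi>' n (y' n) < u"
  proof eventually_elim
    case (elim n) then show ?case using profile_le[OF \<Phi>'[of n], of "y' n" x] by linarith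
  qed
qed

text \<open>
  A right continuous profile attains its first passage, so that recentring there normalises it.
\<close>
lemma first_passage:
  assumes \<Phi>: "profile \<Phi>" "rcont \<Phi>" and l: "(\<Phi> \<longlongrightarrow> l) at_bot" "l < \<theta>" and x1: "\<theta> \<le> \<Phi> x1"
  obtains X where "X \<le> x1" "\<theta> \<le> \<Phi> X" "\<And>x. x < X \<Longrightarrow> \<Phi> x < \<theta>"
proof -
  define S where "S = {x. \<theta> \<le> \<Phi> x}"
  have S: "x1 \<in> S" using x1 by (simp add: S_def)
  from order_tendstoD(2)[OF l] obtain y where y: "\<And>x. x \<le> y \<Longrightarrow> \<Phi> x < \<theta>"
    unfolding eventually_at_bot_linorder by blast
  have bdd: "bdd_below S"
  proof (rule bdd_belowI[where m = y])
    fix x assume "x \<in> S"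
    then show "y \<le> x" using y[of x] by (cases "x \<le> y") (auto simp: S_def)
  qed
  show thesis
  proof (rule that[of "Inf S"])
    show "Inf S \<le> x1" by (rule cInf_lower[OF S bdd])
    show less: "\<Phi> x < \<theta>" if "x < Inf S" for x
      using that cInf_lower[OF _ bdd, of x] by (auto simp: S_def not_le[symmetric])
    have "\<theta> \<le> \<Phi> x" if "Inf S < x" for x
    proof -
      have "\<exists>z\<in>S. z < x" using that cInf_lessD[of S x] S by auto
      then obtain z where "z \<in> S" "z < x" by blast
      then show ?thesis using profile_le[OF \<Phi>(1), of z x] by (auto simp: S_def)
    qed
    then have "\<theta> \<le> \<Phi> (Inf S + inverse (Suc n))" for n by simp
    moreover have "(\<lambda>n. \<Phi> (Inf S + inverse (Suc n))) \<longlonglongrightarrow> \<Phi> (Inf S)"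
      by (rule rcont_seq[OF \<Phi>(2) LIMSEQ_inverse_real_of_nat_add]) simp
    ultimately show "\<theta> \<le> \<Phi> (Inf S)" by (intro LIMSEQ_le_const) auto
  qed
qed

lemma normalised_limit:
  assumes \<Phi>: "profile \<Phi>" "rcont \<Phi>"
    and lim: "\<And>x. isCont \<Phi> x \<Longrightarrow> (\<lambda>n. \<Phi>' n x) \<longlonglongrightarrow> \<Phi> x"
  shows "(\<And>n x. x < z \<Longrightarrow> \<Phi>' n x \<le> \<theta>) \<Longrightarrow> x < z \<Longrightarrow> \<Phi> x \<le> \<theta>"
    and "(\<And>n x. z \<le> x \<Longrightarrow> \<theta> \<le> \<Phi>' n x) \<Longrightarrow> \<theta> \<le> \<Phi> z"
proof -
  assume le: "\<And>n x. x < z \<Longrightarrow> \<Phi>' n x \<le> \<theta>" and "x < z"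
  obtain y where y: "x < y" "y < z" "isCont \<Phi> y" by (rule continuity_point_between[OF \<Phi>(1) \<open>x < z\<close>])
  have "\<Phi> y \<le> \<theta>" using lim[OF y(3)] le y(2) by (intro LIMSEQ_le_const2) auto
  then show "\<Phi> x \<le> \<theta>" using profile_le[OF \<Phi>(1), of x y] y by linarith
next
  assume ge: "\<And>n x. z \<le> x \<Longrightarrow> \<theta> \<le> \<Phi>' n x"
  have "\<theta> \<le> \<Phi> x" if "z < x" for x
  proof -
    obtain y where y: "z < y" "y < x" "isCont \<Phi> y" by (rule continuity_point_between[OF \<Phi>(1) \<open>z < x\<close>])
    have "\<theta> \<le> \<Phi> y" using lim[OF y(3)] ge y(1) by (intro LIMSEQ_le_const) auto
    then show ?thesis using profile_le[OF \<Phi>(1), of y x] y by linarith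
  qed
  then have "\<theta> \<le> \<Phi> (z + inverse (Suc n))" for n by simp
  moreover have "(\<lambda>n. \<Phi> (z + inverse (Suc n))) \<longlonglongrightarrow> \<Phi> z"
    by (rule rcont_seq[OF \<Phi>(2) LIMSEQ_inverse_real_of_nat_add]) simp
  ultimately show "\<theta> \<le> \<Phi> z" by (intro LIMSEQ_le_const) auto
qed

lemma filterlim_minus_nat_at_bot: "filterlim (\<lambda>n. - real n + y) at_bot sequentially"
  unfolding filterlim_at_bot
proof
  fix Z :: real
  obtain N :: nat where N: "y - Z \<le> N" using real_arch_simple by blast
  show "\<forall>\<^sub>F n in sequentially. - real n + y \<le> Z"
    using eventually_ge_at_top[of N] by eventually_elim (use N in simp)
qed

lemma filterlim_nat_at_top: "filterlim (\<lambda>n. real n + y) at_top sequentially"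
  unfolding filterlim_at_top
proof
  fix Z :: real
  obtain N :: nat where N: "Z - y \<le> N" using real_arch_simple by blast
  show "\<forall>\<^sub>F n in sequentially. Z \<le> real n + y"
    using eventually_ge_at_top[of N] by eventually_elim (use N in simp)
qed

context hopping
begin

text \<open>
  The largest function that is dominated by its own image under the obstacle operator is a fixed point, by
  the argument of Knaster and Tarski.  Being the largest it coincides with its right limits when the
  obstacles are right continuous, since these right limits are again dominated by their image.
\<close>
lemma double_obstacle:
  assumes lo: "profile lo" and up: "profile up" and le: "\<And>x. lo x \<le> up x"
  obtains \<Psi> where "profile \<Psi>" "\<And>x. \<Psi> x = min (max (T v \<Psi> x) (lo x)) (up x)"
    "rcont lo \<Longrightarrow> rcont up \<Longrightarrow> rcont \<Psi>"
proof -
  define S where "S \<Phi> x = min (max (T v \<Phi> x) (lo x)) (up x)" for \<Phi> x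
  have S_profile: "profile (S \<Phi>)" if "profile \<Phi>" for \<Phi>
  proof (rule profileI)
    show "mono (S \<Phi>)" unfolding S_def
      by (intro monoI min.mono max.mono profile_le[OF profile_T[OF that]] profile_le[OF lo] profile_le[OF up])
    show "0 \<le> S \<Phi> x" "S \<Phi> x \<le> 1" for x
      using profileD(2,3)[OF profile_T[OF that], of x v] profileD(2,3)[OF lo, of x] profileD(2,3)[OF up, of x]
      by (auto simp: S_def)
  qed
  have S_mono: "S \<Phi> x \<le> S \<Psi> x" if "profile \<Phi>" "profile \<Psi>" "\<And>x. \<Phi> x \<le> \<Psi> x" for \<Phi> \<Psi> x
    unfolding S_def by (intro min.mono max.mono T_mono_profile that order_refl)
  define C where "C = {\<Phi>. profile \<Phi> \<and> (\<forall>x. \<Phi> x \<le> S \<Phi> x)}"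
  have "lo \<in> C" using lo le by (auto simp: C_def S_def)
  define \<Psi> where "\<Psi> x = (SUP \<Phi>\<in>C. \<Phi> x)" for x
  have bdd: "bdd_above ((\<lambda>\<Phi>. \<Phi> x) ` C)" for x
    by (rule bdd_aboveI2[where M = 1]) (auto simp: C_def profile_def)
  have upper: "\<Phi> x \<le> \<Psi> x" if "\<Phi> \<in> C" for \<Phi> x
    unfolding \<Psi>_def by (rule cSUP_upper[OF that bdd])
  have least: "\<Psi> x \<le> b" if "\<And>\<Phi>. \<Phi> \<in> C \<Longrightarrow> \<Phi> x \<le> b" for x b
    unfolding \<Psi>_def using \<open>lo \<in> C\<close> that by (intro cSUP_least) auto
  have \<Psi>: "profile \<Psi>"
  proof (rule profileI)
    show "mono \<Psi>"
    proof (intro monoI least)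
      fix x y \<Phi> assume "x \<le> (y::real)" "\<Phi> \<in> C"
      then show "\<Phi> x \<le> \<Psi> y" using upper[of \<Phi> y] profile_le[of \<Phi> x y] by (auto simp: C_def)
    qed
    show "0 \<le> \<Psi> x" for x using upper[OF \<open>lo \<in> C\<close>, of x] profileD(2)[OF lo, of x] by linarith
    show "\<Psi> x \<le> 1" for x by (rule least) (auto simp: C_def profile_def)
  qed
  have \<Psi>_le: "\<Psi> x \<le> S \<Psi> x" for x
  proof (rule least)
    fix \<Phi> assume C: "\<Phi> \<in> C"
    then have "\<Phi> x \<le> S \<Phi> x" "profile \<Phi>" by (auto simp: C_def)
    then show "\<Phi> x \<le> S \<Psi> x" using S_mono[OF _ \<Psi> upper[OF C], of x] by simp
  qed
  have "S \<Psi> \<in> C" using S_profile[OF \<Psi>] S_mono[OF \<Psi> S_profile[OF \<Psi>] \<Psi>_le] by (simp add: C_def)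
  with \<Psi>_le have fix_eq: "\<Psi> x = S \<Psi> x" for x using upper by (intro antisym) auto
  have "rcont \<Psi>" if rc: "rcont lo" "rcont up"
  proof -
    obtain \<Psi>' where \<Psi>': "profile \<Psi>'" "\<And>x. \<Psi> x \<le> \<Psi>' x" "\<And>x. (\<Psi> \<longlongrightarrow> \<Psi>' x) (at_right x)"
      using right_limit_profile[OF \<Psi>] by blast
    have "\<Psi>' x = S \<Psi>' x" for x
    proof -
      define x' where "x' n = x + inverse (Suc n)" for n :: nat
      have x': "x' \<longlonglongrightarrow> x" "\<And>n. x < x' n"
        unfolding x'_def by (rule LIMSEQ_inverse_real_of_nat_add) simp
      have "filterlim x' (at_right x) sequentially"
        unfolding filterlim_at using x' by (auto intro!: always_eventually)
      from filterlim_compose[OF \<Psi>'(3) this]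
      have "(\<lambda>n. \<Psi> (x' n)) \<longlonglongrightarrow> \<Psi>' x" .
      moreover have "(\<lambda>n. S \<Psi> (x' n)) \<longlonglongrightarrow> S \<Psi>' x" unfolding S_def
        by (intro tendsto_intros T_tendsto_right[OF \<Psi> \<Psi>'(1) \<Psi>'(3) x'] rcont_seq[OF rc(1) x'] rcont_seq[OF rc(2) x'])
      ultimately show ?thesis using fix_eq by (simp add: LIMSEQ_unique)
    qed
    then have "\<Psi>' \<in> C" using \<Psi>'(1) by (auto simp: C_def)
    then have "\<Psi>' = \<Psi>" using upper \<Psi>'(2) by (intro ext antisym) auto
    with \<Psi>'(3) show ?thesis by (simp add: rcont_def)
  qed
  with \<Psi> fix_eq show thesis unfolding S_def by (rule that)
qed

lemma T_limit:
  assumes \<Phi>': "\<And>n. profile (\<Phi>' n)" and \<Phi>: "profile \<Phi>"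
    and lim: "\<And>x. isCont \<Phi> x \<Longrightarrow> (\<lambda>n. \<Phi>' n x) \<longlonglongrightarrow> \<Phi> x"
    and v: "v' \<longlonglongrightarrow> v" and x: "\<And>z. z \<in> {-h, 0, h} \<Longrightarrow> isCont \<Phi> (x + z)"
  shows "(\<lambda>n. T (v' n) (\<Phi>' n) x) \<longlonglongrightarrow> T v \<Phi> x"
proof (rule T_tendsto[OF \<Phi>' \<Phi>])
  have "AE s in waiting_time. \<forall>z\<in>{-h, 0, h}. x + v * s + z \<notin> {x. \<not> isCont \<Phi> x}"
    by (rule AE_avoids_countable[OF profile_countable_discont[OF \<Phi>]]) (use x in auto)
  then show "AE s in waiting_time. \<forall>z\<in>{-h, 0, h}.
      (\<lambda>n. \<Phi>' n (x + v' n * s + z)) \<longlonglongrightarrow> \<Phi> (x + v * s + z)"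
    by eventually_elim (auto intro!: moving_limit[OF \<Phi>' \<Phi> lim] tendsto_intros v)
qed

text \<open>
  Points whose hopping neighbours are all continuity points are dense, because they avoid a countable set.
\<close>
lemma good_sequence:
  assumes \<Phi>: "profile \<Phi>" "rcont \<Phi>" and "open U" "x \<in> U"
  obtains x' :: "nat \<Rightarrow> real" where "\<And>n. x' n \<in> U" "\<And>n z. z \<in> {-h, 0, h} \<Longrightarrow> isCont \<Phi> (x' n + z)"
    "(\<lambda>n. \<Phi> (x' n)) \<longlonglongrightarrow> \<Phi> x" "(\<lambda>n. T v \<Phi> (x' n)) \<longlonglongrightarrow> T v \<Phi> x"
proof -
  obtain e where e: "0 < e" "\<And>y. dist y x < e \<Longrightarrow> y \<in> U" using assms(3,4) unfolding open_dist by blast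
  have "countable (\<Union>z\<in>{-h, 0, h}. (\<lambda>y. y - z) ` {x. \<not> isCont \<Phi> x})"
    using profile_countable_discont[OF \<Phi>(1)] by auto
  then have "\<exists>y\<in>{x<..<x + min e (inverse (Suc n))}.
      y \<notin> (\<Union>z\<in>{-h, 0, h}. (\<lambda>y. y - z) ` {x. \<not> isCont \<Phi> x})" for n :: nat
    by (rule open_minus_countable) (use e(1) in \<open>auto simp: min_le_iff_disj\<close>)
  then obtain x' where x': "\<And>n. x' n \<in> {x<..<x + min e (inverse (Suc n))}"
    "\<And>n. x' n \<notin> (\<Union>z\<in>{-h, 0, h}. (\<lambda>y. y - z) ` {x. \<not> isCont \<Phi> x})" by metis
  have gt: "x < x' n" for n using x'(1)[of n] by auto
  have "x' \<longlonglongrightarrow> x"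
  proof (rule tendsto_sandwich[OF _ _ tendsto_const])
    show "(\<lambda>n. x + inverse (Suc n)) \<longlonglongrightarrow> x"
      by (rule LIMSEQ_inverse_real_of_nat_add)
    show "\<forall>\<^sub>F n in sequentially. x' n \<le> x + inverse (Suc n)"
    proof (intro always_eventually allI)
      show "x' n \<le> x + inverse (Suc n)" for n using x'(1)[of n] by auto
    qed
  qed (use gt in \<open>auto intro!: always_eventually less_imp_le\<close>)
  show thesis
  proof (rule that[of x'])
    show "x' n \<in> U" for n using x'(1)[of n] by (intro e(2)) (auto simp: dist_real_def)
    show "isCont \<Phi> (x' n + z)" if "z \<in> {-h, 0, h}" for n z
    proof (rule ccontr)
      assume "\<not> isCont \<Phi> (x' n + z)"
      moreover have "x' n = (x' n + z) - z" by simp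
      ultimately show False using x'(2)[of n] that by blast
    qed
    show "(\<lambda>n. \<Phi> (x' n)) \<longlonglongrightarrow> \<Phi> x" by (rule rcont_seq[OF \<Phi>(2) \<open>x' \<longlonglongrightarrow> x\<close> gt])
    show "(\<lambda>n. T v \<Phi> (x' n)) \<longlonglongrightarrow> T v \<Phi> x"
      by (rule T_tendsto_right[OF \<Phi>(1) \<Phi>(1) _ \<open>x' \<longlonglongrightarrow> x\<close> gt]) (use \<Phi>(2) in \<open>auto simp: rcont_def\<close>)
  qed
qed

text \<open>
  Inequalities between a profile and its image survive Helly limits, even if they hold only
  eventually and only on an open set: they pass to the limit at good points, and from there to
  every point by right continuity.
\<close>
lemma
  assumes \<Phi>': "\<And>n. profile (\<Phi>' n)" and \<Phi>: "profile \<Phi>" "rcont \<Phi>"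
    and lim: "\<And>x. isCont \<Phi> x \<Longrightarrow> (\<lambda>n. \<Phi>' n x) \<longlonglongrightarrow> \<Phi> x"
    and v: "v' \<longlonglongrightarrow> v" and U: "open U" "x \<in> U"
  shows sub_limit: "(\<And>x. x \<in> U \<Longrightarrow> \<forall>\<^sub>F n in sequentially. \<Phi>' n x \<le> T (v' n) (\<Phi>' n) x) \<Longrightarrow> \<Phi> x \<le> T v \<Phi> x"
    and super_limit: "(\<And>x. x \<in> U \<Longrightarrow> \<forall>\<^sub>F n in sequentially. T (v' n) (\<Phi>' n) x \<le> \<Phi>' n x) \<Longrightarrow> T v \<Phi> x \<le> \<Phi> x"
proof -
  obtain x' :: "nat \<Rightarrow> real" where x': "\<And>n. x' n \<in> U" "\<And>n z. z \<in> {-h, 0, h} \<Longrightarrow> isCont \<Phi> (x' n + z)"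
    "(\<lambda>n. \<Phi> (x' n)) \<longlonglongrightarrow> \<Phi> x" "(\<lambda>n. T v \<Phi> (x' n)) \<longlonglongrightarrow> T v \<Phi> x"
    using good_sequence[OF \<Phi> U] by blast
  have l1: "(\<lambda>n. \<Phi>' n (x' j)) \<longlonglongrightarrow> \<Phi> (x' j)" for j using x'(2)[of 0 j] by (intro lim) auto
  have l2: "(\<lambda>n. T (v' n) (\<Phi>' n) (x' j)) \<longlonglongrightarrow> T v \<Phi> (x' j)" for j
    by (rule T_limit[OF \<Phi>' \<Phi>(1) lim v x'(2)])
  show "\<Phi> x \<le> T v \<Phi> x" if "\<And>x. x \<in> U \<Longrightarrow> \<forall>\<^sub>F n in sequentially. \<Phi>' n x \<le> T (v' n) (\<Phi>' n) x"
    by (rule tendsto_le[OF sequentially_bot x'(4,3) always_eventually], rule allI)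
       (rule tendsto_le[OF sequentially_bot l2 l1 that[OF x'(1)]])
  show "T v \<Phi> x \<le> \<Phi> x" if "\<And>x. x \<in> U \<Longrightarrow> \<forall>\<^sub>F n in sequentially. T (v' n) (\<Phi>' n) x \<le> \<Phi>' n x"
    by (rule tendsto_le[OF sequentially_bot x'(3,4) always_eventually], rule allI)
       (rule tendsto_le[OF sequentially_bot l1 l2 that[OF x'(1)]])
qed

text \<open>
  Far out a profile is almost constant, so that its limits inherit the inequality between a
  constant and its image.  This restricts them to the zeros of the reaction term or to the
  intervals where it has the right sign.
\<close>
lemma end_seq:
  assumes \<Phi>: "profile \<Phi>" and l: "0 \<le> l" "l \<le> 1"
    and F: "(\<Phi> \<longlongrightarrow> l) F" and x': "\<And>y. filterlim (\<lambda>n. x' n + y) F sequentially"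
  shows "(\<lambda>n. \<Phi> (x' n)) \<longlonglongrightarrow> l" "(\<lambda>n. T v \<Phi> (x' n)) \<longlonglongrightarrow> (p + q) * l + r l"
proof -
  have lim: "(\<lambda>n. \<Phi> (x' n + y)) \<longlonglongrightarrow> l" for y by (rule filterlim_compose[OF F x'])
  from lim[of 0] show "(\<lambda>n. \<Phi> (x' n)) \<longlonglongrightarrow> l" by simp
  show "(\<lambda>n. T v \<Phi> (x' n)) \<longlonglongrightarrow> (p + q) * l + r l" by (rule T_tendsto_end[OF \<Phi> l lim])
qed

lemma sub_limit_bot:
  assumes \<Phi>: "profile \<Phi>" and l: "(\<Phi> \<longlongrightarrow> l) at_bot" "0 \<le> l" "l \<le> 1"
    and sub: "\<And>x. x < K \<Longrightarrow> \<Phi> x \<le> T v \<Phi> x"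
  shows "(1 - p - q) * l \<le> r l"
proof -
  note e = end_seq(1)[OF \<Phi> l(2,3,1) filterlim_minus_nat_at_bot] end_seq(2)[OF \<Phi> l(2,3,1) filterlim_minus_nat_at_bot, where v = v]
  have "\<forall>\<^sub>F n in sequentially. - real n + 0 \<le> K - 1"
    using filterlim_minus_nat_at_bot[of 0] unfolding filterlim_at_bot by blast
  then have "\<forall>\<^sub>F n in sequentially. \<Phi> (- real n) \<le> T v \<Phi> (- real n)"
    by eventually_elim (rule sub, simp)
  from tendsto_le[OF sequentially_bot e(2,1) this] show ?thesis by (simp add: algebra_simps)
qed

lemma
  assumes \<Phi>: "profile \<Phi>" and l: "(\<Phi> \<longlongrightarrow> l) at_top" "0 \<le> l" "l \<le> 1"
  shows sub_limit_top: "(\<And>x. \<Phi> x \<le> T v \<Phi> x) \<Longrightarrow> (1 - p - q) * l \<le> r l"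
    and super_limit_top: "(\<And>x. T v \<Phi> x \<le> \<Phi> x) \<Longrightarrow> r l \<le> (1 - p - q) * l"
proof -
  note e = end_seq(1)[OF \<Phi> l(2,3,1) filterlim_nat_at_top] end_seq(2)[OF \<Phi> l(2,3,1) filterlim_nat_at_top, where v = v]
  show "(1 - p - q) * l \<le> r l" if "\<And>x. \<Phi> x \<le> T v \<Phi> x"
    using tendsto_le[OF sequentially_bot e(2,1) always_eventually] that by (simp add: algebra_simps)
  show "r l \<le> (1 - p - q) * l" if "\<And>x. T v \<Phi> x \<le> \<Phi> x"
    using tendsto_le[OF sequentially_bot e(1,2) always_eventually] that by (simp add: algebra_simps)
qed

end

section \<open>Existence of bistable fronts\<close>

locale bistable = stable_hopping +
  fixes a :: real
  assumes a_pos: "0 < a" and a_less: "a < 1"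
    and r_low: "\<And>u. 0 < u \<Longrightarrow> u < a \<Longrightarrow> r u < (1 - p - q) * u"
    and r_a: "r a = (1 - p - q) * a"
    and r_high: "\<And>u. a < u \<Longrightarrow> u < 1 \<Longrightarrow> (1 - p - q) * u < r u"
begin

text \<open>
  A subfront need not be a front, but its existence at a speed already says that invasion of 0 is
  possible at that speed.  Right continuity makes the notion closed under Helly limits.
\<close>
definition subfront :: "real \<Rightarrow> (real \<Rightarrow> real) \<Rightarrow> bool"
  where "subfront v \<Phi> \<longleftrightarrow> profile \<Phi> \<and> rcont \<Phi> \<and> (\<forall>x. \<Phi> x \<le> T v \<Phi> x) \<and>
    (\<Phi> \<longlongrightarrow> 0) at_bot \<and> (\<exists>x. 0 < \<Phi> x)"

text \<open>
  Its limit at the left is below \<open>a\<close> and has a nonnegative reaction term, and 0 is the only such state.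
\<close>
lemma sub_starts_at_0:
  assumes \<Phi>: "profile \<Phi>" and sub: "\<And>x. x < K \<Longrightarrow> \<Phi> x \<le> T v \<Phi> x" and y: "\<Phi> y < a"
  shows "(\<Phi> \<longlongrightarrow> 0) at_bot"
proof -
  obtain l where l: "(\<Phi> \<longlongrightarrow> l) at_bot" "\<And>x. l \<le> \<Phi> x" "0 \<le> l" "l \<le> 1"
    using profile_limit_bot[OF \<Phi>] by blast
  have "l < a" using l(2)[of y] y by simp
  moreover have "(1 - p - q) * l \<le> r l" by (rule sub_limit_bot[OF \<Phi> l(1,3,4) sub])
  ultimately have "l = 0" using r_low[of l] l(3) by (cases "l = 0") auto
  with l(1) show ?thesis by simp
qed

lemma subfront_reaches_a:
  assumes "subfront v \<Phi>" "\<theta> < a" shows "\<exists>x. \<theta> < \<Phi> x"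
proof -
  obtain x0 where \<Phi>: "profile \<Phi>" "\<And>x. \<Phi> x \<le> T v \<Phi> x" "0 < \<Phi> x0"
    using assms(1) by (auto simp: subfront_def)
  obtain l where l: "(\<Phi> \<longlongrightarrow> l) at_top" "\<And>x. \<Phi> x \<le> l" "0 \<le> l" "l \<le> 1"
    using profile_limit_top[OF \<Phi>(1)] by blast
  have "(1 - p - q) * l \<le> r l" by (rule sub_limit_top[OF \<Phi>(1) l(1,3,4) \<Phi>(2)])
  then have "\<theta> < l" using r_low[of l] l(2)[of x0] \<Phi>(3) assms(2) by (cases "l < a") auto
  from order_tendstoD(1)[OF l(1) this] show ?thesis
    using eventually_happens' trivial_limit_at_top_linorder by blast
qed

text \<open>
  The level \<open>a / 2\<close> used for normalisation lies strictly between 0 and \<open>a\<close>: subfronts exceed it, and a profile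
  below it on a half line starts at 0.
\<close>
lemma subfront_limit:
  assumes "\<And>n. subfront (v' n) (\<Phi>' n)" and v: "v' \<longlonglongrightarrow> v"
  shows "\<exists>\<Phi>. subfront v \<Phi>"
proof -
  have \<Phi>': "profile (\<Phi>' n)" "rcont (\<Phi>' n)" "\<And>x. \<Phi>' n x \<le> T (v' n) (\<Phi>' n) x"
    "(\<Phi>' n \<longlongrightarrow> 0) at_bot" for n
    using assms(1)[of n] by (auto simp: subfront_def)
  have "\<exists>X. a / 2 \<le> \<Phi>' n X \<and> (\<forall>x<X. \<Phi>' n x \<le> a / 2)" for n
  proof -
    obtain x1 where "a / 2 < \<Phi>' n x1"
      using subfront_reaches_a[OF assms(1), of "a / 2" n] a_pos by auto
    then obtain X where "a / 2 \<le> \<Phi>' n X" "\<And>x. x < X \<Longrightarrow> \<Phi>' n x < a / 2"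
      using first_passage[OF \<Phi>'(1,2,4)[of n], of "a / 2" x1] a_pos by auto
    then show ?thesis by (auto intro: less_imp_le)
  qed
  then obtain X where X: "\<And>n. a / 2 \<le> \<Phi>' n (X n)" "\<And>n x. x < X n \<Longrightarrow> \<Phi>' n x \<le> a / 2" by metis
  define \<Psi>' where "\<Psi>' n x = \<Phi>' n (x + X n)" for n x
  have \<Psi>': "profile (\<Psi>' n)" "rcont (\<Psi>' n)" "\<Psi>' n x \<le> T (v' n) (\<Psi>' n) x" for n x
    unfolding \<Psi>'_def[abs_def] wave_op_shift
    by (auto intro: profile_shift rcont_shift \<Phi>')
  obtain s :: "nat \<Rightarrow> nat" and \<Phi> where s: "strict_mono s" and \<Phi>: "profile \<Phi>" "rcont \<Phi>"
    and lim: "\<And>x. isCont \<Phi> x \<Longrightarrow> (\<lambda>n. \<Psi>' (s n) x) \<longlonglongrightarrow> \<Phi> x"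
    by (rule profile_helly[of \<Psi>']) (use \<Psi>' in auto)
  have vs: "(\<lambda>n. v' (s n)) \<longlonglongrightarrow> v" using LIMSEQ_subseq_LIMSEQ[OF v s] by (simp add: comp_def)
  have sub: "\<Phi> x \<le> T v \<Phi> x" for x
    by (rule sub_limit[OF \<Psi>'(1) \<Phi> lim vs, of UNIV]) (auto intro: \<Psi>' always_eventually)
  have low: "\<Phi> x \<le> a / 2" if "x < 0" for x
    by (rule normalised_limit(1)[where \<Phi>' = "\<lambda>n. \<Psi>' (s n)", OF \<Phi> lim _ that])
       (assumption, simp only: \<Psi>'_def, rule X(2), simp)
  have high: "a / 2 \<le> \<Phi> 0"
  proof (rule normalised_limit(2)[OF \<Phi> lim])
    show "a / 2 \<le> \<Psi>' (s n) x" if "0 \<le> x" for n x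
      using that profile_le[OF \<Phi>'(1), of "X (s n)" "x + X (s n)" "s n"] X(1)[of "s n"] by (simp add: \<Psi>'_def)
  qed
  have "(\<Phi> \<longlongrightarrow> 0) at_bot"
    by (rule sub_starts_at_0[OF \<Phi>(1) sub, of "-1"]) (use low[of "-1"] a_pos in auto)
  moreover have "0 < \<Phi> 0" using high a_pos by simp
  ultimately show ?thesis using \<Phi> sub by (auto simp: subfront_def)
qed

text \<open>
  The fixed point for the obstacles \<open>a / 2\<close> on the left of 0 and 1 on the right of \<open>N\<close> is a subsolution on the left of
  \<open>N\<close> and a supersolution on the right of 0.  If its transition through the level \<open>a / 2\<close> stayed bounded as \<open>N\<close>
  grows, a Helly limit would be a subfront.
\<close>
lemma far_transition:
  assumes no: "\<And>\<Phi>. \<not> subfront v \<Phi>"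
  obtains \<Psi> X N where "profile \<Psi>" "rcont \<Psi>" "real n \<le> X" "X \<le> N" "\<And>x. N \<le> x \<Longrightarrow> \<Psi> x = 1"
    "\<And>x. x < N \<Longrightarrow> \<Psi> x \<le> T v \<Psi> x" "\<And>x. 0 \<le> x \<Longrightarrow> T v \<Psi> x \<le> \<Psi> x"
    "a / 2 \<le> \<Psi> X" "\<And>x. x < X \<Longrightarrow> \<Psi> x \<le> a / 2"
proof -
  have "\<exists>\<Psi>. profile \<Psi> \<and> rcont \<Psi> \<and> (\<forall>x\<ge>real N. \<Psi> x = 1) \<and> (\<forall>x<real N. \<Psi> x \<le> T v \<Psi> x) \<and>
      (\<forall>x\<ge>0. T v \<Psi> x \<le> \<Psi> x) \<and> (\<forall>x<0. \<Psi> x \<le> a / 2)" for N :: nat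
  proof -
    define lo where "lo x = (if x < real N then 0 else 1::real)" for x :: real
    define up where "up x = (if x < 0 then a / 2 else 1::real)" for x :: real
    have p: "profile lo" "profile up" using a_pos a_less
      by (auto simp: profile_def lo_def up_def mono_def)
    have rc: "rcont lo" "rcont up" unfolding lo_def[abs_def] up_def[abs_def] by (rule rcont_step)+
    have le: "lo x \<le> up x" for x using a_pos by (auto simp: lo_def up_def)
    from double_obstacle[OF p le, of v] obtain \<Psi> where \<Psi>: "profile \<Psi>" "rcont \<Psi>"
      "\<And>x. \<Psi> x = min (max (T v \<Psi> x) (lo x)) (up x)" using rc by metis
    have T: "0 \<le> T v \<Psi> x" "T v \<Psi> x \<le> 1" for x
      using profileD(2,3)[OF profile_T[OF \<Psi>(1)]] by auto
    show ?thesis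
    proof (intro exI[of _ \<Psi>] conjI allI impI \<Psi>(1,2))
      show "\<Psi> x = 1" if "real N \<le> x" for x
        using that T[of x] by (subst \<Psi>(3)) (auto simp: lo_def up_def)
      show "\<Psi> x \<le> T v \<Psi> x" if "x < real N" for x
        using that T[of x] by (subst \<Psi>(3)) (auto simp: lo_def up_def)
      show "T v \<Psi> x \<le> \<Psi> x" if "0 \<le> x" for x
        using that T[of x] \<Psi>(3)[of x] by (auto simp: lo_def up_def split: if_splits)
      show "\<Psi> x \<le> a / 2" if "x < 0" for x
        using that by (subst \<Psi>(3)) (auto simp: up_def)
    qed
  qed
  then obtain \<Psi> where \<Psi>: "\<And>N. profile (\<Psi> N)" "\<And>N. rcont (\<Psi> N)" "\<And>N x. real N \<le> x \<Longrightarrow> \<Psi> N x = 1"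
    "\<And>N x. x < real N \<Longrightarrow> \<Psi> N x \<le> T v (\<Psi> N) x" "\<And>N x. 0 \<le> x \<Longrightarrow> T v (\<Psi> N) x \<le> \<Psi> N x"
    "\<And>N x. x < 0 \<Longrightarrow> \<Psi> N x \<le> a / 2"
    by metis
  have \<Psi>0: "(\<Psi> N \<longlongrightarrow> 0) at_bot" for N
    by (rule sub_starts_at_0[where \<Phi> = "\<Psi> N" and K = "real N" and v = v and y = "-1", OF \<Psi>(1) \<Psi>(4)]) (use \<Psi>(6)[of "-1" N] a_pos in auto)
  have "\<exists>X. X \<le> real N \<and> a / 2 \<le> \<Psi> N X \<and> (\<forall>x<X. \<Psi> N x \<le> a / 2)" for N
  proof -
    have "a / 2 \<le> \<Psi> N (real N)" using \<Psi>(3)[of N "real N"] a_less by simp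
    then obtain X where "X \<le> real N" "a / 2 \<le> \<Psi> N X" "\<And>x. x < X \<Longrightarrow> \<Psi> N x < a / 2"
      using first_passage[OF \<Psi>(1,2) \<Psi>0[of N], of "a / 2" "real N"] a_pos by auto
    then show ?thesis by (auto intro: less_imp_le)
  qed
  then obtain X where X: "\<And>N. X N \<le> real N" "\<And>N. a / 2 \<le> \<Psi> N (X N)" "\<And>N x. x < X N \<Longrightarrow> \<Psi> N x \<le> a / 2"
    by metis
  have "\<exists>N. real n \<le> X N"
  proof (rule ccontr)
    assume "\<nexists>N. real n \<le> X N"
    then have Xn: "X N < real n" for N by (meson not_le)
    obtain s :: "nat \<Rightarrow> nat" and \<Phi> where s: "strict_mono s" and \<Phi>: "profile \<Phi>" "rcont \<Phi>"
      and lim: "\<And>x. isCont \<Phi> x \<Longrightarrow> (\<lambda>n. \<Psi> (s n) x) \<longlonglongrightarrow> \<Phi> x"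
      by (rule profile_helly[of \<Psi>]) (use \<Psi> in auto)
    have sub: "\<Phi> x \<le> T v \<Phi> x" for x
    proof (rule sub_limit[OF \<Psi>(1) \<Phi> lim tendsto_const, of UNIV])
      show "\<forall>\<^sub>F n in sequentially. \<Psi> (s n) x \<le> T v (\<Psi> (s n)) x" for x
      proof -
        obtain m :: nat where m: "x < real m" using reals_Archimedean2 by blast
        show ?thesis using eventually_ge_at_top[of m]
        proof eventually_elim
          case (elim n)
          have "real m \<le> real (s n)" using elim seq_suble[OF s, of n] by simp
          then show ?case using m by (intro \<Psi>(4)) simp
        qed
      qed
    qed auto
    have low: "\<Phi> x \<le> a / 2" if "x < 0" for x
      by (rule normalised_limit(1)[where \<Phi>' = "\<lambda>n. \<Psi> (s n)", OF \<Phi> lim \<Psi>(6) that])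
    have high: "a / 2 \<le> \<Phi> (real n)"
    proof (rule normalised_limit(2)[OF \<Phi> lim])
      show "a / 2 \<le> \<Psi> (s k) x" if "real n \<le> x" for k x
        using that profile_le[OF \<Psi>(1), of "X (s k)" x "s k"] X(2)[of "s k"] Xn[of "s k"] by simp
    qed
    have "(\<Phi> \<longlongrightarrow> 0) at_bot"
      by (rule sub_starts_at_0[OF \<Phi>(1) sub, of "-1"]) (use low[of "-1"] a_pos in auto)
    moreover have "0 < \<Phi> (real n)" using high a_pos by simp
    ultimately have "subfront v \<Phi>" using \<Phi> sub by (auto simp: subfront_def)
    with no show False by blast
  qed
  then obtain N where "real n \<le> X N" by blast
  then show thesis
    by (intro that[of "\<Psi> N" "X N" "real N"] \<Psi> X)
qed

text \<open>
  Recentred at the transition, the left obstacle disappears and the limit is a supersolution on the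
  whole line.  On the negative half line it is also a subsolution, because the right obstacle lies beyond
  the transition; hence it starts at 0.  If its limit on the right were at most \<open>a\<close>, the right obstacle would disappear as
  well, and the limit would be a subsolution that stays below \<open>a\<close>, which is excluded by assumption.
\<close>
lemma super_at_limit_of_gaps:
  assumes no: "\<And>n \<Phi>. \<not> subfront (v' n) \<Phi>" and v: "v' \<longlonglongrightarrow> v"
    and no_low: "\<And>\<Phi> x. profile \<Phi> \<Longrightarrow> (\<And>x. \<Phi> x \<le> T v \<Phi> x) \<Longrightarrow> (\<Phi> \<longlongrightarrow> 0) at_bot \<Longrightarrow>
      (\<And>x. \<Phi> x \<le> a) \<Longrightarrow> \<Phi> x = 0"
  obtains \<Phi> where "profile \<Phi>" "\<And>x. T v \<Phi> x \<le> \<Phi> x" "(\<Phi> \<longlongrightarrow> 0) at_bot" "(\<Phi> \<longlongrightarrow> 1) at_top"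
proof -
  have "\<exists>\<Psi> X N. profile \<Psi> \<and> rcont \<Psi> \<and> real n \<le> X \<and> X \<le> N \<and> (\<forall>x\<ge>N. \<Psi> x = 1) \<and>
    (\<forall>x<N. \<Psi> x \<le> T (v' n) \<Psi> x) \<and> (\<forall>x\<ge>0. T (v' n) \<Psi> x \<le> \<Psi> x) \<and>
    a / 2 \<le> \<Psi> X \<and> (\<forall>x<X. \<Psi> x \<le> a / 2)" for n
    by (rule far_transition[OF no, of n n]) blast
  then obtain \<Psi> X N where \<Psi>: "\<And>n. profile (\<Psi> n)" "\<And>n. rcont (\<Psi> n)"
    and X: "\<And>n. real n \<le> X n" "\<And>n. X n \<le> N n"
    and ge_N: "\<And>n x. N n \<le> x \<Longrightarrow> \<Psi> n x = 1"
    and sub_N: "\<And>n x. x < N n \<Longrightarrow> \<Psi> n x \<le> T (v' n) (\<Psi> n) x"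
    and super_0: "\<And>n x. 0 \<le> x \<Longrightarrow> T (v' n) (\<Psi> n) x \<le> \<Psi> n x"
    and cross: "\<And>n. a / 2 \<le> \<Psi> n (X n)" "\<And>n x. x < X n \<Longrightarrow> \<Psi> n x \<le> a / 2"
    by metis
  define \<Psi>' where "\<Psi>' n x = \<Psi> n (x + X n)" for n x
  have \<Psi>': "profile (\<Psi>' n)" "rcont (\<Psi>' n)" for n
    unfolding \<Psi>'_def[abs_def] by (auto intro: profile_shift rcont_shift \<Psi>)
  have T': "T (v' n) (\<Psi>' n) x = T (v' n) (\<Psi> n) (x + X n)" for n x
    unfolding \<Psi>'_def[abs_def] wave_op_shift ..
  obtain s :: "nat \<Rightarrow> nat" and \<Phi> where s: "strict_mono s" and \<Phi>: "profile \<Phi>" "rcont \<Phi>"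
    and lim: "\<And>x. isCont \<Phi> x \<Longrightarrow> (\<lambda>n. \<Psi>' (s n) x) \<longlonglongrightarrow> \<Phi> x"
    by (rule profile_helly[of \<Psi>']) (use \<Psi>' in auto)
  have vs: "(\<lambda>n. v' (s n)) \<longlonglongrightarrow> v" using LIMSEQ_subseq_LIMSEQ[OF v s] by (simp add: comp_def)
  have super: "T v \<Phi> x \<le> \<Phi> x" for x
  proof (rule super_limit[OF \<Psi>'(1) \<Phi> lim vs, of UNIV])
    show "\<forall>\<^sub>F n in sequentially. T (v' (s n)) (\<Psi>' (s n)) x \<le> \<Psi>' (s n) x" for x
    proof -
      obtain m :: nat where m: "- x < real m" using reals_Archimedean2 by blast
      show ?thesis using eventually_ge_at_top[of m]
      proof eventually_elim
        case (elim n)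
        have "real m \<le> real (s n)" using elim seq_suble[OF s, of n] by simp
        then have "0 \<le> x + X (s n)" using m X(1)[of "s n"] by simp
        then show ?case unfolding T' \<Psi>'_def by (rule super_0)
      qed
    qed
  qed auto
  have sub_neg: "\<Phi> x \<le> T v \<Phi> x" if "x < 0" for x
  proof (rule sub_limit[OF \<Psi>'(1) \<Phi> lim vs, of "{..<0}"])
    show "\<forall>\<^sub>F n in sequentially. \<Psi>' (s n) x \<le> T (v' (s n)) (\<Psi>' (s n)) x" if "x \<in> {..<0}" for x
      unfolding T' \<Psi>'_def
    proof (intro always_eventually allI sub_N)
      show "x + X (s n) < N (s n)" for n using X(2)[of "s n"] that by simp
    qed
  qed (use that in auto)
  have low: "\<Phi> x \<le> a / 2" if "x < 0" for x
    by (rule normalised_limit(1)[where \<Phi>' = "\<lambda>n. \<Psi>' (s n)", OF \<Phi> lim _ that])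
       (assumption, simp only: \<Psi>'_def, rule cross(2), simp)
  have high: "a / 2 \<le> \<Phi> 0"
  proof (rule normalised_limit(2)[OF \<Phi> lim])
    show "a / 2 \<le> \<Psi>' (s n) x" if "0 \<le> x" for n x
      using that profile_le[OF \<Psi>(1), of "X (s n)" "x + X (s n)" "s n"] cross(1)[of "s n"] by (simp add: \<Psi>'_def)
  qed
  have bot: "(\<Phi> \<longlongrightarrow> 0) at_bot"
    by (rule sub_starts_at_0[OF \<Phi>(1) sub_neg, of 0 "-1"]) (use low[of "-1"] a_pos in auto)
  obtain l where l: "(\<Phi> \<longlongrightarrow> l) at_top" "\<And>x. \<Phi> x \<le> l" "0 \<le> l" "l \<le> 1"
    using profile_limit_top[OF \<Phi>(1)] by blast
  have "r l \<le> (1 - p - q) * l" by (rule super_limit_top[OF \<Phi>(1) l(1,3,4) super])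
  then have "l = 1 \<or> l \<le> a" using r_high[of l] l(4) by force
  moreover have "\<not> l \<le> a"
  proof
    assume "l \<le> a"
    then have le_a: "\<Phi> x \<le> a" for x using l(2)[of x] by simp
    have "\<Phi> x \<le> T v \<Phi> x" for x
    proof (rule sub_limit[OF \<Psi>'(1) \<Phi> lim vs, of UNIV])
      show "\<forall>\<^sub>F n in sequentially. \<Psi>' (s n) x \<le> T (v' (s n)) (\<Psi>' (s n)) x" for x
      proof -
        obtain y where y: "x < y" "isCont \<Phi> y" using continuity_point_between[OF \<Phi>(1), of x "x + 1"] by auto
        have "\<Phi> y < 1" using le_a[of y] a_less by simp
        from order_tendstoD(2)[OF lim[OF y(2)] this] show ?thesis
        proof eventually_elim
          case (elim n)
          then have "y + X (s n) < N (s n)" using ge_N[of "s n" "y + X (s n)"] by (force simp: \<Psi>'_def)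
          then show ?case unfolding T' \<Psi>'_def using y(1) by (intro sub_N) simp
        qed
      qed
    qed auto
    from no_low[OF \<Phi>(1) this bot le_a, of 0] high a_pos show False by simp
  qed
  ultimately have "(\<Phi> \<longlongrightarrow> 1) at_top" using l(1) by auto
  with \<Phi>(1) super bot show thesis by (rule that)
qed

text \<open>
  At the infimum of the speeds of subfronts there is a subfront, since it is a limit of such speeds, and a
  supersolution, since it is a limit of speeds without subfronts.  The fixed point is found between them.
\<close>
theorem front_exists:
  assumes below: "\<And>v \<Phi>. subfront v \<Phi> \<Longrightarrow> v\<^sub>0 \<le> v"
    and above: "subfront v\<^sub>1 \<psi>"
    and no_low: "\<And>\<Phi> x. profile \<Phi> \<Longrightarrow> (\<And>x. \<Phi> x \<le> T v\<^sub>1 \<Phi> x) \<Longrightarrow> (\<Phi> \<longlongrightarrow> 0) at_bot \<Longrightarrow>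
      (\<And>x. \<Phi> x \<le> a) \<Longrightarrow> \<Phi> x = 0"
  obtains v \<Phi> where "profile \<Phi>" "\<And>x. T v \<Phi> x = \<Phi> x" "(\<Phi> \<longlongrightarrow> 0) at_bot" "(\<Phi> \<longlongrightarrow> 1) at_top"
proof -
  define A where "A = {v. \<exists>\<Phi>. subfront v \<Phi>}"
  define v where "v = Inf A"
  have A: "v\<^sub>1 \<in> A" using above by (auto simp: A_def)
  have bdd: "bdd_below A" by (rule bdd_belowI[where m = v\<^sub>0]) (use below in \<open>auto simp: A_def\<close>)
  have "v \<le> v\<^sub>1" unfolding v_def by (rule cInf_lower[OF A bdd])
  have no_low': "\<Phi> x = 0" if "profile \<Phi>" "\<And>x. \<Phi> x \<le> T v \<Phi> x" "(\<Phi> \<longlongrightarrow> 0) at_bot" "\<And>x. \<Phi> x \<le> a" for \<Phi> x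
    by (rule no_low[OF that(1) order_trans[OF that(2) T_mono_speed[OF that(1) \<open>v \<le> v\<^sub>1\<close>]] that(3,4)])
  have "v \<in> closure A" unfolding v_def using A bdd by (intro closure_contains_Inf) auto
  then obtain v' where v': "\<And>n. v' n \<in> A" "v' \<longlonglongrightarrow> v" unfolding closure_sequential by blast
  then obtain \<Phi>' where "\<And>n. subfront (v' n) (\<Phi>' n)" unfolding A_def by (auto, metis)
  from subfront_limit[OF this v'(2)] obtain \<Phi> where \<Phi>: "subfront v \<Phi>" by blast
  have gap: "\<not> subfront (v - inverse (Suc n)) \<Psi>" for n \<Psi>
  proof
    assume "subfront (v - inverse (Suc n)) \<Psi>"
    then have "v - inverse (Suc n) \<in> A" by (auto simp: A_def)
    from cInf_lower[OF this bdd] show False by (simp add: v_def)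
  qed
  have lim_gap: "(\<lambda>n. v - inverse (real (Suc n))) \<longlonglongrightarrow> v"
    using LIMSEQ_inverse_real_of_nat_add_minus[of v] by simp
  have "\<exists>up. profile up \<and> (\<forall>x. T v up x \<le> up x) \<and> (up \<longlongrightarrow> 0) at_bot \<and> (up \<longlongrightarrow> 1) at_top"
  proof (rule super_at_limit_of_gaps[where v = v and v' = "\<lambda>n. v - inverse (real (Suc n))", OF gap lim_gap])
    show "\<Phi> x = 0" if "profile \<Phi>" "\<And>x. \<Phi> x \<le> T v \<Phi> x" "(\<Phi> \<longlongrightarrow> 0) at_bot" "\<And>x. \<Phi> x \<le> a" for \<Phi> x
      using that by (rule no_low')
  qed blast
  then obtain up where up: "profile up" "\<And>x. T v up x \<le> up x" "(up \<longlongrightarrow> 0) at_bot" "(up \<longlongrightarrow> 1) at_top"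
    by blast
  obtain x0 where lo: "profile \<Phi>" "\<And>x. \<Phi> x \<le> T v \<Phi> x" "(\<Phi> \<longlongrightarrow> 0) at_bot" "0 < \<Phi> x0"
    using \<Phi> by (auto simp: subfront_def)
  have "\<forall>\<^sub>F x in at_top. 1 - \<eta> < up x" by (rule order_tendstoD(1)[OF up(4)]) (use \<eta>_pos in simp)
  then obtain X where X: "\<And>x. X \<le> x \<Longrightarrow> 1 - \<eta> < up x" unfolding eventually_at_top_linorder by blast
  obtain y where y: "\<And>x. x \<le> y \<Longrightarrow> \<Phi> x < \<eta>" using tendsto_at_bot_profileE[OF lo(3) \<eta>_pos] by blast
  define t where "t = X + 1 - y"
  define lo' where "lo' x = \<Phi> (x - t)" for x
  have below_up: "lo' x \<le> up x" for x unfolding lo'_def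
    by (rule shift_below[where Y = "X + 1" and X = X and R = 1, OF lo(1) up(1) lo(2) up(2) \<gamma>_pos \<gamma>_le near_0 near_1])
       (use y[of y] X in \<open>auto simp: t_def profileD[OF lo(1)] intro: less_imp_le\<close>)
  have lo': "profile lo'" "lo' x \<le> T v lo' x" for x
    using profile_shift[OF lo(1), of "- t"] wave_op_shift[of p q h r v \<Phi> "- t" x] lo(2)[of "x - t"]
    by (simp_all add: lo'_def[abs_def])
  obtain \<Psi> where \<Psi>: "profile \<Psi>" "\<And>x. \<Psi> x = min (max (T v \<Psi> x) (lo' x)) (up x)"
    using double_obstacle[OF lo'(1) up(1) below_up] by metis
  have ge: "lo' x \<le> \<Psi> x" for x using below_up[of x] by (subst \<Psi>(2)) auto
  have le: "\<Psi> x \<le> up x" for x by (subst \<Psi>(2)) auto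
  have eq: "T v \<Psi> x = \<Psi> x" for x
    using \<Psi>(2)[of x] order_trans[OF lo'(2) T_mono_profile[OF lo'(1) \<Psi>(1) ge], of x]
      order_trans[OF T_mono_profile[OF \<Psi>(1) up(1) le] up(2), of x] by auto
  have bot: "(\<Psi> \<longlongrightarrow> 0) at_bot"
    by (rule tendsto_sandwich[OF _ _ tendsto_const up(3)])
       (auto intro!: always_eventually le profileD(2)[OF \<Psi>(1)])
  obtain l where l: "(\<Psi> \<longlongrightarrow> l) at_top" "\<And>x. \<Psi> x \<le> l" "0 \<le> l" "l \<le> 1"
    using profile_limit_top[OF \<Psi>(1)] by blast
  have "0 < \<Psi> (x0 + t)" using ge[of "x0 + t"] lo(4) by (simp add: lo'_def)
  then have "0 < l" using l(2)[of "x0 + t"] by simp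
  have "\<not> l \<le> a"
  proof
    assume "l \<le> a"
    then have "\<Psi> x \<le> a" for x using l(2)[of x] by simp
    from no_low'[OF \<Psi>(1) _ bot this, of "x0 + t"] \<open>0 < \<Psi> (x0 + t)\<close> eq show False by simp
  qed
  moreover have "r l \<le> (1 - p - q) * l"
    by (rule super_limit_top[where v = v, OF \<Psi>(1) l(1,3,4)]) (simp add: eq)
  ultimately have "l = 1" using r_high[of l] l(4) by force
  with l(1) have "(\<Psi> \<longlongrightarrow> 1) at_top" by simp
  with \<Psi>(1) eq bot show thesis by (rule that)
qed

end

section \<open>The wave operator as a resolvent\<close>

lemma ex_in_interval_of_AE:
  assumes "AE s in lborel. P s" "c < (d::real)"
  shows "\<exists>s. c < s \<and> s < d \<and> P s"
proof (rule ccontr)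
  assume *: "\<nexists>s. c < s \<and> s < d \<and> P s"
  have "AE s in lborel. s \<notin> {c<..<d}" using assms(1) by eventually_elim (use * in auto)
  then have "{c<..<d} \<in> null_sets lborel" by (subst AE_iff_null_sets) auto
  then show False using assms(2) by (auto dest: null_setsD1)
qed

text \<open>
  Absence of memory of the exponential law, which turns the expectation into an integral over a bounded
  interval plus a multiple of a translate of the expectation.
\<close>
lemma waiting_time_split:
  fixes f :: "real \<Rightarrow> real"
  assumes [measurable]: "f \<in> borel_measurable borel" and B: "\<And>s. \<bar>f s\<bar> \<le> B" and t: "0 \<le> t"
  shows "integral\<^sup>L waiting_time f
    = (LBINT s:{0..t}. exp (- s) * f s) + exp (- t) * integral\<^sup>L waiting_time (\<lambda>s. f (t + s))"
proof -
  define g where "g s = indicator {0..} s * (exp (- s) * f s)" for s :: real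
  have [measurable]: "g \<in> borel_measurable borel" unfolding g_def by measurable
  have E: "integral\<^sup>L waiting_time f = integral\<^sup>L lborel g"
    using integral_waiting_time[OF assms(1)] by (simp add: g_def[abs_def] set_lebesgue_integral_def)
  have "integrable waiting_time f" by (rule integrable_waiting_time[OF assms(1) B])
  then have "integrable lborel (\<lambda>s. exponential_density 1 s *\<^sub>R f s)"
    unfolding waiting_time_def by (subst (asm) integrable_density) (auto simp: exponential_density_nonneg)
  moreover have "(\<lambda>s. exponential_density 1 s *\<^sub>R f s) = g"
    by (auto simp: g_def exponential_density_def fun_eq_iff)
  ultimately have int: "integrable lborel g" by simp
  have int1: "integrable lborel (\<lambda>s. indicator {0..<t} s * g s)"
    and int2: "integrable lborel (\<lambda>s. indicator {t..} s * g s)"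
    by (rule Bochner_Integration.integrable_bound[OF int]; auto simp: indicator_def)+
  have "g s = indicator {0..<t} s * g s + indicator {t..} s * g s" for s
    by (auto simp: g_def indicator_def)
  then have "integral\<^sup>L lborel g = integral\<^sup>L lborel (\<lambda>s. indicator {0..<t} s * g s + indicator {t..} s * g s)"
    by simp
  also have "\<dots> = integral\<^sup>L lborel (\<lambda>s. indicator {0..<t} s * g s)
      + integral\<^sup>L lborel (\<lambda>s. indicator {t..} s * g s)"
    by (rule Bochner_Integration.integral_add[OF int1 int2])
  also have "integral\<^sup>L lborel (\<lambda>s. indicator {0..<t} s * g s) = (LBINT s:{0..t}. exp (- s) * f s)"
    unfolding set_lebesgue_integral_def
  proof (rule integral_cong_AE)
    have "AE s in lborel. s \<noteq> t" by (rule AE_lborel_singleton)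
    then show "AE s in lborel. indicator {0..<t} s * g s = indicator {0..t} s *\<^sub>R (exp (- s) * f s)"
      by eventually_elim (auto simp: g_def indicator_def)
  qed auto
  also have "integral\<^sup>L lborel (\<lambda>s. indicator {t..} s * g s)
      = integral\<^sup>L lborel (\<lambda>s. indicator {t..} (t + s) * g (t + s))"
    using lborel_integral_real_affine[of 1 "\<lambda>s. indicator {t..} s * g s" t] by simp
  also have "\<dots> = integral\<^sup>L lborel (\<lambda>s. exp (- t) * (indicator {0..} s *\<^sub>R (exp (- s) * f (t + s))))"
    using t by (intro Bochner_Integration.integral_cong) (auto simp: g_def indicator_def exp_add exp_diff exp_minus field_simps)
  also have "\<dots> = exp (- t) * integral\<^sup>L waiting_time (\<lambda>s. f (t + s))"
    by (subst integral_waiting_time) (auto simp: set_lebesgue_integral_def)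
  finally show ?thesis using E by simp
qed

text \<open>
  The primitive of \<open>exp (- s) (f - v f')(x + v s)\<close> is \<open>- exp (- s) f(x + v s)\<close>.  The boundary term and the remainder
  at time \<open>t\<close> are of order \<open>exp (- t)\<close>.
\<close>
lemma resolvent_of_derivative:
  fixes f f' :: "real \<Rightarrow> real"
  assumes D: "\<And>x. (f has_real_derivative f' x) (at x)" and cont: "\<And>x. isCont f' x"
    and B: "\<And>x. \<bar>f x\<bar> \<le> B" "\<And>x. \<bar>f' x\<bar> \<le> B"
  shows "integral\<^sup>L waiting_time (\<lambda>s. f (x + v * s) - v * f' (x + v * s)) = f x"
proof -
  define \<phi> where "\<phi> s = f (x + v * s) - v * f' (x + v * s)" for s
  have contf: "isCont f x" for x using D by (rule DERIV_isCont)
  have cont\<phi>: "isCont \<phi> s" for s unfolding \<phi>_def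
    by (intro continuous_intros isCont_o2[OF _ contf] isCont_o2[OF _ cont])
  have [measurable]: "\<phi> \<in> borel_measurable borel"
    using cont\<phi> by (intro borel_measurable_continuous_onI continuous_at_imp_continuous_on) auto
  define C where "C = B + \<bar>v\<bar> * B"
  have C: "\<bar>\<phi> s\<bar> \<le> C" for s
  proof -
    have "\<bar>\<phi> s\<bar> \<le> \<bar>f (x + v * s)\<bar> + \<bar>v * f' (x + v * s)\<bar>" unfolding \<phi>_def by linarith
    also have "\<dots> \<le> C" unfolding C_def abs_mult by (intro add_mono mult_left_mono B) auto
    finally show ?thesis .
  qed
  interpret prob_space waiting_time by (rule prob_space_waiting_time)
  have main: "\<bar>integral\<^sup>L waiting_time \<phi> - f x\<bar> \<le> exp (- t) * (B + C)" if t: "0 \<le> t" for t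
  proof -
    have "(LBINT s:{0..t}. exp (- s) * \<phi> s) = - exp (- t) * f (x + v * t) - (- exp (- 0) * f (x + v * 0))"
      unfolding set_lebesgue_integral_def
    proof (rule integral_FTC_atLeastAtMost[OF t])
      show "((\<lambda>s. - exp (- s) * f (x + v * s)) has_vector_derivative exp (- s) * \<phi> s) (at s within {0..t})" for s
        unfolding has_real_derivative_iff_has_vector_derivative[symmetric] \<phi>_def
        by (rule DERIV_subset[where s = UNIV])
           (auto intro!: derivative_eq_intros DERIV_chain2[OF D] simp: algebra_simps)
      show "continuous_on {0..t} (\<lambda>s. exp (- s) * \<phi> s)"
        by (intro continuous_at_imp_continuous_on ballI continuous_intros cont\<phi>)
    qed
    moreover have "integral\<^sup>L waiting_time \<phi>
        = (LBINT s:{0..t}. exp (- s) * \<phi> s) + exp (- t) * integral\<^sup>L waiting_time (\<lambda>s. \<phi> (t + s))"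
      by (rule waiting_time_split[OF _ C t]) measurable
    moreover have "\<bar>integral\<^sup>L waiting_time (\<lambda>s. \<phi> (t + s))\<bar> \<le> C"
    proof -
      have "\<bar>integral\<^sup>L waiting_time (\<lambda>s. \<phi> (t + s))\<bar> \<le> integral\<^sup>L waiting_time (\<lambda>s. \<bar>\<phi> (t + s)\<bar>)"
        by (rule integral_abs_bound)
      also have "\<dots> \<le> integral\<^sup>L waiting_time (\<lambda>s. C)"
        using order_trans[OF abs_ge_zero C[of 0]]
        by (intro integral_mono integrable_waiting_time[where B = C] C) (simp_all add: C)
      finally show ?thesis by simp
    qed
    ultimately have "integral\<^sup>L waiting_time \<phi> - f x
        = exp (- t) * (integral\<^sup>L waiting_time (\<lambda>s. \<phi> (t + s)) - f (x + v * t))"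
      by (simp add: algebra_simps)
    moreover have "\<bar>integral\<^sup>L waiting_time (\<lambda>s. \<phi> (t + s)) - f (x + v * t)\<bar> \<le> B + C"
      using \<open>\<bar>integral\<^sup>L waiting_time (\<lambda>s. \<phi> (t + s))\<bar> \<le> C\<close> B(1)[of "x + v * t"] by linarith
    ultimately show ?thesis by (simp add: abs_mult)
  qed
  have "(\<lambda>n. exp (- real n) * (B + C)) \<longlonglongrightarrow> 0 * (B + C)"
    by (intro tendsto_mult tendsto_const filterlim_compose[OF exp_at_bot])
       (simp add: filterlim_uminus_at_bot filterlim_real_sequentially)
  then have "\<bar>integral\<^sup>L waiting_time \<phi> - f x\<bar> \<le> 0 * (B + C)"
    by (rule LIMSEQ_le_const) (intro exI[of _ 0] allI impI main of_nat_0_le_iff)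
  then show ?thesis by (simp add: \<phi>_def[abs_def])
qed

text \<open>
  Starting from \<open>y = x - v\<close>, absence of memory expresses \<open>f (y + v t)\<close> through an integral with upper end \<open>t\<close>, for
  positive \<open>t\<close>.  The choice of \<open>y\<close> puts \<open>x\<close> at the interior time \<open>t = 1\<close>, where the fundamental theorem of
  calculus applies irrespective of the sign of \<open>v\<close>.
\<close>
lemma resolvent_differentiable:
  fixes f g :: "real \<Rightarrow> real"
  assumes g: "\<And>x. isCont g x" "\<And>x. \<bar>g x\<bar> \<le> B" and v: "v \<noteq> 0"
    and f: "\<And>x. f x = integral\<^sup>L waiting_time (\<lambda>s. g (x + v * s))"
  shows "(f has_real_derivative (f x - g x) / v) (at x)"
proof -
  have contg: "isCont (\<lambda>s. g (y + v * s)) s" for y s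
    by (intro continuous_intros isCont_o2[OF _ g(1)])
  define y where "y = x - v"
  define I where "I t = (LBINT s=0..t. exp (- s) * g (y + v * s))" for t :: real
  have "((\<lambda>u. LBINT s=0..u. exp (- s) * g (y + v * s)) has_vector_derivative (exp (- 1) * g (y + v * 1))) (at 1 within {0..2})"
    using interval_integral_FTC2[of 0 0 2 "\<lambda>s. exp (- s) * g (y + v * s)" 1]
      continuous_at_imp_continuous_on[of "{0..2}" "\<lambda>s. exp (- s) * g (y + v * s)"] contg
    by (simp add: continuous_intros zero_ereal_def)
  then have "(I has_real_derivative exp (- 1) * g x) (at 1 within {0..2})"
    by (simp add: has_real_derivative_iff_has_vector_derivative I_def[abs_def] y_def)
  then have I': "(I has_real_derivative exp (- 1) * g x) (at 1)"
    by (simp add: at_within_interior[of 1 "{0..2}"])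
  have formula: "f (y + v * t) = exp t * (f y - I t)" if t: "0 \<le> t" for t
  proof -
    have [measurable]: "(\<lambda>s. g (y + v * s)) \<in> borel_measurable borel"
      using contg by (intro borel_measurable_continuous_onI continuous_at_imp_continuous_on) auto
    have "f y = (LBINT s:{0..t}. exp (- s) * g (y + v * s)) + exp (- t) * integral\<^sup>L waiting_time (\<lambda>s. g (y + v * (t + s)))"
      unfolding f[of y] by (rule waiting_time_split[OF _ g(2) t]) measurable
    also have "(LBINT s:{0..t}. exp (- s) * g (y + v * s)) = I t"
      using t unfolding I_def zero_ereal_def by (subst interval_integral_Icc) auto
    also have "integral\<^sup>L waiting_time (\<lambda>s. g (y + v * (t + s))) = f (y + v * t)"
      unfolding f[of "y + v * t"] by (simp add: algebra_simps)
    finally show ?thesis by (simp add: exp_minus field_simps)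
  qed
  have "((\<lambda>z. exp ((z - y) / v) * (f y - I ((z - y) / v))) has_real_derivative (f x - g x) / v) (at x)"
  proof -
    have 1: "(x - y) / v = 1" using v by (simp add: y_def)
    have "((\<lambda>z. I ((z - y) / v)) has_real_derivative exp (- 1) * g x * (1 / v)) (at x)"
      by (rule DERIV_chain2[where f = I]) (use I' 1 v in \<open>auto intro!: derivative_eq_intros\<close>)
    moreover have "((\<lambda>z. exp ((z - y) / v)) has_real_derivative exp 1 * (1 / v)) (at x)"
      using v 1 by (auto intro!: derivative_eq_intros)
    ultimately have "((\<lambda>z. exp ((z - y) / v) * (f y - I ((z - y) / v))) has_real_derivative
       exp 1 * (1 / v) * (f y - I ((x - y) / v)) + (0 - exp (- 1) * g x * (1 / v)) * exp ((x - y) / v)) (at x)"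
      by (intro DERIV_mult DERIV_diff DERIV_const)
    moreover have "f x = exp 1 * (f y - I 1)" using formula[of 1] by (simp add: y_def)
    moreover have "exp 1 * (1 / v) * (f y - I 1) + (0 - exp (- 1) * g x * (1 / v)) * exp 1
        = (exp 1 * (f y - I 1) - (exp (- 1) * exp 1) * g x) / v"
      by (simp add: algebra_simps diff_divide_distrib add_divide_distrib)
    moreover have "exp (- 1) * exp 1 = (1::real)" by (simp add: exp_minus)
    ultimately show ?thesis unfolding 1 by simp
  qed
  moreover have "\<forall>\<^sub>F z in nhds x. exp ((z - y) / v) * (f y - I ((z - y) / v)) = f z"
  proof -
    have "((\<lambda>z. (z - y) / v) \<longlongrightarrow> (x - y) / v) (nhds x)"
      using v by (intro tendsto_intros filterlim_ident) auto
    moreover have "0 < (x - y) / v" using v by (simp add: y_def)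
    ultimately have "\<forall>\<^sub>F z in nhds x. 0 < (z - y) / v" by (rule order_tendstoD)
    then show ?thesis
    proof eventually_elim
      case (elim z)
      then show ?case using formula[of "(z - y) / v"] v by simp
    qed
  qed
  ultimately show ?thesis by (subst DERIV_cong_ev[OF refl _ refl]) (auto elim: eventually_mono)
qed

context hopping
begin

lemma isCont_G:
  assumes \<Phi>: "profile \<Phi>" and c: "\<And>x. isCont \<Phi> x" shows "isCont (G \<Phi>) x"
proof -
  have "isCont (T 0 \<Phi>) x" by (rule T_continuous[OF \<Phi> c])
  then show ?thesis by (simp add: wave_op_zero[abs_def])
qed

lemma T_minus_profile:
  assumes \<Phi>: "profile \<Phi>" and D: "\<And>x. (\<Phi> has_real_derivative \<Phi>' x) (at x)" and cont: "\<And>x. isCont \<Phi>' x"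
    and B: "\<And>x. \<bar>\<Phi>' x\<bar> \<le> B"
  shows "T v \<Phi> x - \<Phi> x = integral\<^sup>L waiting_time (\<lambda>s. v * \<Phi>' (x + v * s) - \<Phi> (x + v * s) + G \<Phi> (x + v * s))"
    and "integrable waiting_time (\<lambda>s. v * \<Phi>' (x + v * s) - \<Phi> (x + v * s) + G \<Phi> (x + v * s))"
proof -
  have contf: "isCont \<Phi> x" for x using D by (rule DERIV_isCont)
  have [measurable]: "\<Phi> \<in> borel_measurable borel" "\<Phi>' \<in> borel_measurable borel"
    using contf cont by (auto intro!: borel_measurable_continuous_onI continuous_at_imp_continuous_on)
  have r: "integral\<^sup>L waiting_time (\<lambda>s. \<Phi> (x + v * s) - v * \<Phi>' (x + v * s)) = \<Phi> x"
    by (rule resolvent_of_derivative[where B = "max 1 B", OF D cont])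
       (auto simp: le_max_iff_disj B profileD[OF \<Phi>])
  have i0: "integrable waiting_time (\<lambda>s. \<Phi> (x + v * s))"
    by (rule integrable_waiting_time[where B = 1]) (auto simp: profileD[OF \<Phi>])
  have i1: "integrable waiting_time (\<lambda>s. \<Phi>' (x + v * s))"
    by (rule integrable_waiting_time[where B = B]) (auto simp: B)
  have i: "integrable waiting_time (\<lambda>s. \<Phi> (x + v * s) - v * \<Phi>' (x + v * s))"
    using i0 i1 by (intro Bochner_Integration.integrable_diff integrable_mult_right) auto
  have eq: "v * \<Phi>' y - \<Phi> y + G \<Phi> y = G \<Phi> y - (\<Phi> y - v * \<Phi>' y)" for y by simp
  show "integrable waiting_time (\<lambda>s. v * \<Phi>' (x + v * s) - \<Phi> (x + v * s) + G \<Phi> (x + v * s))"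
    unfolding eq by (intro Bochner_Integration.integrable_diff i G_integrable \<Phi>)
  show "T v \<Phi> x - \<Phi> x = integral\<^sup>L waiting_time (\<lambda>s. v * \<Phi>' (x + v * s) - \<Phi> (x + v * s) + G \<Phi> (x + v * s))"
    unfolding eq wave_op_def
    by (subst Bochner_Integration.integral_diff[OF G_integrable[OF \<Phi>] i]) (simp add: r)
qed

text \<open>
  For smooth profiles the inequality \<open>T v \<Phi> < \<Phi>\<close> can be read off from the differential equation, for \<open>T v \<Phi> - \<Phi>\<close> is an
  average of its residual.
\<close>
lemma
  assumes \<Phi>: "profile \<Phi>" and D: "\<And>x. (\<Phi> has_real_derivative \<Phi>' x) (at x)" and cont: "\<And>x. isCont \<Phi>' x"
    and B: "\<And>x. \<bar>\<Phi>' x\<bar> \<le> B"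
  shows T_less_if_residual_neg: "(\<And>x. v * \<Phi>' x - \<Phi> x + G \<Phi> x < 0) \<Longrightarrow> T v \<Phi> x < \<Phi> x"
    and T_greater_if_residual_pos: "(\<And>x. 0 < v * \<Phi>' x - \<Phi> x + G \<Phi> x) \<Longrightarrow> \<Phi> x < T v \<Phi> x"
proof -
  note t = T_minus_profile[OF assms, of v x]
  interpret prob_space waiting_time by (rule prob_space_waiting_time)
  show "T v \<Phi> x < \<Phi> x" if "\<And>x. v * \<Phi>' x - \<Phi> x + G \<Phi> x < 0"
    using integral_less_AE_space[OF t(2) integrable_const[of 0]] that t(1) emeasure_space_1 by simp
  show "\<Phi> x < T v \<Phi> x" if "\<And>x. 0 < v * \<Phi>' x - \<Phi> x + G \<Phi> x"
    using integral_less_AE_space[OF integrable_const[of 0] t(2)] that t(1) emeasure_space_1 by simp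
qed

end

section \<open>Uniqueness of the speed\<close>

text \<open>
  Iterating the dilation moves the argument to 0.
\<close>
lemma eq_at_0_of_dilation:
  fixes f :: "real \<Rightarrow> real"
  assumes "isCont f 0" "0 < \<rho>" "\<rho> < 1" and f: "\<And>y. 0 < y \<Longrightarrow> f y = f (\<rho> * y)" and "0 < y"
  shows "f y = f 0"
proof -
  have "f (\<rho> ^ n * y) = f y" for n
  proof (induction n)
    case (Suc n)
    have "0 < \<rho> ^ n * y" using assms(2,5) by simp
    from f[OF this] Suc show ?case by (simp add: mult.assoc)
  qed simp
  moreover have "(\<lambda>n. \<rho> ^ n * y) \<longlonglongrightarrow> 0 * y"
    using assms by (intro tendsto_intros LIMSEQ_power_zero) auto
  then have "(\<lambda>n. f (\<rho> ^ n * y)) \<longlonglongrightarrow> f 0" by (intro isCont_tendsto_compose[OF assms(1)]) simp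
  ultimately have "(\<lambda>n::nat. f y) \<longlonglongrightarrow> f 0" by simp
  then show ?thesis by (simp add: LIMSEQ_const_iff)
qed

context stable_hopping
begin

text \<open>
  If the average of \<open>G \<Phi>\<close> attains its maximal value 1 then \<open>G \<Phi>\<close> equals 1 at points arbitrarily close to the base point, and then
  \<open>\<Phi>\<close> equals 1 one mesh width further to the left.  Half of that distance is lost to the random time.
  Iterating contradicts the limit 0.
\<close>
lemma fixed_less_1:
  assumes \<Phi>: "profile \<Phi>" and fixed: "\<And>x. T v \<Phi> x = \<Phi> x" and lim: "(\<Phi> \<longlongrightarrow> 0) at_bot"
  shows "\<Phi> x < 1"
proof (rule ccontr)
  assume "\<not> \<Phi> x < 1"
  then have x1: "\<Phi> x = 1" using profileD(3)[OF \<Phi>, of x] by simp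
  have step: "\<Phi> (y - h / 2) = 1" if y: "\<Phi> y = 1" for y
  proof -
    interpret prob_space waiting_time by (rule prob_space_waiting_time)
    have int: "integrable waiting_time (\<lambda>s. 1 - G \<Phi> (y + v * s))"
      by (intro Bochner_Integration.integrable_diff G_integrable \<Phi>) simp
    have "integral\<^sup>L waiting_time (\<lambda>s. 1 - G \<Phi> (y + v * s)) = 1 - T v \<Phi> y"
      unfolding wave_op_def by (subst Bochner_Integration.integral_diff) (auto intro: G_integrable \<Phi>)
    also have "\<dots> = 0" using fixed y by simp
    finally have "AE s in waiting_time. 1 - G \<Phi> (y + v * s) = 0"
      by (subst (asm) integral_nonneg_eq_0_iff_AE[OF int]) (auto simp: profileD[OF profile_G[OF \<Phi>]])
    then have ae: "AE s in lborel. 0 \<le> s \<longrightarrow> 1 - G \<Phi> (y + v * s) = 0" by (simp add: AE_waiting_time_iff)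
    define k where "k = \<bar>v\<bar> + 1"
    have k: "0 < k" using abs_ge_zero[of v] by (simp add: k_def)
    define e where "e = h / (2 * k)"
    have e: "0 < e" using h_pos k by (simp add: e_def)
    from ex_in_interval_of_AE[OF ae e] obtain s where s: "0 < s" "s < e" "G \<Phi> (y + v * s) = 1" by auto
    have "v * s \<le> \<bar>v\<bar> * s" using s by (intro mult_right_mono) auto
    also have "\<dots> \<le> k * e" using s by (intro mult_mono) (auto simp: k_def)
    also have "\<dots> = h / 2" using k by (simp add: e_def)
    finally have vs: "v * s \<le> h / 2" .
    have "p * \<Phi> (y + v * s + h) \<le> p * 1" "r (\<Phi> (y + v * s)) \<le> r 1"
      using p_pos profileD[OF \<Phi>] by (auto intro!: r_le)
    then have "q * 1 \<le> q * \<Phi> (y + v * s - h)" using s(3) r_1_eq unfolding hop_def by linarith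
    then have "1 \<le> \<Phi> (y + v * s - h)" using q_pos by simp
    also have "\<dots> \<le> \<Phi> (y - h / 2)" using vs by (intro profile_le[OF \<Phi>]) simp
    finally show ?thesis using profileD(3)[OF \<Phi>, of "y - h / 2"] by simp
  qed
  have "\<Phi> (x - real n * (h / 2)) = 1" for n
  proof (induction n)
    case (Suc n) from step[OF this] show ?case by (simp add: algebra_simps add_divide_distrib)
  qed (use x1 in simp)
  moreover obtain y where y: "\<And>z. z \<le> y \<Longrightarrow> \<Phi> z < 1" using tendsto_at_bot_profileE[OF lim, of 1] by auto
  moreover obtain n :: nat where "(x - y) / (h / 2) \<le> real n" using real_arch_simple by blast
  ultimately show False using y[of "x - real n * (h / 2)"] h_pos by (auto simp: field_simps)
qed

lemma fixed_greater_0: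
  assumes \<Phi>: "profile \<Phi>" and fixed: "\<And>x. T v \<Phi> x = \<Phi> x" and lim: "(\<Phi> \<longlongrightarrow> 1) at_top"
  shows "0 < \<Phi> x"
proof -
  interpret f: stable_hopping q p h "\<lambda>u. 1 - p - q - r (1 - u)" \<gamma> \<eta> by (rule stable_hopping_flip)
  have "flip \<Phi> (- x) < 1"
    by (rule f.fixed_less_1[OF profile_flip[OF \<Phi>] _ flip_tendsto_at_bot[OF lim], of "- v"])
       (simp add: wave_op_flip[OF \<Phi>] fixed, simp add: flip_def)
  then show ?thesis by (simp add: flip_def)
qed

text \<open>
  Equality would force \<open>G \<Phi> (x + w s) = G \<Phi> (x + v s)\<close> for every positive \<open>s\<close>.  If \<open>v\<close> and \<open>w\<close> have the same sign this is
  invariance under a dilation, which makes \<open>G \<Phi>\<close> constant on a half line; in the remaining case monotonicity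
  gives the same bound.  Thus \<open>G \<Phi> x\<close> would be one of the limits 0 and 1, which are not attained.
\<close>
lemma slower_operator_less:
  assumes \<Phi>: "profile \<Phi>" and fixed: "\<And>x. T w \<Phi> x = \<Phi> x"
    and lim: "(\<Phi> \<longlongrightarrow> 0) at_bot" "(\<Phi> \<longlongrightarrow> 1) at_top" and w: "v < w" "w \<noteq> 0"
  shows "T v \<Phi> x < \<Phi> x"
proof (rule ccontr)
  assume "\<not> T v \<Phi> x < \<Phi> x"
  then have eq: "T v \<Phi> x = T w \<Phi> x"
    using T_mono_speed[OF \<Phi>, of v w x] w fixed[of x] by simp
  have c\<Phi>: "isCont \<Phi> y" for y
    
  proof -
    have "T w \<Phi> = \<Phi>" by (rule ext, rule fixed)
    then show ?thesis using T_continuous_nonzero[OF \<Phi> w(2), of y] by simp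
  qed
  define g where "g = G \<Phi>"
  have g: "isCont g y" "profile g" for y
    unfolding g_def by (rule isCont_G[OF \<Phi> c\<Phi>], rule profile_G[OF \<Phi>])
  have cg: "isCont (\<lambda>s. g (x + u * s)) s" for u s
    by (intro continuous_intros isCont_o2[OF _ g(1)])
  have g_lim: "g x < 1" "0 < g x"
  proof -
    have "p * \<Phi> (x + h) < p * 1" using p_pos fixed_less_1[OF \<Phi> fixed lim(1)] by simp
    moreover have "q * \<Phi> (x - h) < q * 1" using q_pos fixed_less_1[OF \<Phi> fixed lim(1)] by simp
    moreover have "r (\<Phi> x) \<le> r 1" using profileD[OF \<Phi>] by (intro r_le) auto
    ultimately show "g x < 1" using r_1_eq unfolding g_def hop_def by linarith
    have "0 < p * \<Phi> (x + h)" using p_pos fixed_greater_0[OF \<Phi> fixed lim(2)] by simp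
    moreover have "0 < q * \<Phi> (x - h)" using q_pos fixed_greater_0[OF \<Phi> fixed lim(2)] by simp
    moreover have "0 \<le> r (\<Phi> x)" using profileD[OF \<Phi>] by (intro r_nonneg) auto
    ultimately show "0 < g x" unfolding g_def hop_def by linarith
  qed
  have g_ends: "(\<lambda>n. g (- real n)) \<longlonglongrightarrow> 0" "(\<lambda>n. g (real n)) \<longlonglongrightarrow> 1"
    using end_seq(2)[OF \<Phi> _ _ lim(1) filterlim_minus_nat_at_bot, where v = 0]
      end_seq(2)[OF \<Phi> _ _ lim(2) filterlim_nat_at_top, where v = 0]
    by (simp_all add: wave_op_zero g_def r_0 r_1_eq)
  have same: "g (x + w * s) = g (x + v * s)" if "0 < s" for s
  proof (rule ccontr)
    assume ne: "g (x + w * s) \<noteq> g (x + v * s)"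
    interpret prob_space waiting_time by (rule prob_space_waiting_time)
    have int: "integrable waiting_time (\<lambda>s. g (x + w * s) - g (x + v * s))"
      unfolding g_def by (intro Bochner_Integration.integrable_diff G_integrable \<Phi>)
    have "integral\<^sup>L waiting_time (\<lambda>s. g (x + w * s) - g (x + v * s)) = 0"
      using eq unfolding wave_op_def g_def
      by (subst Bochner_Integration.integral_diff) (auto intro: G_integrable \<Phi>)
    moreover have "AE s in waiting_time. 0 \<le> g (x + w * s) - g (x + v * s)"
      using AE_waiting_time_nonneg
    proof eventually_elim
      case (elim s)
      then have "v * s \<le> w * s" using w by (intro mult_right_mono) auto
      then show ?case using profile_le[OF g(2), of "x + v * s" "x + w * s"] by simp
    qed
    ultimately have "AE s in waiting_time. g (x + w * s) - g (x + v * s) = 0"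
      by (simp add: integral_nonneg_eq_0_iff_AE[OF int])
    then have ae: "AE s in lborel. 0 \<le> s \<longrightarrow> g (x + w * s) - g (x + v * s) = 0"
      by (simp add: AE_waiting_time_iff)
    have "isCont (\<lambda>s. g (x + w * s) - g (x + v * s)) s" by (intro continuous_intros cg)
    then have "\<forall>\<^sub>F z in at s. g (x + w * z) - g (x + v * z) \<noteq> 0"
      using ne by (intro tendsto_imp_eventually_ne[OF isContD]) auto
    then obtain d where d: "0 < d" "\<And>z. z \<noteq> s \<Longrightarrow> dist z s < d \<Longrightarrow> g (x + w * z) - g (x + v * z) \<noteq> 0"
      unfolding eventually_at by blast
    obtain z where "s < z" "z < s + d" "0 \<le> z \<longrightarrow> g (x + w * z) - g (x + v * z) = 0"
      using ex_in_interval_of_AE[OF ae, of s "s + d"] d(1) by auto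
    then show False using d(2)[of z] that by (auto simp: dist_real_def)
  qed
  show False
  proof (cases "0 < w")
    case True
    have le: "g (x + y) \<le> g x" if "0 < y" for y
    proof (cases "v \<le> 0")
      case True
      have "g (x + y) = g (x + v * (y / w))" using same[of "y / w"] \<open>0 < w\<close> that by simp
      also have "\<dots> \<le> g x" using True \<open>0 < w\<close> that
        by (intro profile_le[OF g(2)]) (auto intro: mult_nonpos_nonneg simp: divide_le_0_iff)
      finally show ?thesis .
    next
      case False
      have "g (x + y) = g (x + 0)"
      proof (rule eq_at_0_of_dilation[where \<rho> = "v / w" and f = "\<lambda>y. g (x + y)"])
        show "g (x + y) = g (x + v / w * y)" if "0 < y" for y
          using same[of "y / w"] that True by simp
        show "isCont (\<lambda>y. g (x + y)) 0" by (intro isCont_o2[OF _ g(1)] continuous_intros)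
      qed (use False True w that in auto)
      then show ?thesis by simp
    qed
    have dom: "g z \<le> g x" if "x < z" for z using le[of "z - x"] that by simp
    have "\<forall>\<^sub>F n in sequentially. x < real n"
      using filterlim_real_sequentially unfolding filterlim_at_top_dense by blast
    then have "\<forall>\<^sub>F n in sequentially. g (real n) \<le> g x" by eventually_elim (rule dom)
    then have "1 \<le> g x" by (rule tendsto_upperbound[OF g_ends(2)]) simp
    with g_lim show False by simp
  next
    case False
    then have neg: "w < 0" "v < 0" using w by auto
    have const: "g (x - y) = g (x - 0)" if "0 < y" for y
    proof (rule eq_at_0_of_dilation[where \<rho> = "w / v" and f = "\<lambda>y. g (x - y)"])
      show "g (x - y) = g (x - w / v * y)" if "0 < y" for y
        using same[of "- y / v"] that neg by (simp add: divide_neg_neg divide_pos_neg)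
      show "isCont (\<lambda>y. g (x - y)) 0" by (intro isCont_o2[OF _ g(1)] continuous_intros)
    qed (use neg w that in \<open>simp_all add: divide_neg_neg neg_divide_less_eq\<close>)
    have dom: "g y = g x" if "y < x" for y using const[of "x - y"] that by simp
    have "\<forall>\<^sub>F n in sequentially. - x < real n"
      using filterlim_real_sequentially unfolding filterlim_at_top_dense by blast
    then have "\<forall>\<^sub>F n in sequentially. g x \<le> g (- real n)"
    proof eventually_elim
      case (elim n) then show ?case using dom[of "- real n"] by simp
    qed
    then have "g x \<le> 0" by (rule tendsto_lowerbound[OF g_ends(1)]) simp
    with g_lim show False by simp
  qed
qed

lemma no_slower_front:
  assumes \<Phi>: "profile \<Phi>" "\<And>x. T v \<Phi> x = \<Phi> x" "(\<Phi> \<longlongrightarrow> 0) at_bot" "(\<Phi> \<longlongrightarrow> 1) at_top"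
    and \<Psi>: "profile \<Psi>" "\<And>x. T w \<Psi> x = \<Psi> x" "(\<Psi> \<longlongrightarrow> 0) at_bot" "(\<Psi> \<longlongrightarrow> 1) at_top"
  shows "\<not> (v < w \<and> w \<noteq> 0)"
proof
  assume w: "v < w \<and> w \<noteq> 0"
  have "T w \<Psi> = \<Psi>" by (rule ext, rule \<Psi>(2))
  then have c: "isCont \<Psi> y" for y using T_continuous_nonzero[OF \<Psi>(1), of w y] w by simp
  have "\<Phi> 0 = 0"
    by (rule no_sub_at_strict_super[where v = v, OF \<Phi>(1) \<Psi>(1) _ slower_operator_less[OF \<Psi>] c \<Phi>(3) \<Psi>(3,4)])
       (use w in \<open>simp_all add: \<Phi>(2)\<close>)
  with fixed_greater_0[OF \<Phi>(1,2,4), of 0] show False by simp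
qed

end

text \<open>
  The faster front has to move in order to be continuous.  If it is the standing one, then the
  slower front moves, and the reflected problem exchanges the roles.
\<close>
theorem (in stable_hopping) front_speed_unique:
  assumes \<Phi>: "profile \<Phi>" "\<And>x. T v \<Phi> x = \<Phi> x" "(\<Phi> \<longlongrightarrow> 0) at_bot" "(\<Phi> \<longlongrightarrow> 1) at_top"
    and \<Psi>: "profile \<Psi>" "\<And>x. T w \<Psi> x = \<Psi> x" "(\<Psi> \<longlongrightarrow> 0) at_bot" "(\<Psi> \<longlongrightarrow> 1) at_top"
  shows "v = w"
proof -
  interpret f: stable_hopping q p h "\<lambda>u. 1 - p - q - r (1 - u)" \<gamma> \<eta> by (rule stable_hopping_flip)
  have le: "\<not> v < w"
    if \<Phi>: "profile \<Phi>" "\<And>x. T v \<Phi> x = \<Phi> x" "(\<Phi> \<longlongrightarrow> 0) at_bot" "(\<Phi> \<longlongrightarrow> 1) at_top"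
    and \<Psi>: "profile \<Psi>" "\<And>x. T w \<Psi> x = \<Psi> x" "(\<Psi> \<longlongrightarrow> 0) at_bot" "(\<Psi> \<longlongrightarrow> 1) at_top" for \<Phi> \<Psi> v w
  proof
    assume "v < w"
    then have "v < 0" "w = 0" using no_slower_front[OF \<Phi> \<Psi>] by auto
    have \<Phi>': "f.T (- v) (flip \<Phi>) x = flip \<Phi> x" for x
      unfolding wave_op_flip[OF \<Phi>(1)] by (simp add: flip_def \<Phi>(2))
    have \<Psi>': "f.T (- w) (flip \<Psi>) x = flip \<Psi> x" for x
      unfolding wave_op_flip[OF \<Psi>(1)] by (simp add: flip_def \<Psi>(2))
    have "\<not> (- w < - v \<and> - v \<noteq> 0)"
      by (rule f.no_slower_front[OF profile_flip[OF \<Psi>(1)] \<Psi>' _ _ profile_flip[OF \<Phi>(1)] \<Phi>'])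
         (intro flip_tendsto_at_bot flip_tendsto_at_top \<Phi> \<Psi>)+
    with \<open>v < w\<close> \<open>v < 0\<close> show False by simp
  qed
  show ?thesis using le[OF \<Phi> \<Psi>] le[OF \<Psi> \<Phi>] by simp
qed

context bistable
begin

lemma hopping_capped: "hopping p q h (\<lambda>u. min (r u) ((1 - p - q) * u))"
proof
  show "mono_on {0..1} (\<lambda>u. min (r u) ((1 - p - q) * u))"
    using pq by (intro mono_onI min.mono r_le mult_left_mono) auto
  show "continuous_on {0..1} (\<lambda>u. min (r u) ((1 - p - q) * u))"
    by (intro continuous_intros r_cont)
qed (use p_pos q_pos h_pos pq r_0 in auto)

text \<open>
  A subsolution that stays below \<open>a\<close> does not notice positive values of the reaction term, so these may be capped at
  0.  For the capped reaction term there are strict supersolutions that rise beyond \<open>a\<close>, and contact with them can take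
  place only where they are still below \<open>a\<close>.
\<close>
lemma no_sub_below_a:
  assumes \<psi>: "profile \<psi>" "\<And>x. isCont \<psi> x" "(\<psi> \<longlongrightarrow> 0) at_bot" "(\<psi> \<longlongrightarrow> b) at_top" "a < b"
    and super: "\<And>x. wave_op p q h (\<lambda>u. min (r u) ((1 - p - q) * u)) v \<psi> x < \<psi> x"
    and \<Phi>: "profile \<Phi>" "\<And>x. \<Phi> x \<le> T v \<Phi> x" "(\<Phi> \<longlongrightarrow> 0) at_bot" "\<And>x. \<Phi> x \<le> a"
  shows "\<Phi> x = 0"
proof (rule ccontr)
  assume "\<Phi> x \<noteq> 0"
  then have pos: "0 < \<Phi> x" using profileD(2)[OF \<Phi>(1), of x] by simp
  have r_le_id: "r u \<le> (1 - p - q) * u" if "0 \<le> u" "u \<le> a" for u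
    using r_low[of u] r_0 r_a that by (cases "u = 0"; cases "u = a") (auto intro: less_imp_le)
  interpret m: hopping p q h "\<lambda>u. min (r u) ((1 - p - q) * u)" by (rule hopping_capped)
  have "hop p q h (\<lambda>u. min (r u) ((1 - p - q) * u)) \<Phi> = G \<Phi>"
    unfolding hop_def using r_le_id[OF profileD(2)[OF \<Phi>(1)] \<Phi>(4)] by (simp add: min_def)
  then have T: "m.T v \<Phi> = T v \<Phi>" by (simp add: wave_op_def fun_eq_iff)
  obtain X where X: "\<And>x. X \<le> x \<Longrightarrow> a < \<psi> x"
    using order_tendstoD(1)[OF \<psi>(4,5)] unfolding eventually_at_top_linorder by blast
  show False
  proof (rule m.sliding[where R = a and X = X and \<eta> = "min \<eta> a", OF \<Phi>(1) \<psi>(1) _ super \<psi>(2) \<gamma>_pos \<gamma>_le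
        _ _ _ \<Phi>(4) \<Phi>(3) \<psi>(3) pos])
    show "\<Phi> x \<le> m.T v \<Phi> x" for x unfolding T by (rule \<Phi>(2))
    show "0 < min \<eta> a" using \<eta>_pos a_pos by simp
    show "min (r u) ((1 - p - q) * u) - min (r w) ((1 - p - q) * w) \<le> (1 - p - q - \<gamma>) * (u - w)"
      if "0 \<le> w" "w \<le> u" "u \<le> min \<eta> a" for u w
    proof -
      have "u \<le> \<eta>" "u \<le> a" "w \<le> a" using that by auto
      then show ?thesis
        using near_0[of w u] r_le_id[of u] r_le_id[of w] that by (simp add: min_absorb1)
    qed
    show "min (r u) ((1 - p - q) * u) - min (r (\<psi> x)) ((1 - p - q) * \<psi> x) \<le> (1 - p - q - \<gamma>) * (u - \<psi> x)"
      if "X \<le> x" "\<psi> x \<le> u" "u \<le> a" for x u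
      using X[of x] that by simp
  qed
qed

end

section \<open>The lattice equation with cubic nonlinearity\<close>

lemma cubic_diff:
  "cubic u a - cubic w a = (u - w) * ((1 + a) * (u + w) - a - (u\<^sup>2 + u * w + w\<^sup>2))"
  by (simp add: cubic_def algebra_simps power2_eq_square)

lemma cubic_diff_near_0:
  assumes "0 < a" "a < 1" "m \<le> a" and w: "0 \<le> w" "w \<le> u" "u \<le> m / 8"
  shows "cubic u a - cubic w a \<le> - (m / 2) * (u - w)"
proof -
  have "(1 + a) * (u + w) \<le> 2 * (m / 4)" using assms by (intro mult_mono) auto
  moreover have "0 \<le> u\<^sup>2 + u * w + w\<^sup>2" using w by simp
  ultimately have "(1 + a) * (u + w) - a - (u\<^sup>2 + u * w + w\<^sup>2) \<le> - (m / 2)" using assms(3) by linarith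
  then have "(u - w) * ((1 + a) * (u + w) - a - (u\<^sup>2 + u * w + w\<^sup>2)) \<le> (u - w) * (- (m / 2))"
    using w by (intro mult_left_mono) auto
  then show ?thesis unfolding cubic_diff by (simp add: mult.commute)
qed

lemma cubic_flip: "cubic (1 - u) a = - cubic u (1 - a)"
  by (simp add: cubic_def algebra_simps)

text \<open>
  The slope of the cubic on the unit interval is bounded below by its values \<open>- a\<close> and \<open>a - 1\<close> at the
  end points, so that adding \<open>2 u\<close> makes it increasing.
\<close>
lemma cubic_plus_mono:
  assumes "0 < a" "a < 1" and w: "0 \<le> w" "w \<le> u" "u \<le> 1"
  shows "2 * w + cubic w a \<le> 2 * u + cubic u a"
proof -
  have "u\<^sup>2 \<le> u" "w\<^sup>2 \<le> w" using w by (simp_all add: power2_eq_square mult_left_le)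
  moreover have "u * w \<le> 1" using w by (intro mult_le_one) auto
  moreover have "0 \<le> a * (u + w)" using assms by simp
  moreover have "(1 + a) * (u + w) = (u + w) + a * (u + w)" by (simp only: distrib_right mult_1)
  ultimately have "0 \<le> 2 + ((1 + a) * (u + w) - a - (u\<^sup>2 + u * w + w\<^sup>2))"
    using assms(2) by linarith
  then have "0 \<le> (u - w) * (2 + ((1 + a) * (u + w) - a - (u\<^sup>2 + u * w + w\<^sup>2)))" using w by simp
  then show ?thesis using cubic_diff[of u a w] by (simp add: algebra_simps)
qed

locale cubic_lattice =
  fixes a d k :: real
  assumes a: "0 < a" "a < 1" and d: "0 < d" and k: "0 < k"
begin

definition M :: real where "M = d * (k + 1) + 2"

lemma M_pos: "0 < M" using d k by (simp add: M_def add_pos_pos)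

abbreviation "H \<equiv> mesh d k"

lemma H_pos: "0 < H" using d k by (simp add: mesh_def)

lemma H_sq: "H\<^sup>2 = 2 / (d * (k + 1))"
  using d k by (simp add: mesh_def power_divide power_mult_distrib)

text \<open>
  The value of the travelling wave operator; \<open>\<psi>'\<close> stands for the derivative, so that the definition makes
  sense for a standing profile that is not differentiable.
\<close>
definition residual :: "real \<Rightarrow> (real \<Rightarrow> real) \<Rightarrow> (real \<Rightarrow> real) \<Rightarrow> real \<Rightarrow> real"
  where "residual c \<psi> \<psi>' x =
    c * \<psi>' x + d * k * (\<psi> (x + H) - \<psi> x) + d * (\<psi> (x - H) - \<psi> x) + cubic (\<psi> x) a"

lemma leftover_eq: "1 - d * k / M - d / M = 2 / M"
proof -
  have "M - d * k - d = 2" by (simp add: M_def algebra_simps)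
  moreover have "1 - d * k / M - d / M = (M - d * k - d) / M" using M_pos by (simp add: diff_divide_distrib)
  ultimately show ?thesis by simp
qed

sublocale bistable "d * k / M" "d / M" H "\<lambda>u. (2 * u + cubic u a) / M"
  "min a (1 - a) / (2 * M)" "min a (1 - a) / 8" a
proof
  note pq = leftover_eq
  show "0 < d * k / M" "0 < d / M" "0 < H" using d k M_pos H_pos by simp_all
  show "d * k / M + d / M < 1" using pq M_pos by (smt (verit) divide_pos_pos)
  show "mono_on {0..1} (\<lambda>u. (2 * u + cubic u a) / M)"
    using M_pos a by (auto intro!: mono_onI divide_right_mono cubic_plus_mono)
  show "continuous_on {0..1} (\<lambda>u. (2 * u + cubic u a) / M)"
    unfolding cubic_def using M_pos by (intro continuous_intros) auto
  show "(2 * 0 + cubic 0 a) / M = 0" by (simp add: cubic_def)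
  show "(2 * 1 + cubic 1 a) / M \<le> 1 - d * k / M - d / M" "(2 * 1 + cubic 1 a) / M = 1 - d * k / M - d / M"
    unfolding pq by (simp_all add: cubic_def)
  show "0 < min a (1 - a) / (2 * M)" "0 < min a (1 - a) / 8" using a M_pos by simp_all
  show "min a (1 - a) / (2 * M) \<le> 1 - d * k / M - d / M"
    unfolding pq using a M_pos by (simp add: field_simps)
  have scale: "(2 * u + cubic u a) / M - (2 * w + cubic w a) / M \<le> (1 - d * k / M - d / M - min a (1 - a) / (2 * M)) * (u - w)"
    if "cubic u a - cubic w a \<le> - (min a (1 - a) / 2) * (u - w)" for u w
  proof -
    have "(2 * u + cubic u a) / M - (2 * w + cubic w a) / M = (2 * (u - w) + (cubic u a - cubic w a)) / M"
      by (simp add: diff_divide_distrib[symmetric])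
    also have "\<dots> \<le> (2 * (u - w) + - (min a (1 - a) / 2) * (u - w)) / M"
      using that M_pos by (intro divide_right_mono add_left_mono) auto
    also have "\<dots> = (1 - d * k / M - d / M - min a (1 - a) / (2 * M)) * (u - w)"
      unfolding pq using M_pos by (simp add: field_simps)
    finally show ?thesis .
  qed
  show "(2 * u + cubic u a) / M - (2 * w + cubic w a) / M \<le> (1 - d * k / M - d / M - min a (1 - a) / (2 * M)) * (u - w)"
    if "0 \<le> w" "w \<le> u" "u \<le> min a (1 - a) / 8" for u w
    by (rule scale, rule cubic_diff_near_0[OF a _ that]) simp
  show "(2 * u + cubic u a) / M - (2 * w + cubic w a) / M \<le> (1 - d * k / M - d / M - min a (1 - a) / (2 * M)) * (u - w)"
    if "1 - min a (1 - a) / 8 \<le> w" "w \<le> u" "u \<le> 1" for u w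
  proof (rule scale)
    have "1 - w \<le> min a (1 - a) / 8" using that by linarith
    then have "cubic (1 - w) (1 - a) - cubic (1 - u) (1 - a) \<le> - (min a (1 - a) / 2) * ((1 - w) - (1 - u))"
      by (rule cubic_diff_near_0[rotated -1]) (use a that in auto)
    then show "cubic u a - cubic w a \<le> - (min a (1 - a) / 2) * (u - w)"
      using cubic_flip[of "1 - u" a] cubic_flip[of "1 - w" a] by simp
  qed
  show "0 < a" "a < 1" by (rule a)+
  show "(2 * u + cubic u a) / M < (1 - d * k / M - d / M) * u" if "0 < u" "u < a" for u
  proof -
    have "cubic u a < 0" unfolding cubic_def using that a by (intro mult_pos_neg) auto
    then show ?thesis unfolding pq using M_pos by (simp add: divide_strict_right_mono)
  qed
  show "(2 * a + cubic a a) / M = (1 - d * k / M - d / M) * a"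
    unfolding pq by (simp add: cubic_def)
  show "(1 - d * k / M - d / M) * u < (2 * u + cubic u a) / M" if "a < u" "u < 1" for u
  proof -
    have "0 < cubic u a" unfolding cubic_def using that a by simp
    then show ?thesis unfolding pq using M_pos by (simp add: divide_strict_right_mono)
  qed
qed

lemma residual_eq:
  "c / M * \<psi>' x - \<psi> x + G \<psi> x = residual c \<psi> \<psi>' x / M"
proof -
  have "M * (c / M * \<psi>' x - \<psi> x + G \<psi> x) = c * \<psi>' x - M * \<psi> x
      + (d * k * \<psi> (x + H) + d * \<psi> (x - H) + 2 * \<psi> x + cubic (\<psi> x) a)"
    using M_pos by (simp add: hop_def field_simps)
  also have "\<dots> = residual c \<psi> \<psi>' x"
    by (simp add: residual_def M_def algebra_simps)
  finally show ?thesis using M_pos by (metis less_irrefl nonzero_mult_div_cancel_left)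
qed

text \<open>
  The mesh width satisfies \<open>H^2 = 2 / (d (k + 1))\<close>, which turns central differences back into the coupling constants
  \<open>d k\<close> and \<open>d\<close> of the lattice.
\<close>
lemma front_equation_iff:
  "(- c * \<psi>' x = (\<Phi> (x + H) - 2 * \<Phi> x + \<Phi> (x - H)) / H\<^sup>2
      + 2 * (k - 1) / (H * (k + 1)) * ((\<Phi> (x + H) - \<Phi> (x - H)) / (2 * H)) + cubic (\<Phi> x) a)
   \<longleftrightarrow> residual c \<Phi> \<psi>' x = 0"
proof -
  have aux: "2 * m / (H * K) * (X / (2 * H)) = m / K * X / H\<^sup>2" if "K \<noteq> 0" for m K X :: real
    using that H_pos by (simp add: field_simps power2_eq_square)
  have "2 * (k - 1) / (H * (k + 1)) * ((\<Phi> (x + H) - \<Phi> (x - H)) / (2 * H))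
      = (k - 1) / (k + 1) * (\<Phi> (x + H) - \<Phi> (x - H)) / H\<^sup>2"
    using k by (intro aux) simp
  also have "\<dots> = d * (k - 1) / 2 * (\<Phi> (x + H) - \<Phi> (x - H))"
    unfolding H_sq using d k by (simp add: field_simps)
  finally have 1: "2 * (k - 1) / (H * (k + 1)) * ((\<Phi> (x + H) - \<Phi> (x - H)) / (2 * H))
      = d * (k - 1) / 2 * (\<Phi> (x + H) - \<Phi> (x - H))" .
  have 2: "(\<Phi> (x + H) - 2 * \<Phi> x + \<Phi> (x - H)) / H\<^sup>2
      = d * (k + 1) / 2 * (\<Phi> (x + H) - 2 * \<Phi> x + \<Phi> (x - H))"
    unfolding H_sq by simp
  have "d * (k + 1) / 2 * (\<Phi> (x + H) - 2 * \<Phi> x + \<Phi> (x - H)) + d * (k - 1) / 2 * (\<Phi> (x + H) - \<Phi> (x - H))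
     = d * k * (\<Phi> (x + H) - \<Phi> x) + d * (\<Phi> (x - H) - \<Phi> x)"
    by (simp add: field_simps)
  then show ?thesis unfolding residual_def 1 2 by (intro iffI) linarith+
qed

text \<open>
  The derivative of a moving front is \<open>(\<Phi> - G \<Phi>) / v\<close>, hence continuous and bounded, as required for
  the passage to the mild form; conversely a mild solution with \<open>v\<close> nonzero is the resolvent of
  a continuous function and therefore differentiable.
\<close>
lemma front_iff:
  "front a d k c \<Phi> \<longleftrightarrow> profile \<Phi> \<and> (\<forall>x. T (c / M) \<Phi> x = \<Phi> x) \<and> (\<Phi> \<longlongrightarrow> 0) at_bot \<and> (\<Phi> \<longlongrightarrow> 1) at_top"
  (is "?L \<longleftrightarrow> ?R")
proof
  assume ?L
  then have \<Phi>: "mono \<Phi>" "(\<Phi> \<longlongrightarrow> 0) at_bot" "(\<Phi> \<longlongrightarrow> 1) at_top"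
    and D: "c \<noteq> 0 \<Longrightarrow> \<Phi> field_differentiable (at x)"
    and eq: "residual c \<Phi> (deriv \<Phi>) x = 0" for x
    unfolding front_def Let_def front_equation_iff by auto
  have p: "profile \<Phi>" by (rule profile_of_limits[OF \<Phi>])
  have eq': "c / M * deriv \<Phi> x - \<Phi> x + G \<Phi> x = 0" for x unfolding residual_eq eq by simp
  have "T (c / M) \<Phi> x = \<Phi> x" for x
  proof (cases "c = 0")
    case True
    then show ?thesis using eq'[of x] by (simp add: wave_op_zero)
  next
    case False
    have der: "(\<Phi> has_real_derivative deriv \<Phi> x) (at x)" for x
      using D[OF False] by (rule field_differentiable_derivI)
    have c: "isCont \<Phi> x" for x using der by (rule DERIV_isCont)
    have deriv_eq: "deriv \<Phi> x = (\<Phi> x - G \<Phi> x) * (M / c)" for x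
      using eq'[of x] False M_pos by (simp add: field_simps)
    have cont: "isCont (deriv \<Phi>) x" for x
      unfolding deriv_eq[abs_def] by (intro continuous_intros c isCont_G p)
    have bound: "\<bar>deriv \<Phi> x\<bar> \<le> 1 * \<bar>M / c\<bar>" for x
      unfolding deriv_eq abs_mult
      using profileD(2,3)[OF p, of x] profileD(2,3)[OF profile_G[OF p], of x]
      by (intro mult_right_mono) (auto simp: abs_le_iff)
    show ?thesis using T_minus_profile(1)[OF p der cont bound, of "c / M" x] unfolding eq' by simp
  qed
  with p \<Phi> show ?R by blast
next
  assume R: ?R
  then have p: "profile \<Phi>" and fixed: "\<And>x. T (c / M) \<Phi> x = \<Phi> x" by auto
  have *: "(c \<noteq> 0 \<longrightarrow> \<Phi> field_differentiable (at x)) \<and> residual c \<Phi> (deriv \<Phi>) x = 0" for x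
  proof (cases "c = 0")
    case True
    then have "G \<Phi> x = \<Phi> x" using fixed[of x] by (simp add: wave_op_zero)
    then have "residual c \<Phi> (deriv \<Phi>) x / M = 0" unfolding residual_eq[symmetric] using True by simp
    then show ?thesis using True M_pos by simp
  next
    case False
    have "T (c / M) \<Phi> = \<Phi>" by (rule ext, rule fixed)
    then have c: "isCont \<Phi> y" for y using T_continuous_nonzero[OF p, of "c / M" y] False M_pos by simp
    have "(\<Phi> has_real_derivative (\<Phi> x - G \<Phi> x) / (c / M)) (at x)"
    proof (rule resolvent_differentiable[where B = 1])
      show "isCont (G \<Phi>) x" for x by (rule isCont_G[OF p c])
      show "\<bar>G \<Phi> x\<bar> \<le> 1" for x by (rule profileD(4)[OF profile_G[OF p]])
      show "\<Phi> x = integral\<^sup>L waiting_time (\<lambda>s. G \<Phi> (x + c / M * s))" for x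
        unfolding wave_op_def[symmetric] by (simp add: fixed)
    qed (use False M_pos in simp)
    then have "deriv \<Phi> x = (\<Phi> x - G \<Phi> x) / (c / M)" "\<Phi> field_differentiable (at x)"
      by (auto intro: DERIV_imp_deriv simp: field_differentiable_def)
    then have "residual c \<Phi> (deriv \<Phi>) x / M = 0"
      unfolding residual_eq[symmetric] using False M_pos by simp
    then show ?thesis using M_pos \<open>\<Phi> field_differentiable (at x)\<close> by simp
  qed
  with R profileD(1)[OF p] show ?L unfolding front_def Let_def front_equation_iff by auto
qed

lemma wavespeed_eq:
  assumes "front a d k c \<Phi>" shows "wavespeed a d k = c"
  unfolding wavespeed_def
proof (rule the_equality)
  show "\<exists>\<Phi>. front a d k c \<Phi>" using assms by blast
next
  fix c' assume "\<exists>\<Phi>. front a d k c' \<Phi>"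
  then obtain \<Psi> where "front a d k c' \<Psi>" by blast
  then have "c' / M = c / M" using assms unfolding front_iff
    by (intro front_speed_unique[of \<Psi> "c' / M" \<Phi> "c / M"]) auto
  then show "c' = c" using M_pos by simp
qed

lemma
  assumes \<Phi>: "front a d k c \<Phi>"
    and \<psi>: "profile \<psi>" "(\<psi> \<longlongrightarrow> 0) at_bot" "(\<psi> \<longlongrightarrow> 1) at_top"
    and D: "\<And>x. (\<psi> has_real_derivative \<psi>' x) (at x)" "\<And>x. isCont \<psi>' x" "\<And>x. \<bar>\<psi>' x\<bar> \<le> B"
  shows speed_greater: "(\<And>x. residual c' \<psi> \<psi>' x < 0) \<Longrightarrow> c' < c"
    and speed_less: "(\<And>x. 0 < residual c' \<psi> \<psi>' x) \<Longrightarrow> c < c'"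
proof -
  have c: "isCont \<psi> x" for x using D(1) by (rule DERIV_isCont)
  have p: "profile \<Phi>" "\<And>x. T (c / M) \<Phi> x = \<Phi> x" "(\<Phi> \<longlongrightarrow> 0) at_bot" "(\<Phi> \<longlongrightarrow> 1) at_top"
    using \<Phi> unfolding front_iff by auto
  show "c' < c" if res: "\<And>x. residual c' \<psi> \<psi>' x < 0"
  proof (rule ccontr)
    assume "\<not> c' < c"
    then have "c / M \<le> c' / M" using M_pos by (intro divide_right_mono) auto
    then have sub: "\<Phi> x \<le> T (c' / M) \<Phi> x" for x using T_mono_speed[OF p(1), of "c / M" "c' / M" x] p(2) by simp
    have "c' / M * \<psi>' x - \<psi> x + G \<psi> x < 0" for x
      unfolding residual_eq using res M_pos by (simp add: divide_neg_pos)
    then have "T (c' / M) \<psi> x < \<psi> x" for x by (rule T_less_if_residual_neg[OF \<psi>(1) D])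
    from no_sub_at_strict_super[OF p(1) \<psi>(1) sub this c p(3) \<psi>(2,3)] fixed_greater_0[OF p(1,2,4)]
    show False by (metis less_irrefl)
  qed
  show "c < c'" if res: "\<And>x. 0 < residual c' \<psi> \<psi>' x"
  proof (rule ccontr)
    assume "\<not> c < c'"
    then have "c' / M \<le> c / M" using M_pos by (intro divide_right_mono) auto
    then have super: "T (c' / M) \<Phi> x \<le> \<Phi> x" for x using T_mono_speed[OF p(1), of "c' / M" "c / M" x] p(2) by simp
    have "0 < c' / M * \<psi>' x - \<psi> x + G \<psi> x" for x
      unfolding residual_eq using res M_pos by simp
    then have "\<psi> x < T (c' / M) \<psi> x" for x by (rule T_greater_if_residual_pos[OF \<psi>(1) D])
    from no_super_at_strict_sub[OF p(1) \<psi>(1) super this c p(4) \<psi>(2,3)] fixed_less_1[OF p(1,2,3)]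
    show False by (metis less_irrefl)
  qed
qed

text \<open>
  The sign conditions on \<open>\<psi>\<close> bound the possible speeds from both sides; \<open>\<theta>\<close> excludes profiles that come
  to rest at \<open>a\<close>.
\<close>
lemma front_exists_between:
  assumes \<psi>: "profile \<psi>" "(\<psi> \<longlongrightarrow> 0) at_bot" "(\<psi> \<longlongrightarrow> 1) at_top"
    and D: "\<And>x. (\<psi> has_real_derivative \<psi>' x) (at x)" "\<And>x. isCont \<psi>' x" "\<And>x. \<bar>\<psi>' x\<bar> \<le> B"
    and neg: "\<And>x. residual c\<^sub>0 \<psi> \<psi>' x < 0" and pos: "\<And>x. 0 < residual c\<^sub>1 \<psi> \<psi>' x"
    and \<theta>: "profile \<theta>" "(\<theta> \<longlongrightarrow> 0) at_bot" "(\<theta> \<longlongrightarrow> b) at_top" "a < b"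
    and D\<theta>: "\<And>x. (\<theta> has_real_derivative \<theta>' x) (at x)" "\<And>x. isCont \<theta>' x" "\<And>x. \<bar>\<theta>' x\<bar> \<le> B"
    and neg\<theta>: "\<And>x. residual c\<^sub>1 \<theta> \<theta>' x - max 0 (cubic (\<theta> x) a) < 0"
  obtains c \<Phi> where "front a d k c \<Phi>"
proof -
  have c: "isCont \<psi> x" for x using D(1) by (rule DERIV_isCont)
  have c\<theta>: "isCont \<theta> x" for x using D\<theta>(1) by (rule DERIV_isCont)
  have below: "c\<^sub>0 / M \<le> v" if "subfront v \<Phi>" for v \<Phi>
  proof (rule ccontr)
    assume "\<not> c\<^sub>0 / M \<le> v"
    then have "v \<le> c\<^sub>0 / M" by simp
    from that obtain x0 where \<Phi>: "profile \<Phi>" "\<And>x. \<Phi> x \<le> T v \<Phi> x" "(\<Phi> \<longlongrightarrow> 0) at_bot" "0 < \<Phi> x0"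
      unfolding subfront_def by auto
    have sub: "\<Phi> x \<le> T (c\<^sub>0 / M) \<Phi> x" for x
      using order_trans[OF \<Phi>(2) T_mono_speed[OF \<Phi>(1) \<open>v \<le> c\<^sub>0 / M\<close>]] .
    have "c\<^sub>0 / M * \<psi>' x - \<psi> x + G \<psi> x < 0" for x
      unfolding residual_eq using neg M_pos by (simp add: divide_neg_pos)
    then have "T (c\<^sub>0 / M) \<psi> x < \<psi> x" for x by (rule T_less_if_residual_neg[OF \<psi>(1) D])
    from no_sub_at_strict_super[OF \<Phi>(1) \<psi>(1) sub this c \<Phi>(3) \<psi>(2,3)] \<Phi>(4)
    show False by (metis less_irrefl)
  qed
  have "0 < c\<^sub>1 / M * \<psi>' x - \<psi> x + G \<psi> x" for x
    unfolding residual_eq using pos M_pos by simp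
  then have "\<psi> x < T (c\<^sub>1 / M) \<psi> x" for x by (rule T_greater_if_residual_pos[OF \<psi>(1) D])
  moreover have "\<exists>x. 0 < \<psi> x"
    using order_tendstoD(1)[OF \<psi>(3), of 0] eventually_happens' trivial_limit_at_top_linorder by force
  ultimately have climb: "subfront (c\<^sub>1 / M) \<psi>"
    unfolding subfront_def using \<psi> isCont_imp_rcont[OF c] by (auto intro: less_imp_le)
  have super\<theta>: "wave_op (d * k / M) (d / M) H
      (\<lambda>u. min ((2 * u + cubic u a) / M) ((1 - d * k / M - d / M) * u)) (c\<^sub>1 / M) \<theta> x < \<theta> x" for x
  proof -
    interpret m: hopping "d * k / M" "d / M" H
      "\<lambda>u. min ((2 * u + cubic u a) / M) ((1 - d * k / M - d / M) * u)"
      by (rule hopping_capped)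
    have min_eq: "min ((2 * u + cubic u a) / M) ((1 - d * k / M - d / M) * u) = (2 * u + cubic u a) / M - max 0 (cubic u a) / M" for u
      unfolding leftover_eq using M_pos
      by (cases "cubic u a \<le> 0") (simp_all add: min_def max_def add_divide_distrib divide_le_0_iff)
    have "c\<^sub>1 / M * \<theta>' x - \<theta> x + m.G \<theta> x = (residual c\<^sub>1 \<theta> \<theta>' x - max 0 (cubic (\<theta> x) a)) / M" for x
    proof -
      have "m.G \<theta> x = G \<theta> x - max 0 (cubic (\<theta> x) a) / M" by (simp add: hop_def min_eq)
      then show ?thesis using residual_eq[of c\<^sub>1 \<theta>' x \<theta>] by (simp add: diff_divide_distrib)
    qed
    then have "c\<^sub>1 / M * \<theta>' x - \<theta> x + m.G \<theta> x < 0" for x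
      using neg\<theta> M_pos by (simp only: divide_neg_pos)
    then show ?thesis by (rule m.T_less_if_residual_neg[OF \<theta>(1) D\<theta>])
  qed
  have "\<exists>v \<Phi>. profile \<Phi> \<and> (\<forall>x. T v \<Phi> x = \<Phi> x) \<and> (\<Phi> \<longlongrightarrow> 0) at_bot \<and> (\<Phi> \<longlongrightarrow> 1) at_top"
  proof (rule front_exists[OF below climb])
    show "\<Phi> x = 0" if "profile \<Phi>" "\<And>x. \<Phi> x \<le> T (c\<^sub>1 / M) \<Phi> x" "(\<Phi> \<longlongrightarrow> 0) at_bot" "\<And>x. \<Phi> x \<le> a" for \<Phi> x
      by (rule no_sub_below_a[OF \<theta>(1) c\<theta> \<theta>(2,3,4) super\<theta> that])
  next
    fix v \<Phi> assume "profile \<Phi>" "\<And>x. T v \<Phi> x = \<Phi> x" "(\<Phi> \<longlongrightarrow> 0) at_bot" "(\<Phi> \<longlongrightarrow> 1) at_top"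
    then show "\<exists>v \<Phi>. profile \<Phi> \<and> (\<forall>x. T v \<Phi> x = \<Phi> x) \<and> (\<Phi> \<longlongrightarrow> 0) at_bot \<and> (\<Phi> \<longlongrightarrow> 1) at_top"
      by (intro exI[of _ v] exI[of _ \<Phi>]) simp
  qed
  then obtain v \<Phi> where "profile \<Phi>" "\<And>x. T v \<Phi> x = \<Phi> x" "(\<Phi> \<longlongrightarrow> 0) at_bot" "(\<Phi> \<longlongrightarrow> 1) at_top"
    by blast
  then have "front a d k (v * M) \<Phi>" unfolding front_iff using M_pos by simp
  then show thesis by (rule that)
qed

end

section \<open>Logistic comparison profiles\<close>

definition logistic :: "real \<Rightarrow> real \<Rightarrow> real"
  where "logistic \<kappa> x = 1 / (1 + exp (- \<kappa> * x))"

lemma one_plus_exp_pos: "0 < 1 + exp (x::real)"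
  by (simp add: add_pos_pos)

lemma logistic_bounds: "0 < logistic \<kappa> x" "logistic \<kappa> x < 1"
  using one_plus_exp_pos[of "- \<kappa> * x"] by (simp_all add: logistic_def)

lemma one_minus_logistic: "1 - logistic \<kappa> x = exp (- \<kappa> * x) / (1 + exp (- \<kappa> * x))"
  using one_plus_exp_pos[of "- \<kappa> * x"] by (simp add: logistic_def field_simps)

lemma logistic_deriv:
  "(logistic \<kappa> has_real_derivative \<kappa> * logistic \<kappa> x * (1 - logistic \<kappa> x)) (at x)"
proof -
  have "1 + exp (- \<kappa> * x) \<noteq> 0" using one_plus_exp_pos[of "- \<kappa> * x"] by linarith
  then have "(logistic \<kappa> has_real_derivative - ((- \<kappa>) * exp (- \<kappa> * x)) / (1 + exp (- \<kappa> * x))\<^sup>2) (at x)"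
    unfolding logistic_def[abs_def] by (auto intro!: derivative_eq_intros simp: power2_eq_square)
  moreover have "- ((- \<kappa>) * exp (- \<kappa> * x)) / (1 + exp (- \<kappa> * x))\<^sup>2 = \<kappa> * logistic \<kappa> x * (1 - logistic \<kappa> x)"
    unfolding one_minus_logistic by (simp add: logistic_def power2_eq_square)
  ultimately show ?thesis by simp
qed

lemma isCont_logistic: "isCont (logistic \<kappa>) x"
  using logistic_deriv by (rule DERIV_isCont)

lemma logistic_limits:
  assumes "0 < \<kappa>" shows "(logistic \<kappa> \<longlongrightarrow> 0) at_bot" "(logistic \<kappa> \<longlongrightarrow> 1) at_top"
proof -
  have "filterlim (\<lambda>x. - \<kappa> * x) at_bot at_top"
    by (rule filterlim_tendsto_neg_mult_at_bot[OF tendsto_const]) (use assms in \<open>auto simp: filterlim_ident\<close>)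
  then have e: "((\<lambda>x. exp (- \<kappa> * x)) \<longlongrightarrow> 0) at_top" by (rule filterlim_compose[OF exp_at_bot])
  then show top: "(logistic \<kappa> \<longlongrightarrow> 1) at_top"
    unfolding logistic_def[abs_def]
    using tendsto_divide[OF tendsto_const[of 1] tendsto_add[OF tendsto_const[of 1] e]] by simp
  have "logistic \<kappa> (- x) = 1 - logistic \<kappa> x" for x
    unfolding one_minus_logistic using one_plus_exp_pos[of "\<kappa> * x"] one_plus_exp_pos[of "- \<kappa> * x"]
    by (simp add: logistic_def exp_minus divide_simps)
  then show "(logistic \<kappa> \<longlongrightarrow> 0) at_bot"
    unfolding filterlim_at_bot_mirror using tendsto_diff[OF tendsto_const[of 1] top] by simp
qed

lemma profile_logistic:
  assumes "0 < \<kappa>" "0 \<le> b" "b \<le> 1" shows "profile (\<lambda>x. b * logistic \<kappa> x)"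
proof (rule profileI)
  show "mono (\<lambda>x. b * logistic \<kappa> x)"
  proof (rule monoI)
    fix x y :: real assume "x \<le> y"
    then have "exp (- \<kappa> * y) \<le> exp (- \<kappa> * x)" using assms(1) by simp
    then have "logistic \<kappa> x \<le> logistic \<kappa> y"
      unfolding logistic_def using one_plus_exp_pos by (intro divide_left_mono) auto
    then show "b * logistic \<kappa> x \<le> b * logistic \<kappa> y" using assms(2) by (rule mult_left_mono)
  qed
  show "0 \<le> b * logistic \<kappa> x" "b * logistic \<kappa> x \<le> 1" for x
    using assms logistic_bounds[of \<kappa> x] by (auto intro: mult_le_one)
qed

text \<open>
  A shift by \<open>h\<close> acts on the odds \<open>\<psi> / (1 - \<psi>)\<close> as multiplication by \<open>1 + E\<close>.  Therefore the differences are rational in \<open>\<psi>\<close> and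
  divisible by \<open>\<psi> (1 - \<psi>)\<close>, as is the derivative.
\<close>
lemma logistic_shift:
  fixes x :: real
  assumes h: "exp (\<kappa> * h) = 1 + E" and E: "0 < E"
  defines "y \<equiv> logistic \<kappa> x"
  shows "logistic \<kappa> (x + h) - y = y * (1 - y) * (E / (1 + y * E))"
    and "logistic \<kappa> (x - h) - y = - (y * (1 - y) * (E / (1 + (1 - y) * E)))"
proof -
  define z where "z = exp (- \<kappa> * x)"
  have z: "0 < z" by (simp add: z_def)
  have y: "y = 1 / (1 + z)" by (simp add: y_def z_def logistic_def)
  have "exp (- \<kappa> * (x + h)) = z / (1 + E)"
    using h by (simp add: z_def algebra_simps exp_add exp_diff exp_minus divide_inverse)
  then have r: "logistic \<kappa> (x + h) = 1 / (1 + z / (1 + E))" by (simp add: logistic_def)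
  have "exp (- \<kappa> * (x - h)) = z * (1 + E)"
    unfolding h[symmetric] z_def exp_add[symmetric] by (simp add: algebra_simps)
  then have l: "logistic \<kappa> (x - h) = 1 / (1 + z * (1 + E))" by (simp add: logistic_def)
  have nz: "1 + z \<noteq> 0" "1 + E \<noteq> 0" "1 + E + z \<noteq> 0" "1 + z * (1 + E) \<noteq> 0"
    using z E by (auto simp: add_pos_pos add_nonneg_eq_0_iff)
  have "1 + y * E = (1 + E + z) / (1 + z)" unfolding y using nz by (simp add: field_simps)
  moreover have "1 - y = z / (1 + z)" unfolding y using nz by (simp add: field_simps)
  moreover have "1 + z / (1 + E) = (1 + E + z) / (1 + E)" using nz by (simp add: field_simps)
  ultimately show "logistic \<kappa> (x + h) - y = y * (1 - y) * (E / (1 + y * E))"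
    unfolding r using nz by (simp add: y divide_simps) (simp add: algebra_simps)
  have "1 + (1 - y) * E = (1 + z * (1 + E)) / (1 + z)" unfolding y using nz by (simp add: field_simps)
  with \<open>1 - y = z / (1 + z)\<close> show "logistic \<kappa> (x - h) - y = - (y * (1 - y) * (E / (1 + (1 - y) * E)))"
    unfolding l using nz by (simp add: y divide_simps) (simp add: algebra_simps)
qed

lemma inverse_one_plus_bounds:
  fixes z :: real assumes "0 \<le> z" shows "1 - z \<le> 1 / (1 + z)" "1 / (1 + z) \<le> 1 - z + z\<^sup>2"
proof -
  have "(1 - z) * (1 + z) \<le> 1" by (simp add: algebra_simps)
  then show "1 - z \<le> 1 / (1 + z)" using assms by (simp add: le_divide_eq)
  have "1 \<le> (1 - z + z\<^sup>2) * (1 + z)" using assms by (simp add: algebra_simps power2_eq_square)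
  then show "1 / (1 + z) \<le> 1 - z + z\<^sup>2" using assms by (simp add: divide_le_eq)
qed

context cubic_lattice
begin

text \<open>
  The coupling terms of the lattice at a logistic profile, divided by \<open>y (1 - y)\<close>, as a function of the value
  \<open>y\<close> of the profile.
\<close>
definition drive :: "real \<Rightarrow> real \<Rightarrow> real"
  where "drive E y = d * k * (E / (1 + y * E)) - d * (E / (1 + (1 - y) * E))"

lemma residual_logistic:
  assumes "exp (\<kappa> * H) = 1 + E" "0 < E"
  shows "residual c (\<lambda>x. b * logistic \<kappa> x) (\<lambda>x. b * (\<kappa> * logistic \<kappa> x * (1 - logistic \<kappa> x))) x
    = b * logistic \<kappa> x * ((1 - logistic \<kappa> x) * (c * \<kappa> + drive E (logistic \<kappa> x))
        + (1 - b * logistic \<kappa> x) * (b * logistic \<kappa> x - a))"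
proof -
  define y where "y = logistic \<kappa> x"
  note s = logistic_shift[OF assms, of x, folded y_def]
  have "b * logistic \<kappa> (x + H) - b * y = b * (y * (1 - y) * (E / (1 + y * E)))"
    "b * logistic \<kappa> (x - H) - b * y = b * (- (y * (1 - y) * (E / (1 + (1 - y) * E))))"
    by (simp_all only: right_diff_distrib[symmetric] s)
  then show ?thesis unfolding residual_def y_def[symmetric] drive_def cubic_def
    by (simp only:) (simp add: algebra_simps)
qed

text \<open>
  Taylor expansion in \<open>E\<close>; up to terms of third order the result is affine in \<open>y\<close>.
\<close>
lemma drive_bounds:
  assumes y: "0 \<le> y" "y \<le> 1" and E: "0 \<le> E"
  shows "drive E y \<le> d * E * (k - 1) + d * E\<^sup>2 * (1 - (k + 1) * y) + d * k * E ^ 3"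
    and "d * E * (k - 1) + d * E\<^sup>2 * (1 - (k + 1) * y) - d * E ^ 3 \<le> drive E y"
proof -
  have sq: "d * k * E * (y * E)\<^sup>2 \<le> d * k * E ^ 3" "d * E * ((1 - y) * E)\<^sup>2 \<le> d * E ^ 3"
  proof -
    have "y\<^sup>2 \<le> 1" "(1 - y)\<^sup>2 \<le> 1" using y by (auto simp: power_le_one)
    then have "d * k * E ^ 3 * y\<^sup>2 \<le> d * k * E ^ 3 * 1" "d * E ^ 3 * (1 - y)\<^sup>2 \<le> d * E ^ 3 * 1"
      using d k E by (intro mult_left_mono; simp)+
    then show "d * k * E * (y * E)\<^sup>2 \<le> d * k * E ^ 3" "d * E * ((1 - y) * E)\<^sup>2 \<le> d * E ^ 3"
      by (simp_all add: power_mult_distrib power2_eq_square power3_eq_cube mult_ac)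
  qed
  have nn: "0 \<le> y * E" "0 \<le> (1 - y) * E" "0 \<le> d * k * E" "0 \<le> d * E" using y E d k by simp_all
  note u = mult_left_mono[OF inverse_one_plus_bounds(1)[OF nn(1)] nn(3)]
    mult_left_mono[OF inverse_one_plus_bounds(2)[OF nn(1)] nn(3)]
    mult_left_mono[OF inverse_one_plus_bounds(1)[OF nn(2)] nn(4)]
    mult_left_mono[OF inverse_one_plus_bounds(2)[OF nn(2)] nn(4)]
  have dr: "drive E y = d * k * E * (1 / (1 + y * E)) - d * E * (1 / (1 + (1 - y) * E))"
    by (simp add: drive_def)
  have lin: "d * k * E * (1 - y * E) - d * E * (1 - (1 - y) * E) = d * E * (k - 1) + d * E\<^sup>2 * (1 - (k + 1) * y)"
    by (simp add: algebra_simps power2_eq_square)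
  have split: "d * k * E * (1 - y * E + (y * E)\<^sup>2) = d * k * E * (1 - y * E) + d * k * E * (y * E)\<^sup>2"
    "d * E * (1 - (1 - y) * E + ((1 - y) * E)\<^sup>2) = d * E * (1 - (1 - y) * E) + d * E * ((1 - y) * E)\<^sup>2"
    by (simp_all only: distrib_left)
  show "drive E y \<le> d * E * (k - 1) + d * E\<^sup>2 * (1 - (k + 1) * y) + d * k * E ^ 3"
    using u(2,3) sq(1) lin unfolding dr split by linarith
  show "d * E * (k - 1) + d * E\<^sup>2 * (1 - (k + 1) * y) - d * E ^ 3 \<le> drive E y"
    using u(1,4) sq(2) lin unfolding dr split by linarith
qed

lemma logistic_profile_facts:
  assumes "0 < \<kappa>" "0 \<le> b" "b \<le> 1"
  shows "((\<lambda>x. b * logistic \<kappa> x) has_real_derivative b * (\<kappa> * logistic \<kappa> x * (1 - logistic \<kappa> x))) (at x)"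
    and "isCont (\<lambda>x. b * (\<kappa> * logistic \<kappa> x * (1 - logistic \<kappa> x))) x"
    and "\<bar>b * (\<kappa> * logistic \<kappa> x * (1 - logistic \<kappa> x))\<bar> \<le> \<kappa>"
    and "((\<lambda>x. b * logistic \<kappa> x) \<longlongrightarrow> 0) at_bot" "((\<lambda>x. b * logistic \<kappa> x) \<longlongrightarrow> b) at_top"
proof -
  show "((\<lambda>x. b * logistic \<kappa> x) has_real_derivative b * (\<kappa> * logistic \<kappa> x * (1 - logistic \<kappa> x))) (at x)"
    by (rule DERIV_cmult[OF logistic_deriv])
  show "isCont (\<lambda>x. b * (\<kappa> * logistic \<kappa> x * (1 - logistic \<kappa> x))) x"
    by (intro continuous_intros isCont_logistic)
  have "b * (\<kappa> * logistic \<kappa> x * (1 - logistic \<kappa> x)) \<le> 1 * (\<kappa> * 1 * 1)"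
    using assms logistic_bounds[of \<kappa> x] by (intro mult_mono mult_nonneg_nonneg) auto
  moreover have "0 \<le> b * (\<kappa> * logistic \<kappa> x * (1 - logistic \<kappa> x))"
    using assms logistic_bounds[of \<kappa> x] by simp
  ultimately show "\<bar>b * (\<kappa> * logistic \<kappa> x * (1 - logistic \<kappa> x))\<bar> \<le> \<kappa>" by simp
  show "((\<lambda>x. b * logistic \<kappa> x) \<longlongrightarrow> 0) at_bot" "((\<lambda>x. b * logistic \<kappa> x) \<longlongrightarrow> b) at_top"
    using tendsto_mult_left[OF logistic_limits(1)[OF assms(1)], of b]
      tendsto_mult_left[OF logistic_limits(2)[OF assms(1)], of b] by simp_all
qed

end

section \<open>Estimates near the continuum limit\<close>

text \<open>
  The width of the logistic profile is chosen such that \<open>E = H / sqrt 2\<close>, that is \<open>d E^2 (k + 1) = 1\<close>.  With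
  this choice the quadratic term of the drive cancels the value \<open>y\<close> of the profile exactly, and the
  residual is a constant up to \<open>O(E)\<close>.  \<open>E\<^sub>0\<close> is the value of \<open>E\<close> at the critical diffusion, and \<open>\<rho>^2\<close> is the
  ratio of \<open>d\<close> and the critical diffusion.
\<close>
locale near_continuum = cubic_lattice +
  fixes \<delta> :: real
  assumes \<delta>: "0 < \<delta>" "\<delta> < 1 / 4" and a_range: "1 / 2 + \<delta> \<le> a" "a \<le> 1 - \<delta>"
    and k_range: "1 < k" "k < 1 + \<delta> ^ 3 / 200" and d_range: "dcrit a k / 2 < d"
begin

definition A where "A = a - 1 / 2"
definition E where "E = 1 / sqrt (d * (k + 1))"
definition E\<^sub>0 where "E\<^sub>0 = (k - 1) / (A * (k + 1))"
definition \<rho> where "\<rho> = E\<^sub>0 / E"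
definition \<kappa> where "\<kappa> = ln (1 + E) / H"

lemma A_bounds: "\<delta> \<le> A" "A \<le> 1 / 2" "0 < A"
  using a_range \<delta> by (auto simp: A_def)

lemma E_pos: "0 < E" using d k by (simp add: E_def)

lemma E_sq: "E\<^sup>2 = 1 / (d * (k + 1))"
  using d k by (simp add: E_def power_divide)

lemma d_E_sq: "d * E\<^sup>2 = 1 / (k + 1)"
  using d k by (simp add: E_sq)

lemma H_eq: "H = sqrt 2 * E"
  using d k by (simp add: E_def mesh_def real_sqrt_mult)

lemma E\<^sub>0_pos: "0 < E\<^sub>0" using A_bounds k_range by (simp add: E\<^sub>0_def)

lemma dcrit_eq: "dcrit a k = 1 / ((k + 1) * E\<^sub>0\<^sup>2)"
proof -
  have "A \<noteq> 0" "k - 1 \<noteq> 0" "k + 1 \<noteq> 0" using A_bounds k_range by auto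
  then show ?thesis
    unfolding dcrit_def E\<^sub>0_def A_def[symmetric]
    by (simp add: power_divide power_mult_distrib power2_eq_square)
qed

lemma \<rho>_sq: "\<rho>\<^sup>2 = d / dcrit a k"
  using d k by (simp add: \<rho>_def power_divide dcrit_eq E_sq)

lemma \<rho>_pos: "0 < \<rho>" using E_pos E\<^sub>0_pos by (simp add: \<rho>_def)

text \<open>
  This is where the lower bound \<open>dcrit a k / 2\<close> on the diffusion enters: it keeps the mesh as fine as
  it is at the critical diffusion, up to a constant factor.
\<close>
lemma E_le: "E \<le> 3 / 2 * E\<^sub>0"
proof (rule power2_le_imp_le)
  have "0 < dcrit a k" using k E\<^sub>0_pos by (simp add: dcrit_eq)
  then have "1 / 2 \<le> \<rho>\<^sup>2" unfolding \<rho>_sq using d_range by (simp add: field_simps)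
  then have "E\<^sup>2 \<le> 2 * E\<^sub>0\<^sup>2" using E_pos by (simp add: \<rho>_def power_divide field_simps)
  also have "\<dots> \<le> (3 / 2 * E\<^sub>0)\<^sup>2" by (simp add: power_mult_distrib power_divide)
  finally show "E\<^sup>2 \<le> (3 / 2 * E\<^sub>0)\<^sup>2" .
  show "0 \<le> 3 / 2 * E\<^sub>0" using E\<^sub>0_pos by simp
qed

lemma E\<^sub>0_small: "E\<^sub>0 < \<delta>\<^sup>2 / 400"
proof -
  have "\<delta> * 2 \<le> A * (k + 1)" using A_bounds k_range \<delta> by (intro mult_mono) auto
  then have "E\<^sub>0 \<le> (k - 1) / (\<delta> * 2)"
    unfolding E\<^sub>0_def using \<delta> k_range A_bounds by (intro divide_left_mono) auto
  also have "\<dots> < (\<delta> ^ 3 / 200) / (\<delta> * 2)"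
    using \<delta> k_range by (intro divide_strict_right_mono) auto
  also have "\<dots> = \<delta>\<^sup>2 / 400" using \<delta> by (simp add: power2_eq_square power3_eq_cube)
  finally show ?thesis .
qed

lemma E\<^sub>0_tiny: "E\<^sub>0 < 1 / 6400" "E < 1 / 4"
proof -
  have "\<delta>\<^sup>2 \<le> (1 / 4)\<^sup>2" using \<delta> by (intro power_mono) auto
  then show "E\<^sub>0 < 1 / 6400" using E\<^sub>0_small by (simp add: power2_eq_square)
  then show "E < 1 / 4" using E_le by simp
qed

lemma \<kappa>_pos: "0 < \<kappa>" using E_pos H_pos by (simp add: \<kappa>_def)

lemma exp_\<kappa>: "exp (\<kappa> * H) = 1 + E" using E_pos H_pos by (simp add: \<kappa>_def)

lemma ln_ge_E: "E / (1 + E) \<le> ln (1 + E)"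
proof -
  have "ln (1 / (1 + E)) \<le> 1 / (1 + E) - 1" using E_pos by (intro ln_le_minus_one) simp
  moreover have "ln (1 / (1 + E)) = - ln (1 + E)" using E_pos by (simp add: ln_div)
  moreover have "1 / (1 + E) - 1 = - (E / (1 + E))" using E_pos by (simp add: field_simps)
  ultimately show ?thesis by simp
qed

lemma \<kappa>_ge: "1 / 2 \<le> \<kappa>"
proof -
  have "4 / 5 * E \<le> E / (1 + E)"
  proof -
    have "4 / 5 * E * (1 + E) \<le> E * 1"
      using E_pos E\<^sub>0_tiny(2) by (simp add: algebra_simps power2_eq_square[symmetric])
    then show ?thesis using E_pos by (simp add: le_divide_eq)
  qed
  moreover have "sqrt 2 \<le> 8 / 5" by (rule real_le_lsqrt) (simp_all add: power2_eq_square)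
  then have "1 / 2 * H \<le> 4 / 5 * E" unfolding H_eq using E_pos by simp
  ultimately have "1 / 2 * H \<le> ln (1 + E)" using ln_ge_E by linarith
  then show ?thesis unfolding \<kappa>_def using H_pos by (simp add: le_divide_eq)
qed

lemma first_order: "d * E * (k - 1) = A * \<rho>"
proof -
  have "d * E * (k - 1) = (d * E\<^sup>2) * (k - 1) / E" using E_pos by (simp add: power2_eq_square)
  also have "\<dots> = A * \<rho>"
    unfolding d_E_sq \<rho>_def E\<^sub>0_def using A_bounds by simp
  finally show ?thesis .
qed

lemma cube_bounds: "d * E ^ 3 \<le> E" "d * k * E ^ 3 \<le> E"
proof -
  have eq: "d * E ^ 3 = E / (k + 1)"
    using d_E_sq by (simp add: power3_eq_cube power2_eq_square mult.assoc[symmetric])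
  show "d * E ^ 3 \<le> E" unfolding eq using E_pos k by (simp add: divide_le_eq)
  have "d * k * E ^ 3 = k * (d * E ^ 3)" by (simp add: mult_ac)
  also have "\<dots> = k * E / (k + 1)" unfolding eq by simp
  finally show "d * k * E ^ 3 \<le> E" using E_pos k by (simp add: divide_le_eq algebra_simps)
qed

lemma const_term: "1 / (k + 1) = 1 / 2 - A * E\<^sub>0 / 2"
proof -
  have "A * E\<^sub>0 = (k - 1) / (k + 1)" unfolding E\<^sub>0_def using A_bounds by simp
  then show ?thesis using k by (simp add: field_simps)
qed

text \<open>
  The speed of the continuum front, multiplied by \<open>\<kappa>\<close>, is \<open>- A (\<rho> - 1)\<close> to leading order, and \<open>2 E\<^sub>0\<close> collects all errors.
\<close>
lemma drive_estimate:
  assumes "0 \<le> y" "y \<le> 1"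
  shows "\<bar>drive E y + y - a - A * (\<rho> - 1)\<bar> \<le> 2 * E\<^sub>0"
proof -
  have sq: "d * E\<^sup>2 * (1 - (k + 1) * y) = 1 / 2 - A * E\<^sub>0 / 2 - y"
    unfolding d_E_sq const_term[symmetric] using k by (simp add: field_simps)
  have "0 \<le> A * E\<^sub>0" "A * E\<^sub>0 \<le> 1 / 2 * E\<^sub>0"
    using A_bounds E\<^sub>0_pos by (simp, intro mult_right_mono) auto
  moreover have "A * (\<rho> - 1) = A * \<rho> - A" "a = A + 1 / 2" by (simp_all add: A_def right_diff_distrib)
  ultimately show ?thesis
    using drive_bounds[OF assms less_imp_le[OF E_pos]] cube_bounds E_le E\<^sub>0_pos
    unfolding sq first_order abs_le_iff by (intro conjI) linarith+
qed

lemma residual_logistic_1: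
  "residual c (\<lambda>x. 1 * logistic \<kappa> x) (\<lambda>x. 1 * (\<kappa> * logistic \<kappa> x * (1 - logistic \<kappa> x))) x
    = logistic \<kappa> x * (1 - logistic \<kappa> x) * (c * \<kappa> + (drive E (logistic \<kappa> x) + logistic \<kappa> x - a))"
  unfolding residual_logistic[OF exp_\<kappa> E_pos] by (simp add: algebra_simps)

lemma
  shows residual_neg: "c * \<kappa> + A * (\<rho> - 1) + 2 * E\<^sub>0 < 0 \<Longrightarrow>
      residual c (\<lambda>x. 1 * logistic \<kappa> x) (\<lambda>x. 1 * (\<kappa> * logistic \<kappa> x * (1 - logistic \<kappa> x))) x < 0"
    and residual_pos: "0 < c * \<kappa> + A * (\<rho> - 1) - 2 * E\<^sub>0 \<Longrightarrow>
      0 < residual c (\<lambda>x. 1 * logistic \<kappa> x) (\<lambda>x. 1 * (\<kappa> * logistic \<kappa> x * (1 - logistic \<kappa> x))) x"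
proof -
  note l = logistic_bounds[of \<kappa> x]
  have e: "\<bar>drive E (logistic \<kappa> x) + logistic \<kappa> x - a - A * (\<rho> - 1)\<bar> \<le> 2 * E\<^sub>0"
    using l by (intro drive_estimate) auto
  have pos: "0 < logistic \<kappa> x * (1 - logistic \<kappa> x)" using l by simp
  show "residual c (\<lambda>x. 1 * logistic \<kappa> x) (\<lambda>x. 1 * (\<kappa> * logistic \<kappa> x * (1 - logistic \<kappa> x))) x < 0"
    if "c * \<kappa> + A * (\<rho> - 1) + 2 * E\<^sub>0 < 0"
    unfolding residual_logistic_1 using that e by (intro mult_pos_neg[OF pos]) linarith
  show "0 < residual c (\<lambda>x. 1 * logistic \<kappa> x) (\<lambda>x. 1 * (\<kappa> * logistic \<kappa> x * (1 - logistic \<kappa> x))) x"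
    if "0 < c * \<kappa> + A * (\<rho> - 1) - 2 * E\<^sub>0"
    unfolding residual_logistic_1 using that e by (intro mult_pos_pos[OF pos]) linarith
qed

text \<open>
  A speed at which the logistic profile is a strict subsolution.  The second profile is \<open>b\<close> times a logistic
  function with \<open>E\<close> replaced by \<open>b E\<close>, the shape of a front from 0 to \<open>b\<close> in the continuum, and \<open>b\<close> halfway
  between \<open>a\<close> and 1 keeps a distance of order \<open>\<delta>\<close> from both.
\<close>
definition c\<^sub>1 where "c\<^sub>1 = (3 * E\<^sub>0 - A * (\<rho> - 1)) / \<kappa>"
definition b where "b = (1 + a) / 2"
definition \<kappa>' where "\<kappa>' = ln (1 + b * E) / H"

lemma b_bounds: "a < b" "b < 1" "0 < b" "3 / 4 \<le> b" "1 - b = (1 - a) / 2" "b - a = (1 - a) / 2"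
  using a a_range \<delta> by (auto simp: b_def field_simps)

lemma \<kappa>'_pos: "0 < \<kappa>'" using mult_pos_pos[OF b_bounds(3) E_pos] H_pos by (simp add: \<kappa>'_def)

lemma exp_\<kappa>': "exp (\<kappa>' * H) = 1 + b * E"
  using E_pos H_pos b_bounds by (simp add: \<kappa>'_def add_pos_pos)

lemma width_ratio: "b * \<kappa> \<le> \<kappa>'" "\<kappa>' \<le> b * (1 + E) * \<kappa>"
proof -
  have "(1 - b) * ln 1 + b * ln (1 + E) \<le> ln ((1 - b) *\<^sub>R 1 + b *\<^sub>R (1 + E))"
    by (rule concave_onD[OF ln_concave]) (use b_bounds E_pos in auto)
  then have "b * ln (1 + E) \<le> ln (1 + b * E)" by (simp add: algebra_simps)
  then show "b * \<kappa> \<le> \<kappa>'" unfolding \<kappa>_def \<kappa>'_def using H_pos by (simp add: divide_right_mono)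
  have "ln (1 + b * E) \<le> b * E" using b_bounds E_pos by (intro ln_add_one_self_le_self) simp
  also have "\<dots> \<le> b * ((1 + E) * ln (1 + E))"
    using ln_ge_E b_bounds E_pos by (intro mult_left_mono) (auto simp: divide_le_eq mult.commute)
  finally show "\<kappa>' \<le> b * (1 + E) * \<kappa>" unfolding \<kappa>_def \<kappa>'_def using H_pos
    by (simp add: divide_right_mono mult.assoc)
qed

text \<open>
  The first term of \<open>c\<^sub>1\<close> is harmless, but \<open>\<rho>\<close> is unbounded.  Since \<open>\<rho> E = E\<^sub>0\<close>, the relative error \<open>E\<close> of
  \<open>\<kappa>' / \<kappa>\<close> as compared to \<open>b\<close> still contributes only \<open>O(E\<^sub>0)\<close>.
\<close>
lemma transport_estimate: "c\<^sub>1 * \<kappa>' \<le> 6 * E\<^sub>0 - b * A * (\<rho> - 1)"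
proof -
  define X where "X = 3 * E\<^sub>0 - A * (\<rho> - 1)"
  have c1: "c\<^sub>1 * \<kappa>' = X * (\<kappa>' / \<kappa>)" by (simp add: c\<^sub>1_def X_def)
  have t: "b \<le> \<kappa>' / \<kappa>" "\<kappa>' / \<kappa> \<le> b * (1 + E)"
    using width_ratio \<kappa>_pos by (auto simp: field_simps)
  have bE0: "b * E\<^sub>0 \<le> E\<^sub>0" using b_bounds E\<^sub>0_pos by (simp add: mult_left_le_one_le)
  have bX: "b * X = 3 * (b * E\<^sub>0) - b * A * (\<rho> - 1)" by (simp add: X_def algebra_simps)
  show ?thesis
  proof (cases "0 \<le> X")
    case True
    have "X * (\<kappa>' / \<kappa>) \<le> X * (b * (1 + E))" using t True by (intro mult_left_mono)
    also have "\<dots> = b * X + b * (E * X)" by (simp add: algebra_simps)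
    also have "b * (E * X) \<le> 3 * E\<^sub>0"
    proof -
      have "E * X = 3 * E * E\<^sub>0 - A * E\<^sub>0 + A * E" using E_pos by (simp add: X_def \<rho>_def field_simps)
      moreover have "3 * E * E\<^sub>0 \<le> 3 * (1 / 4) * E\<^sub>0" using E\<^sub>0_tiny E\<^sub>0_pos by (intro mult_right_mono) auto
      moreover have "A * E \<le> 1 / 2 * E" using A_bounds E_pos by (intro mult_right_mono) auto
      moreover have "0 \<le> A * E\<^sub>0" using A_bounds E\<^sub>0_pos by simp
      ultimately have "E * X \<le> 3 * E\<^sub>0" using E_le E\<^sub>0_pos by linarith
      moreover have "0 \<le> E * X" using True E_pos by simp
      ultimately show ?thesis using mult_left_le_one_le[of "E * X" b] b_bounds by linarith
    qed
    finally show ?thesis using c1 bX bE0 by linarith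
  next
    case False
    have "X * (\<kappa>' / \<kappa>) \<le> X * b" using t(1) False by (intro mult_left_mono_neg) auto
    also have "X * b = b * X" by (rule mult.commute)
    finally show ?thesis using c1 bX bE0 E\<^sub>0_pos by linarith
  qed
qed

lemma low_drive_estimate:
  assumes y: "0 \<le> y" "y \<le> 1"
  shows "c\<^sub>1 * \<kappa>' + drive (b * E) y \<le> b * A + b\<^sup>2 / 2 - b\<^sup>2 * y + 8 * E\<^sub>0"
proof -
  have "drive (b * E) y \<le> d * (b * E) * (k - 1) + d * (b * E)\<^sup>2 * (1 - (k + 1) * y) + d * k * (b * E) ^ 3"
    using y b_bounds E_pos by (intro drive_bounds) auto
  also have "d * (b * E) * (k - 1) = b * A * \<rho>" using first_order by (simp add: mult_ac)
  also have "d * (b * E)\<^sup>2 * (1 - (k + 1) * y) = b\<^sup>2 * ((d * E\<^sup>2) * (1 - (k + 1) * y))"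
    by (simp add: power_mult_distrib mult_ac)
  also have "(d * E\<^sup>2) * (1 - (k + 1) * y) = 1 / (k + 1) - y"
    unfolding d_E_sq using k by (simp add: field_simps)
  also have "d * k * (b * E) ^ 3 = b ^ 3 * (d * k * E ^ 3)" by (simp add: power_mult_distrib)
  also have "\<dots> \<le> 1 * E"
    using b_bounds cube_bounds(2) d k E_pos by (intro mult_mono) (auto simp: power_le_one)
  finally have "drive (b * E) y \<le> b * A * \<rho> + b\<^sup>2 * (1 / (k + 1) - y) + 1 * E" by simp
  moreover have "b\<^sup>2 * (1 / (k + 1) - y) \<le> b\<^sup>2 * (1 / 2 - y)"
    using const_term A_bounds E\<^sub>0_pos by (intro mult_left_mono) auto
  moreover have "b\<^sup>2 * (1 / 2 - y) = b\<^sup>2 / 2 - b\<^sup>2 * y" by (simp add: algebra_simps)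
  moreover have "b * A * (\<rho> - 1) = b * A * \<rho> - b * A" by (simp add: algebra_simps)
  ultimately show ?thesis using transport_estimate E_le E\<^sub>0_pos by linarith
qed

text \<open>
  Without the errors the bracket in the residual is affine in \<open>y\<close> below the level \<open>a\<close>, and equals \<open>- (1 - b) (b - a) / 2\<close> at
  that level; above it the capped reaction vanishes and the drive is at most \<open>- b (1 - b) / 2\<close>.  Both are
  of order at least \<open>\<delta>^2\<close>, which dominates the errors \<open>8 E\<^sub>0\<close>.
\<close>
lemma residual_low:
  "residual c\<^sub>1 (\<lambda>x. b * logistic \<kappa>' x) (\<lambda>x. b * (\<kappa>' * logistic \<kappa>' x * (1 - logistic \<kappa>' x))) x
    - max 0 (cubic (b * logistic \<kappa>' x) a) < 0"
proof -
  define y where "y = logistic \<kappa>' x"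
  have y: "0 < y" "y < 1" using logistic_bounds by (auto simp: y_def)
  define P where "P = b * A + b\<^sup>2 / 2 - b\<^sup>2 * y"
  define Q where "Q = c\<^sub>1 * \<kappa>' + drive (b * E) y"
  have res: "residual c\<^sub>1 (\<lambda>x. b * logistic \<kappa>' x) (\<lambda>x. b * (\<kappa>' * logistic \<kappa>' x * (1 - logistic \<kappa>' x))) x
      = b * y * ((1 - y) * Q) + cubic (b * y) a"
    using residual_logistic[OF exp_\<kappa>', of c\<^sub>1 b x] b_bounds E_pos
    by (simp add: y_def Q_def cubic_def algebra_simps)
  have Q: "Q \<le> P + 8 * E\<^sub>0"
    unfolding Q_def P_def using low_drive_estimate[of y] y by simp
  have by_pos: "0 < b * y" using y b_bounds by simp
  have E0': "8 * E\<^sub>0 < \<delta>\<^sup>2 / 50" using E\<^sub>0_small by simp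
  have da: "\<delta>\<^sup>2 \<le> (1 - a)\<^sup>2" using \<delta> a_range by (intro power_mono) auto
  show ?thesis
  proof (cases "b * y \<le> a")
    case True
    have "(1 - y) * P + (1 - b * y) * (b * y - a) = (1 - b) * (3 / 2 * (b * y) - (a + b / 2))"
      unfolding P_def A_def
      by (simp add: algebra_simps power2_eq_square add_divide_distrib diff_divide_distrib)
    also have "\<dots> \<le> (1 - b) * ((a - b) / 2)"
      using True b_bounds by (intro mult_left_mono) (auto simp: field_simps)
    also have "\<dots> = - ((1 - a)\<^sup>2 / 8)"
    proof -
      have "a - b = - ((1 - a) / 2)" by (simp add: b_def field_simps)
      then show ?thesis unfolding b_bounds(5) by (simp add: power2_eq_square)
    qed
    finally have 1: "(1 - y) * P + (1 - b * y) * (b * y - a) \<le> - ((1 - a)\<^sup>2 / 8)" .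
    have "(1 - y) * Q \<le> (1 - y) * (P + 8 * E\<^sub>0)" using Q y by (intro mult_left_mono) auto
    moreover have "(1 - y) * (P + 8 * E\<^sub>0) = (1 - y) * P + (1 - y) * (8 * E\<^sub>0)" by (simp add: algebra_simps)
    moreover have "(1 - y) * (8 * E\<^sub>0) \<le> 8 * E\<^sub>0" using y E\<^sub>0_pos by (intro mult_left_le_one_le) auto
    moreover have "0 < \<delta>\<^sup>2" using \<delta> by simp
    ultimately have "(1 - y) * Q + (1 - b * y) * (b * y - a) < 0" using 1 E0' da by linarith
    then have "b * y * ((1 - y) * Q + (1 - b * y) * (b * y - a)) < 0" using by_pos by (rule mult_pos_neg[rotated])
    moreover have "b * y * ((1 - y) * Q) + cubic (b * y) a = b * y * ((1 - y) * Q + (1 - b * y) * (b * y - a))"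
      by (simp add: cubic_def algebra_simps)
    ultimately show ?thesis unfolding res y_def[symmetric] by simp
  next
    case False
    have "b * a \<le> b * (b * y)" using False b_bounds by (intro mult_left_mono) auto
    then have "P \<le> - (b * (1 - b) / 2)" unfolding P_def A_def
      by (simp add: algebra_simps power2_eq_square add_divide_distrib diff_divide_distrib)
    moreover have "3 / 4 * (\<delta> / 2) \<le> b * (1 - b)"
      using b_bounds a_range \<delta> by (intro mult_mono) auto
    moreover have "\<delta>\<^sup>2 \<le> \<delta> * 1" unfolding power2_eq_square using \<delta> by (intro mult_left_mono) auto
    ultimately have "Q < 0" using Q E0' \<delta> by linarith
    then have "b * y * ((1 - y) * Q) < 0" using by_pos y by (intro mult_pos_neg) auto
    then show ?thesis unfolding res y_def[symmetric] by simp
  qed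
qed

lemma c\<^sub>1_eq: "c\<^sub>1 * \<kappa> = 3 * E\<^sub>0 - A * (\<rho> - 1)" using \<kappa>_pos by (simp add: c\<^sub>1_def)

text \<open>
  Speeds \<open>3 E\<^sub>0 / \<kappa>\<close> to either side of the leading order speed leave a margin \<open>E\<^sub>0\<close> over the errors.
\<close>
lemma ex_front: "\<exists>c \<Phi>. front a d k c \<Phi>"
proof -
  define c\<^sub>0 where "c\<^sub>0 = (- 3 * E\<^sub>0 - A * (\<rho> - 1)) / \<kappa>"
  have c0: "c\<^sub>0 * \<kappa> = - 3 * E\<^sub>0 - A * (\<rho> - 1)" using \<kappa>_pos by (simp add: c\<^sub>0_def)
  have neg: "c\<^sub>0 * \<kappa> + A * (\<rho> - 1) + 2 * E\<^sub>0 < 0" using c0 E\<^sub>0_pos by simp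
  have pos: "0 < c\<^sub>1 * \<kappa> + A * (\<rho> - 1) - 2 * E\<^sub>0" using c\<^sub>1_eq E\<^sub>0_pos by simp
  have b: "0 \<le> b" "b \<le> 1" using b_bounds by auto
  note l = logistic_profile_facts[OF \<kappa>_pos, of 1, simplified]
  note l' = logistic_profile_facts[OF \<kappa>'_pos b]
  show ?thesis
    by (rule front_exists_between[where B = "max \<kappa> \<kappa>'" and \<psi> = "\<lambda>x. 1 * logistic \<kappa> x"
          and \<psi>' = "\<lambda>x. 1 * (\<kappa> * logistic \<kappa> x * (1 - logistic \<kappa> x))", OF _ _ _ _ _ _ residual_neg[OF neg] residual_pos[OF pos]
          profile_logistic[OF \<kappa>'_pos b] l'(4,5) b_bounds(1) l'(1,2) _ residual_low])
       (use profile_logistic[OF \<kappa>_pos, of 1] l l'(3) in \<open>auto simp: le_max_iff_disj\<close>)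
qed

lemma
  assumes "front a d k c \<Phi>"
  shows speed_gt: "c' * \<kappa> + A * (\<rho> - 1) + 2 * E\<^sub>0 < 0 \<Longrightarrow> c' < c"
    and speed_lt: "0 < c' * \<kappa> + A * (\<rho> - 1) - 2 * E\<^sub>0 \<Longrightarrow> c < c'"
proof -
  note p = profile_logistic[OF \<kappa>_pos zero_le_one order_refl]
  note l = logistic_profile_facts[OF \<kappa>_pos zero_le_one order_refl]
  show "c' < c" if "c' * \<kappa> + A * (\<rho> - 1) + 2 * E\<^sub>0 < 0"
    by (rule speed_greater[OF assms p l(4,5,1,2,3) residual_neg[OF that]])
  show "c < c'" if "0 < c' * \<kappa> + A * (\<rho> - 1) - 2 * E\<^sub>0"
    by (rule speed_less[OF assms p l(4,5,1,2,3) residual_pos[OF that]])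
qed

end

section \<open>The sign of the wave speed near the critical diffusion\<close>

theorem corollary2p3:
  fixes \<delta> :: real
  assumes "0 < \<delta>" and "\<delta> < 1/4"
  shows "\<exists>kstar>1. \<forall>a\<in>{1/2 + \<delta>..1 - \<delta>}. \<forall>k\<in>{1<..<kstar}.
    \<bar>wavespeed a (dcrit a k) k\<bar> \<le> dcrit a k powr (- 1/4) \<and>
    (\<forall>d. d > dcrit a k * (1 + dcrit a k powr (- 1/4)) \<longrightarrow> wavespeed a d k < 0) \<and>
    (\<forall>d. 1/2 * dcrit a k < d \<and> d < dcrit a k * (1 - dcrit a k powr (- 1/4)) \<longrightarrow>
      wavespeed a d k > 0)"
proof (intro exI[of _ "1 + \<delta> ^ 3 / 200"] conjI ballI)
  show "1 + \<delta> ^ 3 / 200 > 1" using assms by simp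
  fix a k assume a: "a \<in> {1/2 + \<delta>..1 - \<delta>}" and k: "k \<in> {1<..<1 + \<delta> ^ 3 / 200}"
  define D where "D = dcrit a k"
  define \<epsilon> where "\<epsilon> = D powr (- 1/4)"
  define s where "s = a - 1 / 2"
  define e where "e = (k - 1) / (s * (k + 1))"
  have D_pos: "0 < D" using a k assms unfolding D_def dcrit_def by auto
  have loc: "near_continuum a d k \<delta>" if "D / 2 < d" for d
    using a k assms that D_pos by unfold_locales (auto simp: D_def)
  interpret D: near_continuum a D k \<delta> by (rule loc) (use D_pos in simp)
  have E0: "D.E\<^sub>0 = e" "0 < e" "e < \<delta>\<^sup>2 / 400"
    using D.E\<^sub>0_pos D.E\<^sub>0_small by (simp_all add: e_def s_def D.E\<^sub>0_def D.A_def)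
  have s: "\<delta> \<le> s" using a by (simp add: s_def)
  have \<epsilon>_pos: "0 < \<epsilon>" using D_pos by (simp add: \<epsilon>_def)
  have "\<epsilon> ^ 4 = D powr (- 1)"
    using D_pos by (simp add: \<epsilon>_def powr_realpow[symmetric] powr_powr)
  also have "\<dots> = (k + 1) * e\<^sup>2"
    using D.dcrit_eq D_pos unfolding E0 D_def[symmetric] by (simp add: powr_minus_divide)
  finally have \<epsilon>4: "(\<epsilon>\<^sup>2)\<^sup>2 = (k + 1) * e\<^sup>2" by simp
  have "e\<^sup>2 \<le> (k + 1) * e\<^sup>2" using k mult_right_mono[of 1 "k + 1" "e\<^sup>2"] by simp
  then have \<epsilon>_ge: "e \<le> \<epsilon>\<^sup>2" unfolding \<epsilon>4[symmetric] by (rule power2_le_imp_le) simp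
  \<comment> \<open>All errors are bounded by \<open>2 * e\<close>, hence by \<open>2 * \<epsilon>\<^sup>2\<close>, while the signals are of order \<open>\<delta> * \<epsilon>\<close>.\<close>
  have \<epsilon>_less: "\<epsilon> < \<delta> / 12"
  proof (rule ccontr)
    assume "\<not> \<epsilon> < \<delta> / 12"
    then have "(\<delta> / 12) ^ 4 \<le> \<epsilon> ^ 4" using assms by (intro power_mono) auto
    also have "\<epsilon> ^ 4 = (k + 1) * e\<^sup>2" using \<epsilon>4 by simp
    also have "\<dots> \<le> 3 * (\<delta>\<^sup>2 / 400)\<^sup>2"
    proof (rule mult_mono)
      have "\<delta> ^ 3 \<le> 1" using assms by (intro power_le_one) auto
      then show "k + 1 \<le> 3" using k by simp
      show "e\<^sup>2 \<le> (\<delta>\<^sup>2 / 400)\<^sup>2" using E0 by (intro power_mono) auto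
    qed auto
    also have "\<dots> < (\<delta> / 12) ^ 4" using assms by (simp add: power_divide)
    finally show False by simp
  qed
  have \<delta>\<epsilon>: "12 * \<epsilon>\<^sup>2 < \<delta> * \<epsilon>"
    using mult_strict_right_mono[OF \<epsilon>_less \<epsilon>_pos] by (simp add: power2_eq_square)
  have speed: "\<exists>c. wavespeed a d k = c \<and>
      (\<forall>c'. c' * near_continuum.\<kappa> d k + s * (sqrt (d / D) - 1) + 2 * e < 0 \<longrightarrow> c' < c) \<and>
      (\<forall>c'. 0 < c' * near_continuum.\<kappa> d k + s * (sqrt (d / D) - 1) - 2 * e \<longrightarrow> c < c')"
    if d: "D / 2 < d" for d
  proof -
    interpret near_continuum a d k \<delta> by (rule loc[OF d])
    obtain c \<Phi> where f: "front a d k c \<Phi>" using ex_front by blast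
    have "\<rho> = sqrt (d / D)" using \<rho>_sq \<rho>_pos by (simp add: D_def real_sqrt_unique)
    moreover have "local.A = s" "local.E\<^sub>0 = e"
      unfolding local.A_def local.E\<^sub>0_def s_def e_def by simp_all
    ultimately show ?thesis using wavespeed_eq[OF f] speed_gt[OF f] speed_lt[OF f] by auto
  qed
  have \<epsilon>_sq: "48 * \<epsilon>\<^sup>2 < \<epsilon>"
  proof -
    have "\<delta> * \<epsilon> \<le> 1 / 4 * \<epsilon>" using assms \<epsilon>_pos by (intro mult_right_mono) auto
    then show ?thesis using \<delta>\<epsilon> by linarith
  qed
  show "\<bar>wavespeed a (dcrit a k) k\<bar> \<le> dcrit a k powr (- 1/4)"
  proof -
    have "D / 2 < D" using D_pos by simp
    then obtain c where c: "wavespeed a D k = c"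
      "\<And>c'. c' * D.\<kappa> + s * (sqrt (D / D) - 1) + 2 * e < 0 \<Longrightarrow> c' < c"
      "\<And>c'. 0 < c' * D.\<kappa> + s * (sqrt (D / D) - 1) - 2 * e \<Longrightarrow> c < c'"
      using speed by blast
    have "\<epsilon> * (1 / 2) \<le> \<epsilon> * D.\<kappa>" using \<epsilon>_pos D.\<kappa>_ge by (intro mult_left_mono) auto
    then have *: "2 * e < \<epsilon> * D.\<kappa>" using \<epsilon>_sq \<epsilon>_ge E0(2) by linarith
    have "c < \<epsilon>" by (rule c(3)) (use * D_pos in simp)
    moreover have "- \<epsilon> < c" by (rule c(2)) (use * D_pos in simp)
    ultimately show ?thesis unfolding D_def[symmetric] \<epsilon>_def[symmetric] c(1) by simp
  qed
  show "\<forall>d. d > dcrit a k * (1 + dcrit a k powr (- 1/4)) \<longrightarrow> wavespeed a d k < 0"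
    unfolding D_def[symmetric] \<epsilon>_def[symmetric]
  proof (intro allI impI)
    fix d assume d: "d > D * (1 + \<epsilon>)"
    then have "1 + \<epsilon> < d / D" using D_pos by (simp add: less_divide_eq mult.commute)
    have "D < D * (1 + \<epsilon>)" using D_pos \<epsilon>_pos by simp
    then have "D / 2 < d" using d D_pos by linarith
    from speed[OF this] obtain c where c: "wavespeed a d k = c"
      "\<And>c'. 0 < c' * near_continuum.\<kappa> d k + s * (sqrt (d / D) - 1) - 2 * e \<Longrightarrow> c < c'"
      by blast
    have "(1 + \<epsilon> / 3)\<^sup>2 = 1 + 2 / 3 * \<epsilon> + \<epsilon>\<^sup>2 / 9" by (simp add: power2_eq_square algebra_simps)
    also have "\<dots> < d / D" using \<open>1 + \<epsilon> < d / D\<close> \<epsilon>_sq \<epsilon>_pos by linarith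
    finally have "1 + \<epsilon> / 3 < sqrt (d / D)" by (rule real_less_rsqrt)
    then have "\<delta> * (\<epsilon> / 3) \<le> s * (sqrt (d / D) - 1)"
      using s assms \<epsilon>_pos by (intro mult_mono) auto
    then have "c < 0" using \<delta>\<epsilon> \<epsilon>_ge E0(2) by (intro c(2)) simp
    then show "wavespeed a d k < 0" using c(1) by simp
  qed
  show "\<forall>d. 1/2 * dcrit a k < d \<and> d < dcrit a k * (1 - dcrit a k powr (- 1/4)) \<longrightarrow>
      wavespeed a d k > 0"
    unfolding D_def[symmetric] \<epsilon>_def[symmetric]
  proof (intro allI impI)
    fix d assume d: "1 / 2 * D < d \<and> d < D * (1 - \<epsilon>)"
    then have "d / D < 1 - \<epsilon>" using D_pos by (simp add: divide_less_eq mult.commute)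
    have "D / 2 < d" using d by simp
    from speed[OF this] obtain c where c: "wavespeed a d k = c"
      "\<And>c'. c' * near_continuum.\<kappa> d k + s * (sqrt (d / D) - 1) + 2 * e < 0 \<Longrightarrow> c' < c"
      by blast
    have "(1 - \<epsilon> / 2)\<^sup>2 = 1 - \<epsilon> + \<epsilon>\<^sup>2 / 4" by (simp add: power2_eq_square algebra_simps)
    then have "d / D < (1 - \<epsilon> / 2)\<^sup>2" using \<open>d / D < 1 - \<epsilon>\<close> by (smt (verit) zero_le_power2 divide_nonneg_nonneg)
    then have "sqrt (d / D) < 1 - \<epsilon> / 2"
      using \<epsilon>_less assms D_pos \<open>D / 2 < d\<close> by (intro real_less_lsqrt) auto
    then have "\<delta> * (\<epsilon> / 2) \<le> s * (1 - sqrt (d / D))"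
      using s assms \<epsilon>_pos by (intro mult_mono) auto
    moreover have "s * (1 - sqrt (d / D)) = - (s * (sqrt (d / D) - 1))" by (simp add: algebra_simps)
    ultimately have "0 < c" using \<delta>\<epsilon> \<epsilon>_ge E0(2) by (intro c(2)) simp
    then show "wavespeed a d k > 0" using c(1) by simp
  qed
qed

end
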